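(* Let $n\ge 2$, let $T\subset\mathbb{R}^n$ be a nondegenerate $n$-simplex with Alfeld split $T^z$, and let $r\ge 0$ and $1\le k\le n$ be integers. Suppose that $\omega\in V_{d,r}^k(T^z)$ and $d\omega=0$. Then there exists $\rho\in M_{r+1}^{k-1}(T^z)$ such that $d\rho=\omega$.
   Context: Let $T=[x_0,\dots,x_n]$ be a nondegenerate $n$-simplex in $\mathbb{R}^n$ and let $z=\frac1{n+1}\sum_{i=0}^n x_i$ be its barycenter. The Alfeld split is $T^z=\{T_0,\dots,T_n\}$, where $T_i$ is the $n$-simplex with vertices $z$ and all $x_j$, $j\ne i$. For an $n$-simplex $S$, $\mathcal{P}_r\Lambda^k(S)$ is the space of differential $k$-forms on $S$ whose coefficients are polynomials of total degree at most $r$ (it is $\{0\}$ if $r<0$). $L^2\Lambda^k(T)$ and $C^0\Lambda^k(T)$ are the $k$-forms on $T$ with $L^2$ coefficients, respectively with coefficients continuous on the closed simplex. $d$ is the exterior derivative (in the weak sense). Spaces: $V_r^k(T^z)=\{\omega\in L^2\Lambda^k(T):\omega|_{T_i}\in\mathcal{P}_r\Lambda^k(T_i),\ 0\le i\le n\}$; $V_{d,r}^k(T^z)=\{\omega\in V_r^k(T^z): d\omega\in L^2\Lambda^{k+1}(T)\}$; $M_r^k(T^z)=\{\omega\in C^0\Lambda^k(T):\omega|_{T_i}\in\mathcal{P}_r\Lambda^k(T_i),\ 0\le i\le n\}$. *)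

theory Defs
  imports "HOL-Analysis.Analysis"
begin

text \<open>
  Alternating \<open>k\<close>-linear forms on \<open>'a\<close>, as functions on lists of \<open>k\<close> vectors.  Lists of any other
  length are sent to \<open>0\<close>, so that equality of forms is equality of functions.
\<close>

definition alt_maps :: "nat \<Rightarrow> ('a::real_vector list \<Rightarrow> real) set" where
  "alt_maps k = {f.
     (\<forall>vs. length vs \<noteq> k \<longrightarrow> f vs = 0) \<and>
     (\<forall>vs i. length vs = k \<and> i < k \<longrightarrow> linear (\<lambda>u. f (vs[i := u]))) \<and>
     (\<forall>vs i j. length vs = k \<and> i < j \<and> j < k \<and> vs ! i = vs ! j \<longrightarrow> f vs = 0)}"

type_synonym 'a form = "'a \<Rightarrow> 'a list \<Rightarrow> real"

definition forms_on :: "'a::real_vector set \<Rightarrow> nat \<Rightarrow> 'a form set" where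
  "forms_on S k = {\<omega>. \<forall>x\<in>S. \<omega> x \<in> alt_maps k}"

text \<open>
  The coefficients of a \<open>k\<close>-form \<open>\<omega>\<close> are the functions \<open>\<lambda>x. \<omega> x es\<close> for \<open>es \<in> basis_lists k\<close>.  The
  lists are not required to be increasing: since \<open>\<omega> x\<close> is alternating, the additional lists only
  yield the coefficients up to sign and the zero function.
\<close>

definition basis_lists :: "nat \<Rightarrow> 'a::euclidean_space list set" where
  "basis_lists k = {es. length es = k \<and> set es \<subseteq> Basis}"

definition polys_le :: "nat \<Rightarrow> ('a::euclidean_space \<Rightarrow> real) set" where
  "polys_le r = {p. \<exists>c. \<forall>x. p x =
     (\<Sum>a | a \<in> Basis \<rightarrow>\<^sub>E {..r} \<and> (\<Sum>b\<in>Basis. a b) \<le> r. c a * (\<Prod>b\<in>Basis. (x \<bullet> b) ^ a b))}"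

definition poly_forms_on :: "'a::euclidean_space set \<Rightarrow> nat \<Rightarrow> nat \<Rightarrow> 'a form set" where
  "poly_forms_on S r k = {\<omega> \<in> forms_on S k.
     \<forall>es \<in> basis_lists k. \<exists>p \<in> polys_le r. \<forall>x\<in>S. \<omega> x es = p x}"

text \<open>
  Elements of \<open>L2_forms_on S k\<close> are representatives; forms that agree almost everywhere on \<open>S\<close> are
  not identified.
\<close>

definition L2_forms_on :: "'a::euclidean_space set \<Rightarrow> nat \<Rightarrow> 'a form set" where
  "L2_forms_on S k = {\<omega> \<in> forms_on S k. \<forall>es \<in> basis_lists k.
     (\<lambda>x. \<omega> x es) \<in> borel_measurable (lebesgue_on S) \<and>
     integrable (lebesgue_on S) (\<lambda>x. (\<omega> x es)\<^sup>2)}"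

definition C0_forms_on :: "'a::euclidean_space set \<Rightarrow> nat \<Rightarrow> 'a form set" where
  "C0_forms_on S k = {\<omega> \<in> forms_on S k. \<forall>es \<in> basis_lists k. continuous_on S (\<lambda>x. \<omega> x es)}"

fun C_diff :: "nat \<Rightarrow> ('a::euclidean_space \<Rightarrow> real) \<Rightarrow> bool" where
  "C_diff 0 f \<longleftrightarrow> continuous_on UNIV f"
| "C_diff (Suc m) f \<longleftrightarrow> (\<forall>x. f differentiable (at x)) \<and>
     (\<forall>v. C_diff m (\<lambda>x. frechet_derivative f (at x) v))"

definition test_functions :: "'a::euclidean_space set \<Rightarrow> ('a \<Rightarrow> real) set" where
  "test_functions U = {\<phi>. (\<forall>m. C_diff m \<phi>) \<and>
     compact (closure {x. \<phi> x \<noteq> 0}) \<and> closure {x. \<phi> x \<noteq> 0} \<subseteq> U}"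

text \<open>
  \<open>weak_ext_deriv S k \<omega> \<eta>\<close> says that \<open>\<eta>\<close> is the weak exterior derivative of the \<open>k\<close>-form \<open>\<omega>\<close> on the
  interior of \<open>S\<close>.  It is the formula
  \<open>d\<omega> (v\<^sub>0, \<dots>, v\<^sub>k) = (\<Sum>i\<le>k. (-1) ^ i * \<partial>\<^bsub>v\<^sub>i\<^esub> \<omega> (v\<^sub>0, \<dots>, v\<^sub>i\<^sub>-\<^sub>1, v\<^sub>i\<^sub>+\<^sub>1, \<dots>, v\<^sub>k))\<close> for constant vectors,
  multiplied by a test function and integrated by parts.  It is meant for forms that are locally
  integrable on the interior of \<open>S\<close>.
\<close>

definition weak_ext_deriv ::
    "'a::euclidean_space set \<Rightarrow> nat \<Rightarrow> 'a form \<Rightarrow> 'a form \<Rightarrow> bool" where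
  "weak_ext_deriv S k \<omega> \<eta> \<longleftrightarrow>
     (\<forall>\<phi> \<in> test_functions (interior S). \<forall>vs. length vs = Suc k \<longrightarrow>
        (LINT x|lebesgue_on S. \<eta> x vs * \<phi> x) =
        - (\<Sum>i\<le>k. (- 1) ^ i *
             (LINT x|lebesgue_on S.
                \<omega> x (take i vs @ drop (Suc i) vs) * frechet_derivative \<phi> (at x) (vs ! i))))"

text \<open>The simplex \<open>T\<close> is given by its vertex set \<open>X\<close>, that is, \<open>T = convex hull X\<close>.\<close>

definition barycenter :: "'a::real_vector set \<Rightarrow> 'a" where
  "barycenter X = (1 / real (card X)) *\<^sub>R (\<Sum>x\<in>X. x)"

definition alfeld_split :: "'a::real_vector set \<Rightarrow> 'a set set" where
  "alfeld_split X = (\<lambda>x. convex hull (insert (barycenter X) (X - {x}))) ` X"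

definition V_space :: "'a::euclidean_space set \<Rightarrow> nat \<Rightarrow> nat \<Rightarrow> 'a form set" where
  "V_space X r k = {\<omega> \<in> L2_forms_on (convex hull X) k.
     \<forall>S \<in> alfeld_split X. \<exists>p \<in> poly_forms_on S r k. AE x in lebesgue_on S. \<omega> x = p x}"

definition Vd_space :: "'a::euclidean_space set \<Rightarrow> nat \<Rightarrow> nat \<Rightarrow> 'a form set" where
  "Vd_space X r k = {\<omega> \<in> V_space X r k.
     \<exists>\<eta> \<in> L2_forms_on (convex hull X) (Suc k). weak_ext_deriv (convex hull X) k \<omega> \<eta>}"

definition M_space :: "'a::euclidean_space set \<Rightarrow> nat \<Rightarrow> nat \<Rightarrow> 'a form set" where
  "M_space X r k = {\<omega> \<in> C0_forms_on (convex hull X) k.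
     \<forall>S \<in> alfeld_split X. \<omega> \<in> poly_forms_on S r k}"

end

theory Submission
  imports Defs "HOL-Computational_Algebra.Polynomial"
begin

text \<open>
  Let \<open>\<lambda>\<^sub>l\<close> be the barycentric coordinate of the vertex \<open>l\<close>, let \<open>z\<close> be the barycenter and \<open>e\<^sub>m = m - z\<close>.  The
  simplex of the split opposite to \<open>l\<close> is the part of \<open>T\<close> where \<open>\<lambda>\<^sub>l\<close> is the least coordinate, two
  of them meet where \<open>\<lambda>\<^sub>l = \<lambda>\<^sub>m\<close>, and the derivative of \<open>\<lambda>\<^sub>m - \<lambda>\<^sub>l\<close> along \<open>e\<^sub>m\<close> is \<open>1\<close> for all \<open>l \<noteq> m\<close>.  Extend each
  piece of \<open>\<omega>\<close> to a polynomial form \<open>\<alpha>\<^sub>l\<close> on the whole space.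

  The weak equation \<open>d\<omega> = 0\<close> says two things about the pieces: each \<open>\<alpha>\<^sub>l\<close> is closed
  (\<open>weakly_closed_piece\<close>), and \<open>\<alpha>\<^sub>l\<close> and \<open>\<alpha>\<^sub>m\<close> have the same pullback to the hyperplane \<open>\<lambda>\<^sub>l = \<lambda>\<^sub>m\<close>
  (\<open>weakly_closed_tangential\<close>).  From here on the construction of the potential is algebra, and is the
  content of \<open>continuous_primitive\<close>.

  The pieces are removed one after the other, by subtracting exterior derivatives of continuous
  forms.  The first piece has a polynomial primitive by the Poincare lemma.  Suppose that the pieces in \<open>Y\<close>
  already vanish, and let \<open>\<beta>\<close> be the next piece, with index \<open>m\<close>.  Then the pullback of \<open>\<beta>\<close> to
  \<open>\<lambda>\<^sub>m = \<lambda>\<^sub>l\<close> vanishes for all \<open>l \<in> Y\<close>.  Choose one such \<open>l\<close>, and integrate the contraction of \<open>\<beta>\<close> with \<open>e\<^sub>m\<close>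
  along \<open>e\<^sub>m\<close>, starting at \<open>\<lambda>\<^sub>m = \<lambda>\<^sub>l\<close>.  The result is a polynomial form \<open>\<gamma>\<close>, of degree one more, with
  \<open>d\<gamma> = \<beta>\<close> and with zero contraction with \<open>e\<^sub>m\<close> (\<open>relative_poincare\<close>).  Let \<open>y\<close> be the retraction
  \<open>y x = x - (\<lambda>\<^sub>m x - min\<^sub>j \<lambda>\<^sub>j x) e\<^sub>m\<close>.  It is continuous and piecewise affine, the identity on the piece \<open>m\<close>, and it
  projects the piece \<open>l\<close> along \<open>e\<^sub>m\<close> into the hyperplane \<open>\<lambda>\<^sub>m = \<lambda>\<^sub>l\<close>.  Since \<open>\<gamma>\<close> does not see the direction \<open>e\<^sub>m\<close>,
  the pullback of \<open>\<gamma>\<close> by \<open>y\<close> is the plain composition of the coefficients with \<open>y\<close>.  This is why it is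
  continuous in all its components, and not only in the tangential ones.  Its exterior derivative, the pullback of \<open>\<beta>\<close>
  by \<open>y\<close>, is \<open>\<beta>\<close> on the piece \<open>m\<close> and \<open>0\<close> on the pieces in \<open>Y\<close>, so that
  subtracting it also removes the piece \<open>m\<close>.

  The potential is Lipschitz on bounded sets.  So its weak exterior derivative is the one computed on the pieces: the difference
  quotients of a Lipschitz function with compact support have integral \<open>0\<close> and converge boundedly, which
  gives the integration by parts (\<open>integral_derivative_zero\<close>, \<open>integration_by_parts\<close>).
\<close>

section \<open>Polynomial functions of bounded degree\<close>

text \<open>An inductive presentation of \<open>polys_le\<close> (see \<open>polys_le_eq_polyf\<close>), for proofs by induction on
  polynomials.\<close>

inductive polyf :: "nat \<Rightarrow> ('a::euclidean_space \<Rightarrow> real) \<Rightarrow> bool" where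
  const: "polyf r (\<lambda>x. c)"
| add: "polyf r f \<Longrightarrow> polyf r g \<Longrightarrow> polyf r (\<lambda>x. f x + g x)"
| coord: "polyf r f \<Longrightarrow> b \<in> Basis \<Longrightarrow> polyf (Suc r) (\<lambda>x. (x \<bullet> b) * f x)"

lemma polyf_Suc: "polyf r f \<Longrightarrow> polyf (Suc r) f"
  by (induction rule: polyf.induct) (auto intro: polyf.intros)

lemma polyf_mono: assumes "polyf r f" "r \<le> s" shows "polyf s f"
  using assms(2,1) by (induction rule: dec_induct) (auto intro: polyf_Suc)

lemma polyf_scale: "polyf r f \<Longrightarrow> polyf r (\<lambda>x. c * f x)"
proof (induction rule: polyf.induct)
  case (add r f g) then show ?case by (auto simp: distrib_left intro: polyf.add)
next
  case (coord r f b) 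
  have "polyf (Suc r) (\<lambda>x. (x \<bullet> b) * (c * f x))" using coord by (auto intro: polyf.coord)
  then show ?case by (simp add: mult.left_commute)
qed (auto intro: polyf.const)

lemma polyf_diff: "polyf r f \<Longrightarrow> polyf r g \<Longrightarrow> polyf r (\<lambda>x. f x - g x)"
  using polyf.add[of r f "\<lambda>x. -1 * g x"] polyf_scale[of r g "-1"] by simp

lemma polyf_sum: "(\<And>i. i \<in> I \<Longrightarrow> polyf r (f i)) \<Longrightarrow> polyf r (\<lambda>x. \<Sum>i\<in>I. f i x)"
  by (induction I rule: infinite_finite_induct) (auto intro: polyf.const polyf.add)

lemma polyf_inner_mult:
  assumes "polyf r f" shows "polyf (Suc r) (\<lambda>x. (c + a \<bullet> x) * f x)"
proof -
  have "(\<lambda>x. (c + a \<bullet> x) * f x) = (\<lambda>x. c * f x + (\<Sum>b\<in>Basis. (a \<bullet> b) * ((x \<bullet> b) * f x)))"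
    by (subst euclidean_inner) 
       (auto simp: fun_eq_iff algebra_simps sum_distrib_left sum_distrib_right inner_commute intro!: sum.cong)
  moreover have "polyf (Suc r) (\<lambda>x. c * f x + (\<Sum>b\<in>Basis. (a \<bullet> b) * ((x \<bullet> b) * f x)))"
    using assms by (intro polyf.add polyf_sum polyf_scale polyf_Suc polyf.coord)
  ultimately show ?thesis by simp
qed

lemma polyf_mult:
  assumes "polyf r f" "polyf s g" shows "polyf (r + s) (\<lambda>x. f x * g x)"
  using assms
proof (induction rule: polyf.induct)
  case (const r c) then show ?case by (intro polyf_scale) (auto intro: polyf_mono)
next
  case (add r f g) then show ?case by (simp add: distrib_right polyf.add)
next
  case (coord r f b) then show ?case using polyf.coord by (fastforce simp: mult.assoc)
qed

text \<open>The affine maps \<open>x \<mapsto> x - (c + a \<bullet> x) *\<^sub>R e\<close> include the projections along \<open>e\<close> onto a transverse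
  hyperplane.  These describe, on each piece of the split, the retraction with which primitives are composed.\<close>

lemma polyf_shear:
  assumes "polyf r f" shows "polyf r (\<lambda>x. f (x - (c + a \<bullet> x) *\<^sub>R e))"
  using assms
proof (induction rule: polyf.induct)
  case (coord r f b)
  have "(x - (c + a \<bullet> x) *\<^sub>R e) \<bullet> b = - c * (e \<bullet> b) + (b - (e \<bullet> b) *\<^sub>R a) \<bullet> x" for x
    by (simp add: algebra_simps inner_commute)
  then show ?case using polyf_inner_mult[OF coord.IH, of "- c * (e \<bullet> b)"] by simp
qed (auto intro: polyf.intros)

lemma polyf_affine: "polyf (Suc 0) (\<lambda>x. c + a \<bullet> x)"
  using polyf_inner_mult[OF polyf.const[of 0 1], of c a] by simp

lemma polyf_line:
  assumes "polyf r f" shows "\<exists>q. \<forall>t. f (x + t *\<^sub>R v) = poly q t"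
  using assms
proof (induction rule: polyf.induct)
  case (const r c) show ?case by (intro exI[of _ "[:c:]"]) simp
next
  case (add r f g) then show ?case by (metis poly_add)
next
  case (coord r f b) 
  then obtain q where q: "\<forall>t. f (x + t *\<^sub>R v) = poly q t" by blast
  show ?case by (intro exI[of _ "[:x \<bullet> b, v \<bullet> b:] * q"]) (simp add: q inner_add_left algebra_simps)
qed

text \<open>On a line, \<open>f\<close> is a univariate polynomial, here with infinitely many roots.\<close>

lemma polyf_zero_line:
  assumes "polyf r f" "0 < \<epsilon>" "\<And>t. 0 < t \<Longrightarrow> t < \<epsilon> \<Longrightarrow> f (x + t *\<^sub>R v) = 0"
  shows "f (x + s *\<^sub>R v) = 0"
proof -
  obtain q where q: "\<forall>t. f (x + t *\<^sub>R v) = poly q t" using polyf_line[OF assms(1)] by blast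
  have "{0<..<\<epsilon>} \<subseteq> {t. poly q t = 0}" using assms(3) q by auto
  moreover have "infinite {0<..<\<epsilon>}" using assms(2) by simp
  ultimately have "q = 0" using poly_roots_finite[of q] infinite_super by blast
  then show ?thesis using q by simp
qed

lemma polyf_zero_open:
  assumes "polyf r f" "open U" "p \<in> U" "\<And>x. x \<in> U \<Longrightarrow> f x = 0"
  shows "f x = 0"
proof -
  obtain d where d: "0 < d" "ball p d \<subseteq> U" using assms(2,3) openE by blast
  define \<epsilon> where "\<epsilon> = d / (norm (x - p) + 1)"
  have "\<epsilon> > 0" unfolding \<epsilon>_def using d by (intro divide_pos_pos) (auto intro: add_nonneg_pos)
  moreover have "f (p + t *\<^sub>R (x - p)) = 0" if "0 < t" "t < \<epsilon>" for t
  proof -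
    have "t * norm (x - p) \<le> t * (norm (x - p) + 1)" using that by simp
    also have "\<dots> < d" using that(2) unfolding \<epsilon>_def by (subst (asm) pos_less_divide_eq) (auto intro: add_nonneg_pos)
    finally have "p + t *\<^sub>R (x - p) \<in> ball p d" using that by (simp add: dist_norm)
    then show ?thesis using d assms(4) by blast
  qed
  ultimately have "f (p + 1 *\<^sub>R (x - p)) = 0" by (rule polyf_zero_line[OF assms(1)])
  then show ?thesis by simp
qed

lemma polyf_prod: 
  assumes "finite A" "A \<subseteq> Basis"
  shows "polyf (\<Sum>b\<in>A. a b) (\<lambda>x. \<Prod>b\<in>A. (x \<bullet> b) ^ a b)"
  using assms
proof (induction A)
  case empty then show ?case by (simp add: polyf.const)
next
  case (insert i A)
  have "polyf m (\<lambda>x. (x \<bullet> i) ^ m)" for m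
    using insert.prems by (induction m) (auto intro: polyf.const polyf.coord)
  from polyf_mult[OF this[of "a i"] insert.IH] show ?case using insert by simp
qed

lemma polys_le_sum:
  assumes "\<And>i. i \<in> I \<Longrightarrow> f i \<in> polys_le r"
  shows "(\<lambda>x. \<Sum>i\<in>I. f i x) \<in> polys_le r"
proof -
  have "\<forall>i\<in>I. \<exists>c. \<forall>x. f i x = (\<Sum>a | a \<in> Basis \<rightarrow>\<^sub>E {..r} \<and> (\<Sum>b\<in>Basis. a b) \<le> r. c a * (\<Prod>b\<in>Basis. (x \<bullet> b) ^ a b))"
    using assms unfolding polys_le_def by blast
  from bchoice[OF this] obtain c where c: "\<forall>i\<in>I. \<forall>x. f i x = (\<Sum>a | a \<in> Basis \<rightarrow>\<^sub>E {..r} \<and> (\<Sum>b\<in>Basis. a b) \<le> r. c i a * (\<Prod>b\<in>Basis. (x \<bullet> b) ^ a b))"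
    ..
  show ?thesis unfolding polys_le_def mem_Collect_eq
    by (intro exI[of _ "\<lambda>a. \<Sum>i\<in>I. c i a"]) (auto simp: c sum_distrib_right intro!: sum.swap)
qed

lemma finite_exponents: "finite {a. a \<in> (Basis::'a::euclidean_space set) \<rightarrow>\<^sub>E {..r} \<and> (\<Sum>b\<in>Basis. a b) \<le> (r::nat)}"
  by (rule finite_subset[of _ "Basis \<rightarrow>\<^sub>E {..r}"]) (auto intro: finite_PiE)

lemma monomial_in_polys_le:
  fixes a :: "'a::euclidean_space \<Rightarrow> nat"
  assumes "(\<Sum>b\<in>Basis. a b) \<le> r"
  shows "(\<lambda>x. d * (\<Prod>b\<in>Basis. (x \<bullet> b) ^ a b)) \<in> polys_le r"
proof -
  let ?a = "restrict a Basis"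
  have le: "a b \<le> r" if "b \<in> Basis" for b
    using assms that member_le_sum[of b Basis a] by force
  then have "?a \<in> {a. a \<in> Basis \<rightarrow>\<^sub>E {..r} \<and> (\<Sum>b\<in>Basis. a b) \<le> r}" using assms by auto
  then show ?thesis unfolding polys_le_def mem_Collect_eq
    by (intro exI[of _ "\<lambda>a'. if a' = ?a then d else 0"]) 
       (auto simp: if_distrib[of "\<lambda>y. y * _"] sum.delta[OF finite_exponents] cong: if_cong)
qed

lemma polys_le_eq_polyf: "p \<in> polys_le r \<longleftrightarrow> polyf r p"
proof
  assume "p \<in> polys_le r"
  then obtain c where c: "\<forall>x. p x = (\<Sum>a | a \<in> Basis \<rightarrow>\<^sub>E {..r} \<and> (\<Sum>b\<in>Basis. a b) \<le> r. c a * (\<Prod>b\<in>Basis. (x \<bullet> b) ^ a b))"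
    unfolding polys_le_def by blast
  have "polyf r (\<lambda>x. \<Sum>a | a \<in> Basis \<rightarrow>\<^sub>E {..r} \<and> (\<Sum>b\<in>Basis. a b) \<le> r. c a * (\<Prod>b\<in>Basis. (x \<bullet> b) ^ a b))"
    by (intro polyf_sum polyf_scale) (auto intro: polyf_mono[OF polyf_prod])
  also have "(\<lambda>x. \<Sum>a | a \<in> Basis \<rightarrow>\<^sub>E {..r} \<and> (\<Sum>b\<in>Basis. a b) \<le> r. c a * (\<Prod>b\<in>Basis. (x \<bullet> b) ^ a b)) = p" using c by auto
  finally show "polyf r p" .
next
  show "polyf r p \<Longrightarrow> p \<in> polys_le r"
  proof (induction rule: polyf.induct)
    case (const r c)
    show ?case using monomial_in_polys_le[of "\<lambda>_. 0" r c] by simp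
  next
    case (add r f g)
    then show ?case using polys_le_sum[of UNIV "\<lambda>b. if b then f else g" r] by (auto simp: UNIV_bool add.commute)
  next
    case (coord r f i)
    then obtain c where c: "\<forall>x. f x = (\<Sum>a | a \<in> Basis \<rightarrow>\<^sub>E {..r} \<and> (\<Sum>b\<in>Basis. a b) \<le> r. c a * (\<Prod>b\<in>Basis. (x \<bullet> b) ^ a b))"
      unfolding polys_le_def by blast
    have prod: "(x \<bullet> i) * (\<Prod>b\<in>Basis. (x \<bullet> b) ^ a b) = (\<Prod>b\<in>Basis. (x \<bullet> b) ^ (a(i := Suc (a i))) b)" for x a
      using coord.hyps by (subst (1 2) prod.remove[of Basis i]) auto
    have "(\<Sum>b\<in>Basis. (a(i := Suc (a i))) b) = Suc (\<Sum>b\<in>Basis. a b)" for a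
      using coord.hyps by (subst (1 2) sum.remove[of Basis i]) auto
    then have "(\<lambda>x. c a * (\<Prod>b\<in>Basis. (x \<bullet> b) ^ (a(i := Suc (a i))) b)) \<in> polys_le (Suc r)" 
      if "(\<Sum>b\<in>Basis. a b) \<le> r" for a
      using that by (intro monomial_in_polys_le) simp
    then have "(\<lambda>x. \<Sum>a | a \<in> Basis \<rightarrow>\<^sub>E {..r} \<and> (\<Sum>b\<in>Basis. a b) \<le> r. 
        c a * (\<Prod>b\<in>Basis. (x \<bullet> b) ^ (a(i := Suc (a i))) b)) \<in> polys_le (Suc r)"
      by (intro polys_le_sum) auto
    also have "(\<lambda>x. \<Sum>a | a \<in> Basis \<rightarrow>\<^sub>E {..r} \<and> (\<Sum>b\<in>Basis. a b) \<le> r. 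
        c a * (\<Prod>b\<in>Basis. (x \<bullet> b) ^ (a(i := Suc (a i))) b)) = (\<lambda>x. (x \<bullet> i) * f x)"
      unfolding prod[symmetric] by (simp add: c sum_distrib_left mult.left_commute)
    finally show ?case .
  qed
qed

subsection \<open>Directional derivatives\<close>

definition dirderiv :: "'a::real_normed_vector \<Rightarrow> ('a \<Rightarrow> real) \<Rightarrow> 'a \<Rightarrow> real" where
  "dirderiv v f x = frechet_derivative f (at x) v"

lemma dirderiv_eq: "(f has_derivative f') (at x) \<Longrightarrow> dirderiv v f x = f' v"
  unfolding dirderiv_def using frechet_derivative_at by metis

lemma differentiable_has_derivative_dirderiv: "f differentiable (at x) \<Longrightarrow> (f has_derivative (\<lambda>v. dirderiv v f x)) (at x)"
  unfolding dirderiv_def using frechet_derivative_works by auto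

lemma dirderiv_const: "dirderiv v (\<lambda>x. c) = (\<lambda>x. 0)"
  by (auto simp: fun_eq_iff intro!: dirderiv_eq derivative_eq_intros)

lemma dirderiv_add: "f differentiable (at x) \<Longrightarrow> g differentiable (at x) \<Longrightarrow> dirderiv v (\<lambda>x. f x + g x) x = dirderiv v f x + dirderiv v g x"
  by (rule dirderiv_eq) (auto intro!: derivative_eq_intros differentiable_has_derivative_dirderiv)

lemma polyf_differentiable: "polyf r f \<Longrightarrow> f differentiable (at x)"
  by (induction rule: polyf.induct) (auto intro!: derivative_intros)

lemma dirderiv_diff: "f differentiable (at x) \<Longrightarrow> g differentiable (at x) \<Longrightarrow> dirderiv v (\<lambda>x. f x - g x) x = dirderiv v f x - dirderiv v g x"
  by (rule dirderiv_eq) (auto intro!: derivative_eq_intros differentiable_has_derivative_dirderiv)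

lemma dirderiv_mult: "f differentiable (at x) \<Longrightarrow> g differentiable (at x) \<Longrightarrow> 
   dirderiv v (\<lambda>x. f x * g x) x = f x * dirderiv v g x + dirderiv v f x * g x"
  by (rule dirderiv_eq) (auto intro!: derivative_eq_intros differentiable_has_derivative_dirderiv)

lemma dirderiv_cmult: "f differentiable (at x) \<Longrightarrow> dirderiv v (\<lambda>x. c * f x) x = c * dirderiv v f x"
  using dirderiv_mult[of "\<lambda>_. c" x f v] by (simp add: dirderiv_const)

lemma dirderiv_affine: "dirderiv v (\<lambda>x. c + a \<bullet> x) = (\<lambda>x. a \<bullet> v)"
  by (auto simp: fun_eq_iff intro!: dirderiv_eq derivative_eq_intros)

lemma dirderiv_coord: "dirderiv v (\<lambda>x. x \<bullet> b) = (\<lambda>x. v \<bullet> b)"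
  by (auto simp: fun_eq_iff intro!: dirderiv_eq derivative_eq_intros)

lemma dirderiv_sum: "(\<And>i. i \<in> I \<Longrightarrow> f i differentiable (at x)) \<Longrightarrow> dirderiv v (\<lambda>x. \<Sum>i\<in>I. f i x) x = (\<Sum>i\<in>I. dirderiv v (f i) x)"
proof (induction I rule: infinite_finite_induct)
  case (insert i I) then show ?case by (simp add: dirderiv_add differentiable_sum)
qed (auto simp: dirderiv_const)

lemma linear_dirderiv: "f differentiable (at x) \<Longrightarrow> linear (\<lambda>v. dirderiv v f x)"
  using differentiable_has_derivative_dirderiv has_derivative_linear by blast

lemma dirderiv_shear:
  assumes "f differentiable (at (x - (c + a \<bullet> x) *\<^sub>R e))"
  shows "dirderiv v (\<lambda>x. f (x - (c + a \<bullet> x) *\<^sub>R e)) x = dirderiv (v - (a \<bullet> v) *\<^sub>R e) f (x - (c + a \<bullet> x) *\<^sub>R e)"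
proof -
  have "((\<lambda>x. x - (c + a \<bullet> x) *\<^sub>R e) has_derivative (\<lambda>v. v - (a \<bullet> v) *\<^sub>R e)) (at x)"
    by (auto intro!: derivative_eq_intros)
  from has_derivative_compose[OF this differentiable_has_derivative_dirderiv[OF assms]]
  show ?thesis by (rule dirderiv_eq)
qed

lemma has_field_derivative_line:
  assumes "f differentiable (at (x + t *\<^sub>R v))"
  shows "((\<lambda>t. f (x + t *\<^sub>R v)) has_field_derivative dirderiv v f (x + t *\<^sub>R v)) (at t)"
proof -
  have "((\<lambda>t. x + t *\<^sub>R v) has_derivative (\<lambda>h. h *\<^sub>R v)) (at t)" by (auto intro!: derivative_eq_intros)
  from has_derivative_compose[OF this differentiable_has_derivative_dirderiv[OF assms]]
  show ?thesis unfolding has_field_derivative_def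
    by (auto simp: linear_cmul[OF linear_dirderiv[OF assms]] mult.commute fun_eq_iff elim!: has_derivative_eq_rhs)
qed

lemma dirderiv_zero_line:
  assumes "f differentiable (at x)" "\<And>t. f (x + t *\<^sub>R v) = 0"
  shows "dirderiv v f x = 0"
  using has_field_derivative_line[of f x 0 v] assms by (auto dest: DERIV_unique[OF DERIV_const])

lemma dirderiv_zero_const_line:
  assumes "\<And>x. f differentiable (at x)" "\<And>x. dirderiv v f x = 0"
  shows "f (x + t *\<^sub>R v) = f x"
proof -
  have "((\<lambda>t. f (x + t *\<^sub>R v)) has_field_derivative 0) (at t)" for t 
    using has_field_derivative_line[of f x t v] assms by simp
  then have "f (x + t *\<^sub>R v) = f (x + 0 *\<^sub>R v)" by (rule DERIV_isconst_all[OF allI])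
  then show ?thesis by simp
qed

lemma polyf_dirderiv_aux: "polyf r f \<Longrightarrow> polyf (r - 1) (dirderiv v f) \<and> (r = 0 \<longrightarrow> dirderiv v f = (\<lambda>x. 0))"
proof (induction rule: polyf.induct)
  case (const r c) then show ?case by (simp add: dirderiv_const polyf.const)
next
  case (add r f g)
  have "dirderiv v (\<lambda>x. f x + g x) = (\<lambda>x. dirderiv v f x + dirderiv v g x)"
    using add by (auto simp: fun_eq_iff dirderiv_add polyf_differentiable)
  then show ?case using add by (auto intro: polyf.add)
next
  case (coord r f b)
  have eq: "dirderiv v (\<lambda>x. (x \<bullet> b) * f x) = (\<lambda>x. (x \<bullet> b) * dirderiv v f x + (v \<bullet> b) * f x)"
    using coord by (auto simp: fun_eq_iff dirderiv_mult polyf_differentiable dirderiv_coord)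
  have "polyf r (\<lambda>x. (x \<bullet> b) * dirderiv v f x)"
    using coord by (cases r rule: nat.exhaust) (auto simp: polyf.const intro: polyf.coord)
  then show ?case using coord by (auto simp: eq intro: polyf.add polyf_scale)
qed

lemma polyf_dirderiv: "polyf r f \<Longrightarrow> polyf (r - 1) (dirderiv v f)"
  using polyf_dirderiv_aux by blast

lemma polyf_dirderiv_commute: "polyf r f \<Longrightarrow> dirderiv v (dirderiv w f) = dirderiv w (dirderiv v f)"
proof (induction rule: polyf.induct)
  case (const r c) show ?case by (simp add: dirderiv_const)
next
  case (add r f g)
  have "dirderiv v (\<lambda>x. f x + g x) = (\<lambda>x. dirderiv v f x + dirderiv v g x)" for v
    using add by (auto simp: fun_eq_iff dirderiv_add polyf_differentiable)
  moreover have "dirderiv v (\<lambda>x. dirderiv w f x + dirderiv w g x) = (\<lambda>x. dirderiv v (dirderiv w f) x + dirderiv v (dirderiv w g) x)" for v w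
    using add.hyps by (auto simp: fun_eq_iff dirderiv_add polyf_dirderiv polyf_differentiable[OF polyf_dirderiv])
  ultimately show ?case using add by simp
next
  case (coord r f b)
  have eq: "dirderiv v (\<lambda>x. (x \<bullet> b) * f x) = (\<lambda>x. (x \<bullet> b) * dirderiv v f x + (v \<bullet> b) * f x)" for v
    using coord by (auto simp: fun_eq_iff dirderiv_mult polyf_differentiable dirderiv_coord)
  have "dirderiv v (\<lambda>x. (x \<bullet> b) * dirderiv w f x + (w \<bullet> b) * f x) x =
     ((x \<bullet> b) * dirderiv v (dirderiv w f) x + (v \<bullet> b) * dirderiv w f x) + (w \<bullet> b) * dirderiv v f x" for v w x
    using coord.hyps 
    by (subst dirderiv_add)
       (auto simp: dirderiv_mult dirderiv_cmult polyf_differentiable polyf_differentiable[OF polyf_dirderiv] dirderiv_coord dirderiv_const)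
  then show ?case using coord by (auto simp: eq fun_eq_iff)
qed

text \<open>
  A polynomial has an antiderivative along \<open>e\<close> that vanishes on a hyperplane transverse to \<open>e\<close>.  The
  factor \<open>\<ell> ^ j\<close>, where \<open>\<ell> x = c + a \<bullet> x\<close>, is there for the induction: a coordinate function is the
  sum of a function that is constant along \<open>e\<close> and of a multiple of \<open>\<ell>\<close>.
\<close>

lemma antiderivative_aux:
  fixes e :: "'a::euclidean_space"
  assumes "polyf r f" "a \<bullet> e = 1"
  shows "\<exists>F. polyf (r + j + 1) F \<and> (\<forall>x. dirderiv e F x = (c + a \<bullet> x) ^ j * f x) \<and> (\<forall>x. c + a \<bullet> x = 0 \<longrightarrow> F x = 0)"
  using assms(1)
proof (induction arbitrary: j rule: polyf.induct)
  case (const r d)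
  have p: "polyf m (\<lambda>x. (c + a \<bullet> x) ^ m)" for m
    by (induction m) (auto intro: polyf.const polyf_inner_mult)
  \<comment> \<open>\<open>\<ell> ^ (j + 1) / (j + 1)\<close> is an antiderivative of \<open>\<ell> ^ j\<close>, as \<open>\<ell>\<close> has derivative \<open>1\<close> along \<open>e\<close>.\<close>
  have "((\<lambda>x. (c + a \<bullet> x) ^ Suc j) has_derivative (\<lambda>v. real (Suc j) * (c + a \<bullet> x) ^ j * (a \<bullet> v))) (at x)" for x
    by (auto intro!: derivative_eq_intros simp del: power_Suc)
  from dirderiv_eq[OF this, of e] have "dirderiv e (\<lambda>x. (c + a \<bullet> x) ^ Suc j) x = real (Suc j) * (c + a \<bullet> x) ^ j" for x
    using assms(2) by simp
  then have "dirderiv e (\<lambda>x. (d / real (Suc j)) * (c + a \<bullet> x) ^ Suc j) x = (c + a \<bullet> x) ^ j * d" for x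
    by (subst dirderiv_cmult) (auto intro: polyf_differentiable[OF p] simp del: power_Suc of_nat_Suc)
  moreover have "polyf (r + j + 1) (\<lambda>x. (d / real (Suc j)) * (c + a \<bullet> x) ^ Suc j)"
    by (intro polyf_scale) (auto intro: polyf_mono[OF p] simp del: power_Suc)
  ultimately show ?case by (intro exI[of _ "\<lambda>x. (d / real (Suc j)) * (c + a \<bullet> x) ^ Suc j"]) auto
next
  case (add r f g)
  obtain F G where "polyf (r + j + 1) F" "\<forall>x. dirderiv e F x = (c + a \<bullet> x) ^ j * f x" "\<forall>x. c + a \<bullet> x = 0 \<longrightarrow> F x = 0"
     "polyf (r + j + 1) G" "\<forall>x. dirderiv e G x = (c + a \<bullet> x) ^ j * g x" "\<forall>x. c + a \<bullet> x = 0 \<longrightarrow> G x = 0" using add.IH by metis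
  then show ?case
    by (intro exI[of _ "\<lambda>x. F x + G x"]) (auto intro: polyf.add simp: dirderiv_add polyf_differentiable algebra_simps)
next
  case (coord r f b)
  obtain F where F: "polyf (r + j + 1) F" "\<forall>x. dirderiv e F x = (c + a \<bullet> x) ^ j * f x" "\<forall>x. c + a \<bullet> x = 0 \<longrightarrow> F x = 0"
    using coord.IH by metis
  obtain G where G: "polyf (r + Suc j + 1) G" "\<forall>x. dirderiv e G x = (c + a \<bullet> x) ^ Suc j * f x" "\<forall>x. c + a \<bullet> x = 0 \<longrightarrow> G x = 0"
    using coord.IH by metis
  \<comment> \<open>\<open>?q\<close> is the coordinate of the projection of \<open>x\<close> along \<open>e\<close> to the hyperplane \<open>\<ell> = 0\<close>.\<close>
  let ?q = "\<lambda>x. - c * (e \<bullet> b) + (b - (e \<bullet> b) *\<^sub>R a) \<bullet> x"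
  have q: "x \<bullet> b = ?q x + (e \<bullet> b) * (c + a \<bullet> x)" for x by (simp add: algebra_simps inner_commute)
  have 1: "polyf (Suc r + j + 1) (\<lambda>x. ?q x * F x + (e \<bullet> b) * G x)"
    using polyf_inner_mult[OF F(1), of "- c * (e \<bullet> b)" "b - (e \<bullet> b) *\<^sub>R a"] polyf_scale[OF G(1), of "e \<bullet> b"] 
    by (intro polyf.add) auto
  have qe: "(b - (e \<bullet> b) *\<^sub>R a) \<bullet> e = 0" using assms(2) by (simp add: algebra_simps inner_commute)
  have q': "?q differentiable (at x)" for x by (rule polyf_differentiable[OF polyf_affine])
  have 2: "dirderiv e (\<lambda>x. ?q x * F x + (e \<bullet> b) * G x) x = (c + a \<bullet> x) ^ j * ((x \<bullet> b) * f x)" for x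
  proof -
    have "dirderiv e (\<lambda>x. ?q x * F x + (e \<bullet> b) * G x) x = dirderiv e (\<lambda>x. ?q x * F x) x + dirderiv e (\<lambda>x. (e \<bullet> b) * G x) x"
      by (intro dirderiv_add differentiable_mult differentiable_const q' polyf_differentiable[OF F(1)] polyf_differentiable[OF G(1)])
    also have "dirderiv e (\<lambda>x. ?q x * F x) x = ?q x * dirderiv e F x"
      unfolding dirderiv_mult[OF q' polyf_differentiable[OF F(1)]] dirderiv_affine qe by simp
    also have "dirderiv e (\<lambda>x. (e \<bullet> b) * G x) x = (e \<bullet> b) * dirderiv e G x"
      using G(1) by (intro dirderiv_cmult polyf_differentiable)
    finally show ?thesis using F(2) G(2) by (simp only: q[of x]) (simp add: algebra_simps)
  qed
  show ?case using 1 2 F(3) G(3) by (intro exI[of _ "\<lambda>x. ?q x * F x + (e \<bullet> b) * G x"]) auto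
qed

lemma antiderivative:
  fixes e :: "'a::euclidean_space"
  assumes "polyf r f" "a \<bullet> e = 1"
  shows "\<exists>F. polyf (Suc r) F \<and> (\<forall>x. dirderiv e F x = f x) \<and> (\<forall>x. c + a \<bullet> x = 0 \<longrightarrow> F x = 0)"
  using antiderivative_aux[OF assms, of 0 c] by simp

lemma antiderivative_unique:
  assumes "\<And>x. F differentiable (at x)" "a \<bullet> e = 1" "\<And>x. dirderiv e F x = 0" "\<And>x. c + a \<bullet> x = 0 \<Longrightarrow> F x = 0"
  shows "F x = 0"
proof -
  have "F (x + (- (c + a \<bullet> x)) *\<^sub>R e) = F x" by (rule dirderiv_zero_const_line) (use assms in auto)
  moreover have "F (x + (- (c + a \<bullet> x)) *\<^sub>R e) = 0"
    by (rule assms(4)) (simp add: assms(2) inner_add_right inner_diff_right)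
  ultimately show ?thesis by simp
qed

section \<open>Alternating maps\<close>

lemma alt_maps_length: "f \<in> alt_maps k \<Longrightarrow> length vs \<noteq> k \<Longrightarrow> f vs = 0"
  by (simp add: alt_maps_def)

lemma alt_maps_linear:
  assumes "f \<in> alt_maps k" shows "linear (\<lambda>u. f (us @ u # vs))"
proof (cases "length us + Suc (length vs) = k")
  case True
  have "linear (\<lambda>u. f ((us @ 0 # vs)[length us := u]))"
    using assms True unfolding alt_maps_def mem_Collect_eq by (metis length_Cons length_append less_add_Suc1 add_Suc_right)
  then show ?thesis by simp
next
  case False
  then have "(\<lambda>u. f (us @ u # vs)) = (\<lambda>u. 0)" using assms by (auto simp: alt_maps_def)
  then show ?thesis by (metis (no_types) linear_zero)
qed

lemma alt_maps_alternate:
  assumes "f \<in> alt_maps k" shows "f (us @ v # ws @ v # xs) = 0"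
proof (cases "length us + Suc (length ws + Suc (length xs)) = k")
  case True
  let ?i = "length us" and ?j = "length us + Suc (length ws)"
  have n: "(us @ v # ws @ v # xs) ! ?j = v"
    by (metis append.assoc append_Cons length_Cons length_append nth_append_length)
  have "\<And>vs i j. length vs = k \<and> i < j \<and> j < k \<and> vs ! i = vs ! j \<Longrightarrow> f vs = 0" 
    using assms unfolding alt_maps_def by blast
  from this[of "us @ v # ws @ v # xs" ?i ?j] show ?thesis using True n by simp
next
  case False then show ?thesis using assms by (auto simp: alt_maps_def)
qed

text \<open>The exterior derivative removes entries from lists, which shifts positions.  So the conditions
  are stated for concatenations of lists, where no positions occur.\<close>

lemma alt_mapsI:
  assumes "\<And>vs. length vs \<noteq> k \<Longrightarrow> f vs = 0"
    and "\<And>us vs. length us + Suc (length vs) = k \<Longrightarrow> linear (\<lambda>u. f (us @ u # vs))"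
    and "\<And>us v ws xs. length us + Suc (length ws + Suc (length xs)) = k \<Longrightarrow> f (us @ v # ws @ v # xs) = 0"
  shows "f \<in> alt_maps k"
  unfolding alt_maps_def mem_Collect_eq
proof (intro conjI allI impI)
  fix vs :: "'a list" and i assume "length vs = k \<and> i < k"
  then show "linear (\<lambda>u. f (vs[i := u]))"
    using assms(2)[of "take i vs" "drop (Suc i) vs"] by (simp add: upd_conv_take_nth_drop)
next
  fix vs :: "'a list" and i j assume *: "length vs = k \<and> i < j \<and> j < k \<and> vs ! i = vs ! j"
  have 1: "vs = take i vs @ vs ! i # drop (Suc i) vs" using * by (intro id_take_nth_drop) simp
  have 2: "drop (Suc i) vs = take (j - Suc i) (drop (Suc i) vs) @ vs ! j # drop (Suc j) vs"
    using * id_take_nth_drop[of "j - Suc i" "drop (Suc i) vs"] by (simp add: diff_less_mono)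
  have "f (take i vs @ vs ! i # take (j - Suc i) (drop (Suc i) vs) @ vs ! i # drop (Suc j) vs) = 0"
    using * by (intro assms(3)) auto
  also have "take i vs @ vs ! i # take (j - Suc i) (drop (Suc i) vs) @ vs ! i # drop (Suc j) vs = vs"
    using 1 2 * by metis
  finally show "f vs = 0" .
qed (use assms in auto)

lemma alt_maps_add_arg: "f \<in> alt_maps k \<Longrightarrow> f (us @ (u + v) # vs) = f (us @ u # vs) + f (us @ v # vs)"
  using linear_add[OF alt_maps_linear] by blast

lemma alt_maps_scale_arg: "f \<in> alt_maps k \<Longrightarrow> f (us @ (c *\<^sub>R u) # vs) = c * f (us @ u # vs)"
  using linear_cmul[OF alt_maps_linear] by fastforce

lemma alt_maps_diff_arg: "f \<in> alt_maps k \<Longrightarrow> f (us @ (u - v) # vs) = f (us @ u # vs) - f (us @ v # vs)"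
  using linear_diff[OF alt_maps_linear] by blast

text \<open>Expand \<open>f\<close> with \<open>v + w\<close> in both places.\<close>

lemma alt_maps_swap:
  assumes "f \<in> alt_maps k" shows "f (us @ v # w # xs) = - f (us @ w # v # xs)"
proof -
  have "0 = f (us @ (v + w) # (v + w) # xs)" using alt_maps_alternate[OF assms, of us "v + w" "[]"] by simp
  also have "\<dots> = f (us @ v # (v + w) # xs) + f (us @ w # (v + w) # xs)"
    by (rule alt_maps_add_arg[OF assms])
  also have "f (us @ v # (v + w) # xs) = f (us @ v # v # xs) + f (us @ v # w # xs)"
    using alt_maps_add_arg[OF assms, of "us @ [v]"] by simp
  also have "f (us @ w # (v + w) # xs) = f (us @ w # v # xs) + f (us @ w # w # xs)"
    using alt_maps_add_arg[OF assms, of "us @ [w]"] by simp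
  finally show ?thesis using alt_maps_alternate[OF assms, of us _ "[]"] by simp
qed

text \<open>Moving \<open>v\<close> past \<open>ws\<close> takes one transposition for each entry of \<open>ws\<close>.\<close>

lemma alt_maps_move:
  assumes "f \<in> alt_maps k" shows "f (us @ v # ws @ xs) = (- 1) ^ length ws * f (us @ ws @ v # xs)"
proof (induction ws arbitrary: us)
  case (Cons w ws)
  have "f (us @ v # (w # ws) @ xs) = - f ((us @ [w]) @ v # ws @ xs)" 
    using alt_maps_swap[OF assms, of us v w "ws @ xs"] by simp
  then show ?case using Cons.IH[of "us @ [w]"] by simp
qed simp

lemma alt_maps_zero: "(\<lambda>_. 0) \<in> alt_maps k"
  by (intro alt_mapsI) (auto simp: linear_zero)

lemma alt_maps_add: "f \<in> alt_maps k \<Longrightarrow> g \<in> alt_maps k \<Longrightarrow> (\<lambda>vs. f vs + g vs) \<in> alt_maps k"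
proof (rule alt_mapsI)
  assume f: "f \<in> alt_maps k" and g: "g \<in> alt_maps k"
  show "f vs + g vs = 0" if "length vs \<noteq> k" for vs using alt_maps_length[OF f that] alt_maps_length[OF g that] by simp
  show "linear (\<lambda>u. f (us @ u # vs) + g (us @ u # vs))" for us vs
    by (rule linear_compose_add[OF alt_maps_linear[OF f] alt_maps_linear[OF g]])
  show "f (us @ v # ws @ v # xs) + g (us @ v # ws @ v # xs) = 0" for us v ws xs 
    by (simp add: alt_maps_alternate[OF f] alt_maps_alternate[OF g])
qed

lemma alt_maps_minus: "f \<in> alt_maps k \<Longrightarrow> g \<in> alt_maps k \<Longrightarrow> (\<lambda>vs. f vs - g vs) \<in> alt_maps k"
proof (rule alt_mapsI)
  assume f: "f \<in> alt_maps k" and g: "g \<in> alt_maps k"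
  show "f vs - g vs = 0" if "length vs \<noteq> k" for vs using alt_maps_length[OF f that] alt_maps_length[OF g that] by simp
  show "linear (\<lambda>u. f (us @ u # vs) - g (us @ u # vs))" for us vs
    by (rule linear_compose_sub[OF alt_maps_linear[OF f] alt_maps_linear[OF g]])
  show "f (us @ v # ws @ v # xs) - g (us @ v # ws @ v # xs) = 0" for us v ws xs 
    by (simp add: alt_maps_alternate[OF f] alt_maps_alternate[OF g])
qed

lemma alt_maps_Cons: "f \<in> alt_maps (Suc k) \<Longrightarrow> (\<lambda>vs. f (e # vs)) \<in> alt_maps k"
proof (rule alt_mapsI)
  assume f: "f \<in> alt_maps (Suc k)"
  show "f (e # vs) = 0" if "length vs \<noteq> k" for vs using that by (intro alt_maps_length[OF f]) simp
  show "linear (\<lambda>u. f (e # us @ u # vs))" for us vs using alt_maps_linear[OF f, of "e # us"] by simp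
  show "f (e # us @ v # ws @ v # xs) = 0" for us v ws xs using alt_maps_alternate[OF f, of "e # us"] by simp
qed

text \<open>
  A form annihilated by \<open>e\<close> descends to the quotient by the span of \<open>e\<close>.  Consequently, pulling back by a
  map that moves points along \<open>e\<close> only affects the point of evaluation, not the vectors.
\<close>

lemma alt_maps_contraction_zero:
  assumes "f \<in> alt_maps k" "\<And>ws. f (e # ws) = 0"
  shows "f (map (\<lambda>v. v - c v *\<^sub>R e) vs) = f vs"
proof -
  have e: "f (us @ e # xs) = 0" for us xs
    using alt_maps_move[OF assms(1), of "[]" e us xs] assms(2) by simp
  have "f (us @ map (\<lambda>v. v - c v *\<^sub>R e) vs) = f (us @ vs)" for us
  proof (induction vs arbitrary: us)
    case (Cons v vs)
    have "f (us @ map (\<lambda>v. v - c v *\<^sub>R e) (v # vs)) = f (us @ (v - c v *\<^sub>R e) # vs)"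
      using Cons.IH[of "us @ [v - c v *\<^sub>R e]"] by simp
    then show ?case by (simp add: alt_maps_diff_arg[OF assms(1)] alt_maps_scale_arg[OF assms(1)] e)
  qed simp
  from this[of "[]"] show ?thesis by simp
qed

section \<open>The exterior derivative of polynomial forms\<close>

abbreviation omit :: "nat \<Rightarrow> 'b list \<Rightarrow> 'b list" where
  "omit i vs \<equiv> take i vs @ drop (Suc i) vs"

text \<open>
  Forms with polynomial coefficients on the whole space.  The coefficients are taken with respect
  to arbitrary vectors, since no basis is adapted to all the faces of the split.
\<close>

definition pform :: "nat \<Rightarrow> nat \<Rightarrow> 'a::euclidean_space form \<Rightarrow> bool" where
  "pform r k \<alpha> \<longleftrightarrow> (\<forall>x. \<alpha> x \<in> alt_maps k) \<and> (\<forall>vs. polyf r (\<lambda>x. \<alpha> x vs))"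

definition ext_d :: "nat \<Rightarrow> 'a::euclidean_space form \<Rightarrow> 'a form" where
  "ext_d k \<alpha> x vs = (if length vs = Suc k 
     then \<Sum>i\<le>k. (- 1) ^ i * dirderiv (vs ! i) (\<lambda>y. \<alpha> y (omit i vs)) x else 0)"

lemma pform_alt: "pform r k \<alpha> \<Longrightarrow> \<alpha> x \<in> alt_maps k"
  by (simp add: pform_def)

lemma pform_polyf: "pform r k \<alpha> \<Longrightarrow> polyf r (\<lambda>x. \<alpha> x vs)"
  by (simp add: pform_def)

lemma pform_differentiable: "pform r k \<alpha> \<Longrightarrow> (\<lambda>x. \<alpha> x vs) differentiable (at y)"
  by (blast intro: pform_polyf polyf_differentiable)

lemma pform_zero: "pform r k (\<lambda>_ _. 0)"
  by (simp add: pform_def alt_maps_zero polyf.const)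

lemma pform_add: "pform r k \<alpha> \<Longrightarrow> pform r k \<beta> \<Longrightarrow> pform r k (\<lambda>x vs. \<alpha> x vs + \<beta> x vs)"
  by (simp add: pform_def alt_maps_add polyf.add)

lemma pform_diff: "pform r k \<alpha> \<Longrightarrow> pform r k \<beta> \<Longrightarrow> pform r k (\<lambda>x vs. \<alpha> x vs - \<beta> x vs)"
  by (simp add: pform_def alt_maps_minus polyf_diff)

lemma pform_dirderiv_linear:
  assumes "pform r k \<alpha>" shows "linear (\<lambda>u. dirderiv v (\<lambda>y. \<alpha> y (us @ u # vs)) x)"
proof (rule linearI)
  note d = pform_differentiable[OF assms]
  show "dirderiv v (\<lambda>y. \<alpha> y (us @ (u + w) # vs)) x = dirderiv v (\<lambda>y. \<alpha> y (us @ u # vs)) x + dirderiv v (\<lambda>y. \<alpha> y (us @ w # vs)) x" for u w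
    by (simp add: alt_maps_add_arg[OF pform_alt[OF assms]] dirderiv_add d)
  show "dirderiv v (\<lambda>y. \<alpha> y (us @ (c *\<^sub>R u) # vs)) x = c *\<^sub>R dirderiv v (\<lambda>y. \<alpha> y (us @ u # vs)) x" for c u
    by (simp add: alt_maps_scale_arg[OF pform_alt[OF assms]] dirderiv_cmult d)
qed

lemma omit_append_Cons:
  "length us < i \<Longrightarrow> omit i (us @ v # vs) = us @ v # omit (i - Suc (length us)) vs"
proof -
  assume "length us < i"
  then obtain j where "i = length us + Suc j" by (metis add_Suc_right less_natE)
  then show ?thesis by simp
qed

lemma ext_d_linear:
  assumes "pform r k \<alpha>" "length us + Suc (length vs) = Suc k"
  shows "linear (\<lambda>u. ext_d k \<alpha> x (us @ u # vs))"
proof -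
  have "linear (\<lambda>u. (- 1) ^ i * dirderiv ((us @ u # vs) ! i) (\<lambda>y. \<alpha> y (omit i (us @ u # vs))) x)" for i
  proof -
    have "linear (\<lambda>u. dirderiv ((us @ u # vs) ! i) (\<lambda>y. \<alpha> y (omit i (us @ u # vs))) x)"
    proof (cases i "length us" rule: linorder_cases)
      case less
      then show ?thesis
        using pform_dirderiv_linear[OF assms(1), of "us ! i" "omit i us" vs x] by (simp add: nth_append)
    next
      case equal
      then show ?thesis using linear_dirderiv[OF pform_differentiable[OF assms(1)]] by simp
    next
      case greater
      have n: "(us @ u # vs) ! i = vs ! (i - Suc (length us))" for u using greater by (simp add: nth_append)
      show ?thesis unfolding n omit_append_Cons[OF greater] by (rule pform_dirderiv_linear[OF assms(1)])
    qed
    from linear_compose_scale_right[OF this, of "(- 1) ^ i"] show ?thesis by simp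
  qed
  then have "linear (\<lambda>u. \<Sum>i\<le>k. (- 1) ^ i * dirderiv ((us @ u # vs) ! i) (\<lambda>y. \<alpha> y (omit i (us @ u # vs))) x)"
    by (intro linear_compose_sum ballI) auto
  then show ?thesis using assms(2) by (simp add: ext_d_def)
qed

lemma omit_alternate:
  assumes "i \<noteq> length us" "i \<noteq> length us + Suc (length ws)" "i < length us + Suc (length ws) + Suc (length xs)"
  shows "\<exists>us' ws' xs'. omit i (us @ v # ws @ v # xs) = us' @ v # ws' @ v # xs'"
proof (cases i "length us" rule: linorder_cases)
  case less 
  then show ?thesis by - (rule exI[of _ "omit i us"], rule exI[of _ ws], rule exI[of _ xs], simp)
next
  case greater
  then obtain j where j: "i = Suc (length us) + j" by (metis Suc_leI le_Suc_ex)
  show ?thesis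
  proof (cases j "length ws" rule: linorder_cases)
    case less 
    then show ?thesis using j by - (rule exI[of _ us], rule exI[of _ "omit j ws"], rule exI[of _ xs], simp)
  next
    case greater
    then obtain l where "j = Suc (length ws) + l" by (metis Suc_leI le_Suc_ex)
    then show ?thesis using j by - (rule exI[of _ us], rule exI[of _ ws], rule exI[of _ "omit l xs"], simp add: numeral_3_eq_3)
  qed (use j assms in auto)
qed (use assms in auto)

text \<open>
  In all summands but two, both copies of \<open>v\<close> survive.  The remaining two summands differ by moving \<open>v\<close> past \<open>ws\<close>, and
  the signs make them cancel.
\<close>

lemma ext_d_alternate:
  assumes "pform r k \<alpha>" "length us + Suc (length ws + Suc (length xs)) = Suc k"
  shows "ext_d k \<alpha> x (us @ v # ws @ v # xs) = 0"
proof -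
  let ?vs = "us @ v # ws @ v # xs" and ?a = "length us" and ?b = "length us + Suc (length ws)"
  let ?t = "\<lambda>i. (- 1) ^ i * dirderiv (?vs ! i) (\<lambda>y. \<alpha> y (omit i ?vs)) x"
  have z: "?t i = 0" if i: "i \<in> {..k} - {?a, ?b}" for i
  proof -
    obtain us' ws' xs' where "omit i ?vs = us' @ v # ws' @ v # xs'"
      using omit_alternate[of i us ws xs v] i assms(2) by auto
    then show ?thesis by (simp only: alt_maps_alternate[OF pform_alt[OF assms(1)]] dirderiv_const mult_zero_right)
  qed
  have b: "?vs ! ?b = v" "omit ?b ?vs = us @ v # ws @ xs"
    by (auto simp: nth_append)
  have "(\<Sum>i\<le>k. ?t i) = (\<Sum>i\<in>{?a, ?b}. ?t i)"
    using assms(2) z by (intro sum.mono_neutral_right) auto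
  also have "\<dots> = ?t ?a + ?t ?b" by simp
  also have "?t ?b = (- 1) ^ ?b * ((- 1) ^ length ws * dirderiv v (\<lambda>y. \<alpha> y (us @ ws @ v # xs)) x)"
    unfolding b alt_maps_move[OF pform_alt[OF assms(1)], where us = us and v = v and ws = ws and xs = xs]
    by (subst dirderiv_cmult) (auto intro: pform_differentiable[OF assms(1)])
  also have "\<dots> = - ((- 1) ^ ?a * dirderiv v (\<lambda>y. \<alpha> y (us @ ws @ v # xs)) x)"
    by (simp add: power_add flip: power_mult_distrib)
  finally have "(\<Sum>i\<le>k. ?t i) = 0" by simp
  then show ?thesis using assms(2) unfolding ext_d_def by (simp only: if_cancel)
qed

lemma pform_ext_d: assumes "pform r k \<alpha>" shows "pform (r - 1) (Suc k) (ext_d k \<alpha>)"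
  unfolding pform_def
proof (intro conjI allI)
  show "ext_d k \<alpha> x \<in> alt_maps (Suc k)" for x
    by (rule alt_mapsI[OF _ ext_d_linear[OF assms] ext_d_alternate[OF assms]]) (simp add: ext_d_def)
  show "polyf (r - 1) (\<lambda>x. ext_d k \<alpha> x vs)" for vs
  proof (cases "length vs = Suc k")
    case True 
    have "polyf (r - 1) (\<lambda>x. \<Sum>i\<le>k. (- 1) ^ i * dirderiv (vs ! i) (\<lambda>y. \<alpha> y (omit i vs)) x)"
      by (intro polyf_sum polyf_scale polyf_dirderiv pform_polyf[OF assms])
    then show ?thesis using True by (simp add: ext_d_def)
  qed (simp add: ext_d_def polyf.const)
qed

text \<open>This is Cartan's formula for the constant vector field \<open>e\<close>: the contraction of \<open>d\<alpha>\<close> with \<open>e\<close> is the derivative of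
  \<open>\<alpha>\<close> along \<open>e\<close> minus \<open>d\<close> of the contraction of \<open>\<alpha>\<close> with \<open>e\<close>.\<close>

lemma ext_d_Cons:
  assumes "length vs = k"
  shows "ext_d k \<alpha> x (e # vs) = dirderiv e (\<lambda>y. \<alpha> y vs) x 
     - (\<Sum>i<k. (- 1) ^ i * dirderiv (vs ! i) (\<lambda>y. \<alpha> y (e # omit i vs)) x)"
  using assms unfolding ext_d_def by (simp add: sum.atMost_shift sum_negf)

lemma ext_d_add: 
  assumes "pform r k \<alpha>" "pform s k \<beta>"
  shows "ext_d k (\<lambda>x vs. \<alpha> x vs + \<beta> x vs) x vs = ext_d k \<alpha> x vs + ext_d k \<beta> x vs"
  by (simp add: ext_d_def dirderiv_add pform_differentiable[OF assms(1)] pform_differentiable[OF assms(2)] 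
      distrib_left sum.distrib)

lemma ext_d_diff: 
  assumes "pform r k \<alpha>" "pform s k \<beta>"
  shows "ext_d k (\<lambda>x vs. \<alpha> x vs - \<beta> x vs) x vs = ext_d k \<alpha> x vs - ext_d k \<beta> x vs"
  by (simp add: ext_d_def dirderiv_diff pform_differentiable[OF assms(1)] pform_differentiable[OF assms(2)] 
      right_diff_distrib sum_subtractf)

lemma omit_omit: 
  assumes "i \<le> j" "Suc j < length vs" 
  shows "omit j (omit i vs) = omit i (omit (Suc j) vs)"
  using assms by (intro nth_equalityI) (auto simp: nth_append min_def)

text \<open>\<open>d \<circ> d = 0\<close>: removing two entries in either order gives the same second derivative with opposite
  signs.\<close>

lemma ext_d_ext_d:
  assumes "pform r k \<alpha>" shows "ext_d (Suc k) (ext_d k \<alpha>) x vs = 0"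
proof (cases "length vs = Suc (Suc k)")
  case True
  let ?g = "\<lambda>i j. (- 1) ^ (i + j) * dirderiv (vs ! i) (dirderiv (omit i vs ! j) (\<lambda>y. \<alpha> y (omit j (omit i vs)))) x"
  have "ext_d (Suc k) (ext_d k \<alpha>) x vs = (\<Sum>i\<le>Suc k. (- 1) ^ i * (\<Sum>j\<le>k. (- 1) ^ j * 
      dirderiv (vs ! i) (dirderiv (omit i vs ! j) (\<lambda>y. \<alpha> y (omit j (omit i vs)))) x))"
    unfolding ext_d_def[of "Suc k"] using True
    by (auto simp del: sum.atMost_Suc intro!: sum.cong simp: ext_d_def dirderiv_sum dirderiv_cmult
         polyf_differentiable[OF polyf_dirderiv[OF pform_polyf[OF assms]]])
  also have "\<dots> = (\<Sum>i\<le>Suc k. \<Sum>j\<le>k. ?g i j)"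
    by (simp add: sum_distrib_left power_add mult.assoc del: sum.atMost_Suc)
  also have "\<dots> = (\<Sum>(i, j)\<in>{..Suc k} \<times> {..k}. ?g i j)" by (rule sum.cartesian_product)
  also have "{..Suc k} \<times> {..k} = {(i, j). i \<le> j \<and> j \<le> k} \<union> {(i, j). j < i \<and> i \<le> Suc k}" by auto
  also have "(\<Sum>(i, j)\<in>\<dots>. ?g i j) = (\<Sum>(i, j)\<in>{(i, j). i \<le> j \<and> j \<le> k}. ?g i j) + (\<Sum>(i, j)\<in>{(i, j). j < i \<and> i \<le> Suc k}. ?g i j)"
    by (rule sum.union_disjoint) 
       (auto intro: finite_subset[of _ "{..Suc k} \<times> {..k}"])
  also have "(\<Sum>(i, j)\<in>{(i, j). j < i \<and> i \<le> Suc k}. ?g i j) = (\<Sum>(i, j)\<in>{(i, j). i \<le> j \<and> j \<le> k}. - ?g i j)"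
  proof (rule sum.reindex_bij_witness[of _ "\<lambda>(i, j). (Suc j, i)" "\<lambda>(i, j). (j, i - 1)"])
    fix p assume p: "p \<in> {(i, j). j < i \<and> i \<le> Suc k}"
    then obtain j i where ij: "p = (Suc j, i)" "i \<le> j" "j \<le> k" 
      by (cases p; case_tac "fst p") auto
    have 1: "omit (Suc j) vs ! i = vs ! i" "omit i vs ! j = vs ! Suc j"
      using ij True by (auto simp: nth_append)
    have 2: "omit j (omit i vs) = omit i (omit (Suc j) vs)" using ij True by (intro omit_omit) auto
    \<comment> \<open>Entry \<open>Suc j\<close> moves to position \<open>j\<close> when an earlier entry \<open>i\<close> is removed first; hence the opposite signs.\<close>
    have "- ?g i j = ?g (Suc j) i"
      unfolding 1 2 using polyf_dirderiv_commute[OF pform_polyf[OF assms], of "vs ! Suc j" "vs ! i"]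
      by (simp add: add.commute)
    then show "(case case p of (i, j) \<Rightarrow> (j, i - 1) of (i, j) \<Rightarrow> - ?g i j) = (case p of (i, j) \<Rightarrow> ?g i j)"
      unfolding ij(1) prod.case diff_Suc_1 .
  qed auto
  finally show ?thesis by (simp add: sum_negf case_prod_unfold)
qed (simp add: ext_d_def)

section \<open>Primitives of closed polynomial forms\<close>

text \<open>
  The antiderivative along \<open>e\<close> that vanishes on the hyperplane is unique.  So it depends linearly on the integrand and
  commutes with the derivatives tangent to the hyperplane, and identities between integrands
  carry over.
\<close>

lemma antiderivative_eq:
  fixes e :: "'a::euclidean_space"
  assumes "polyf r F" "polyf s G" "a \<bullet> e = 1" "\<And>x. dirderiv e F x = dirderiv e G x" 
    "\<And>x. c + a \<bullet> x = 0 \<Longrightarrow> F x = G x"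
  shows "F x = G x"
proof -
  have "F x - G x = 0"
  proof (rule antiderivative_unique[of "\<lambda>x. F x - G x" a e c])
    note d = polyf_differentiable[OF assms(1)] polyf_differentiable[OF assms(2)]
    show "(\<lambda>x. F x - G x) differentiable at x" for x by (intro differentiable_diff d)
    show "dirderiv e (\<lambda>x. F x - G x) x = 0" for x unfolding dirderiv_diff[OF d] assms(4) by simp
  qed (use assms(3,5) in auto)
  then show ?thesis by simp
qed

lemma primitive_along:
  fixes e :: "'a::euclidean_space"
  assumes \<alpha>: "pform r (Suc k) \<alpha>" and ae: "a \<bullet> e = 1"
  obtains \<gamma> where "pform (Suc r) k \<gamma>" "\<And>x ws. \<gamma> x (e # ws) = 0"
    "\<And>x vs. dirderiv e (\<lambda>y. \<gamma> y vs) x = \<alpha> x (e # vs)"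
    "\<And>x vs. c + a \<bullet> x = 0 \<Longrightarrow> \<gamma> x vs = 0"
proof -
  have "\<exists>F. polyf (Suc r) F \<and> (\<forall>x. dirderiv e F x = \<alpha> x (e # vs)) \<and> (\<forall>x. c + a \<bullet> x = 0 \<longrightarrow> F x = 0)" for vs
    by (rule antiderivative[OF pform_polyf[OF \<alpha>] ae])
  then obtain F where F: "\<And>vs. polyf (Suc r) (F vs)" "\<And>vs x. dirderiv e (F vs) x = \<alpha> x (e # vs)"
    "\<And>vs x. c + a \<bullet> x = 0 \<Longrightarrow> F vs x = 0" by metis
  note d = polyf_differentiable[OF F(1)]
  have z: "F vs x = 0" if "\<And>x. \<alpha> x (e # vs) = 0" for vs x
    by (rule antiderivative_unique[of "F vs" a e c]) (auto simp: d ae F that)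
  have "(\<lambda>vs. F vs x) \<in> alt_maps k" for x
  proof (rule alt_mapsI)
    note \<beta> = alt_maps_Cons[OF pform_alt[OF \<alpha>], of _ e]
    show "F vs x = 0" if "length vs \<noteq> k" for vs 
      using alt_maps_length[OF \<beta> that] by (rule z)
    show "F (us @ v # ws @ v # xs) x = 0" for us v ws xs
      using alt_maps_alternate[OF \<beta>] by (rule z)
    show "linear (\<lambda>u. F (us @ u # vs) x)" for us vs
    proof (rule linearI)
      show "F (us @ (u + w) # vs) x = F (us @ u # vs) x + F (us @ w # vs) x" for u w
        by (rule antiderivative_eq[OF F(1) polyf.add[OF F(1) F(1)] ae, where c = c]) 
          (auto simp: dirderiv_add d F alt_maps_add_arg[OF \<beta>])
      show "F (us @ (t *\<^sub>R u) # vs) x = t *\<^sub>R F (us @ u # vs) x" for t u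
        unfolding real_scaleR_def
        by (rule antiderivative_eq[OF F(1) polyf_scale[OF F(1)] ae, where c = c]) 
          (auto simp: dirderiv_cmult d F alt_maps_scale_arg[OF \<beta>])
    qed
  qed
  then have "pform (Suc r) k (\<lambda>x vs. F vs x)" using F(1) by (simp add: pform_def)
  moreover have "F (e # ws) x = 0" for x ws
    using alt_maps_alternate[OF pform_alt[OF \<alpha>], of _ "[]" e "[]" ws] by (intro z) simp
  ultimately show thesis using that[of "\<lambda>x vs. F vs x"] F by simp
qed

text \<open>The contraction of \<open>d\<gamma>\<close> with \<open>e\<close> is the derivative of \<open>\<gamma>\<close> along \<open>e\<close>, as \<open>\<gamma>\<close> is annihilated by \<open>e\<close>.  So
  \<open>\<alpha> - d\<gamma>\<close> is annihilated by \<open>e\<close>, and, being closed, is constant along \<open>e\<close>.\<close>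

lemma primitive_along_defect:
  fixes e :: "'a::euclidean_space"
  assumes \<alpha>: "pform r (Suc k) \<alpha>" and closed: "\<And>x vs. ext_d (Suc k) \<alpha> x vs = 0"
    and \<gamma>: "pform (Suc r) k \<gamma>" "\<And>x ws. \<gamma> x (e # ws) = 0" 
    and dirderiv\<gamma>: "\<And>x vs. dirderiv e (\<lambda>y. \<gamma> y vs) x = \<alpha> x (e # vs)"
  shows "\<alpha> x (e # ws) = ext_d k \<gamma> x (e # ws)" 
    and "dirderiv e (\<lambda>y. \<alpha> y vs - ext_d k \<gamma> y vs) x = 0"
proof -
  show "\<alpha> x (e # ws) = ext_d k \<gamma> x (e # ws)"
  proof (cases "length ws = k")
    case True
    then show ?thesis by (simp add: ext_d_Cons \<gamma>(2) dirderiv_const dirderiv\<gamma>)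
  next
    case False
    then show ?thesis using alt_maps_length[OF pform_alt[OF \<alpha>]] by (simp add: ext_d_def)
  qed
  have e\<gamma>: "dirderiv e (\<lambda>y. \<gamma> y vs) = (\<lambda>x. \<alpha> x (e # vs))" for vs using dirderiv\<gamma> by auto
  show "dirderiv e (\<lambda>y. \<alpha> y vs - ext_d k \<gamma> y vs) x = 0"
  proof (cases "length vs = Suc k")
    case True
    have "dirderiv e (\<lambda>y. \<alpha> y vs) x = (\<Sum>i<Suc k. (- 1) ^ i * dirderiv (vs ! i) (\<lambda>y. \<alpha> y (e # omit i vs)) x)"
      using closed[of x "e # vs"] ext_d_Cons[OF True, of \<alpha> x e] by simp
    also have "\<dots> = (\<Sum>i\<le>k. (- 1) ^ i * dirderiv e (dirderiv (vs ! i) (\<lambda>y. \<gamma> y (omit i vs))) x)"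
      by (simp only: polyf_dirderiv_commute[OF pform_polyf[OF \<gamma>(1)], of e] e\<gamma> lessThan_Suc_atMost)
    also have "\<dots> = dirderiv e (\<lambda>y. ext_d k \<gamma> y vs) x"
      using True by (simp add: ext_d_def dirderiv_sum dirderiv_cmult polyf_differentiable[OF polyf_dirderiv[OF pform_polyf[OF \<gamma>(1)]]])
    finally show ?thesis
      by (simp add: dirderiv_diff pform_differentiable[OF \<alpha>] pform_differentiable[OF pform_ext_d[OF \<gamma>(1)]])
  next
    case False
    then show ?thesis using alt_maps_length[OF pform_alt[OF \<alpha>]] by (simp add: ext_d_def dirderiv_const)
  qed
qed

text \<open>
  Let the pullback of a closed form \<open>\<alpha>\<close> to a hyperplane vanish.  The antiderivative of \<open>\<alpha>\<close> along a
  transverse direction \<open>e\<close>, starting at the hyperplane, is then a primitive.  Moreover, this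
  primitive is annihilated by \<open>e\<close>.
\<close>

lemma relative_poincare:
  fixes e :: "'a::euclidean_space"
  assumes \<alpha>: "pform r (Suc k) \<alpha>" and closed: "\<And>x vs. ext_d (Suc k) \<alpha> x vs = 0" and ae: "a \<bullet> e = 1"
    and tang: "\<And>x vs. c + a \<bullet> x = 0 \<Longrightarrow> (\<And>v. v \<in> set vs \<Longrightarrow> a \<bullet> v = 0) \<Longrightarrow> \<alpha> x vs = 0"
  obtains \<gamma> where "pform (Suc r) k \<gamma>" "\<And>x ws. \<gamma> x (e # ws) = 0" "\<And>x vs. ext_d k \<gamma> x vs = \<alpha> x vs"
proof -
  obtain \<gamma> where \<gamma>: "pform (Suc r) k \<gamma>" "\<And>x ws. \<gamma> x (e # ws) = 0"
    "\<And>x vs. dirderiv e (\<lambda>y. \<gamma> y vs) x = \<alpha> x (e # vs)"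
    "\<And>x vs. c + a \<bullet> x = 0 \<Longrightarrow> \<gamma> x vs = 0" using primitive_along[OF \<alpha> ae] by blast
  define D where "D = (\<lambda>x vs. \<alpha> x vs - ext_d k \<gamma> x vs)"
  have D: "pform r (Suc k) D" unfolding D_def using pform_ext_d[OF \<gamma>(1)] by (intro pform_diff \<alpha>) simp
  have De: "D x (e # ws) = 0" "dirderiv e (\<lambda>y. D y vs) x = 0" for x ws vs
    unfolding D_def using primitive_along_defect[OF \<alpha> closed \<gamma>(1-3)] by simp_all
  have "ext_d k \<gamma> x vs = \<alpha> x vs" for x vs
  proof -
    \<comment> \<open>Both \<open>x\<close> and the vectors are projected along \<open>e\<close>; on the hyperplane, \<open>\<gamma>\<close> and its tangential derivatives vanish.\<close>
    define p where "p = x + (- (c + a \<bullet> x)) *\<^sub>R e"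
    have p: "c + a \<bullet> p = 0" by (simp add: p_def ae inner_add_right)
    let ?vs = "map (\<lambda>v. v - (a \<bullet> v) *\<^sub>R e) vs"
    have t: "a \<bullet> v = 0" if "v \<in> set ?vs" for v using that by (auto simp: ae inner_diff_right)
    have "D x vs = D p vs" unfolding p_def
      by (rule sym, rule dirderiv_zero_const_line[of "\<lambda>y. D y vs"]) (auto simp: De pform_differentiable[OF D])
    also have "\<dots> = D p ?vs"
      by (rule sym, rule alt_maps_contraction_zero[OF pform_alt[OF D]]) (rule De)
    also have "\<dots> = 0"
    proof -
      have "dirderiv (?vs ! i) (\<lambda>y. \<gamma> y (omit i ?vs)) p = 0" if "i < length vs" for i
      proof (rule dirderiv_zero_line[OF pform_differentiable[OF \<gamma>(1)]])
        show "\<gamma> (p + s *\<^sub>R ?vs ! i) (omit i ?vs) = 0" for s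
          using t[of "?vs ! i"] that p by (intro \<gamma>(4)) (auto simp: inner_add_right)
      qed
      then have "ext_d k \<gamma> p ?vs = 0" by (auto simp: ext_d_def simp del: nth_map)
      moreover have "\<alpha> p ?vs = 0" by (rule tang[OF p]) (rule t)
      ultimately show ?thesis by (simp add: D_def)
    qed
    finally show ?thesis by (simp add: D_def)
  qed
  with \<gamma> show thesis using that by blast
qed

text \<open>In the absence of a hyperplane, the coordinate directions are removed one at a time.  The
  remainder is annihilated by the directions in \<open>S\<close> and constant along them.\<close>

lemma poincare_aux:
  fixes \<alpha> :: "'a::euclidean_space form"
  assumes "finite S" "S \<subseteq> Basis" "pform r (Suc k) \<alpha>" "\<And>x vs. ext_d (Suc k) \<alpha> x vs = 0"
  shows "\<exists>\<gamma>. pform (Suc r) k \<gamma> \<and> (\<forall>b\<in>S. (\<forall>x ws. \<alpha> x (b # ws) = ext_d k \<gamma> x (b # ws)) \<and> 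
     (\<forall>x vs. dirderiv b (\<lambda>y. \<alpha> y vs - ext_d k \<gamma> y vs) x = 0))"
  using assms(1,2)
proof (induction S)
  case empty
  show ?case using pform_zero by blast
next
  case (insert e S)
  then obtain \<gamma> where \<gamma>: "pform (Suc r) k \<gamma>" "\<And>b x ws. b \<in> S \<Longrightarrow> \<alpha> x (b # ws) = ext_d k \<gamma> x (b # ws)"
     "\<And>b x vs. b \<in> S \<Longrightarrow> dirderiv b (\<lambda>y. \<alpha> y vs - ext_d k \<gamma> y vs) x = 0" by auto
  define D where "D = (\<lambda>x vs. \<alpha> x vs - ext_d k \<gamma> x vs)"
  have D: "pform r (Suc k) D" unfolding D_def using pform_ext_d[OF \<gamma>(1)] by (intro pform_diff assms) simp
  have closed: "ext_d (Suc k) D x vs = 0" for x vs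
    unfolding D_def ext_d_diff[OF assms(3) pform_ext_d[OF \<gamma>(1)]] ext_d_ext_d[OF \<gamma>(1)] assms(4) by simp
  have Db: "D x (b # ws) = 0" "dirderiv b (\<lambda>y. D y vs) x = 0" if "b \<in> S" for b x ws vs
    using \<gamma>(2,3) that by (auto simp: D_def)
  have ee: "e \<bullet> e = 1" using insert.prems by (simp add: inner_Basis)
  obtain \<delta> where \<delta>: "pform (Suc r) k \<delta>" "\<And>x ws. \<delta> x (e # ws) = 0"
    "\<And>x vs. dirderiv e (\<lambda>y. \<delta> y vs) x = D x (e # vs)"
    "\<And>x vs. 0 + e \<bullet> x = 0 \<Longrightarrow> \<delta> x vs = 0" using primitive_along[OF D ee] by blast
  define D' where "D' = (\<lambda>x vs. D x vs - ext_d k \<delta> x vs)"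
  have sum: "\<alpha> x vs - ext_d k (\<lambda>x vs. \<gamma> x vs + \<delta> x vs) x vs = D' x vs" for x vs
    unfolding ext_d_add[OF \<gamma>(1) \<delta>(1)] D'_def D_def by simp
  have "D' x (b # ws) = 0 \<and> dirderiv b (\<lambda>y. D' y vs) x = 0" if "b \<in> insert e S" for b x ws vs
  proof (cases "b = e")
    case True
    then show ?thesis using primitive_along_defect[OF D closed \<delta>(1-3)] by (simp add: D'_def)
  next
    case False
    then have b: "b \<in> S" using that by simp
    have eb: "e \<bullet> b = 0" using False insert.prems b by (auto simp: inner_Basis)
    have \<delta>b: "\<delta> x (b # ws) = 0" for x ws
    proof (rule antiderivative_unique[of "\<lambda>x. \<delta> x (b # ws)" e e 0])
      show "dirderiv e (\<lambda>y. \<delta> y (b # ws)) x = 0" for x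
        using alt_maps_swap[OF pform_alt[OF D], of x "[]" e b ws] Db(1)[OF b] by (simp add: \<delta>(3))
    qed (auto simp: ee \<delta>(4) pform_differentiable[OF \<delta>(1)])
    have dirderiv\<delta>: "dirderiv b (\<lambda>y. \<delta> y vs) x = 0" for x vs
    proof (rule antiderivative_unique[of "dirderiv b (\<lambda>y. \<delta> y vs)" e e 0])
      show "dirderiv e (dirderiv b (\<lambda>y. \<delta> y vs)) x = 0" for x
        unfolding polyf_dirderiv_commute[OF pform_polyf[OF \<delta>(1)], of e b] \<delta>(3)[abs_def] using Db(2)[OF b] by simp
      show "dirderiv b (\<lambda>y. \<delta> y vs) x = 0" if "0 + e \<bullet> x = 0" for x
        using that eb by (intro dirderiv_zero_line[OF pform_differentiable[OF \<delta>(1)]] \<delta>(4)) (simp add: inner_add_right)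
    qed (auto simp: ee polyf_differentiable[OF polyf_dirderiv[OF pform_polyf[OF \<delta>(1)]]])
    have "ext_d k \<delta> x (b # ws) = 0"
      by (cases "length ws = k") (simp add: ext_d_Cons dirderiv\<delta> \<delta>b dirderiv_const, simp add: ext_d_def)
    moreover have "dirderiv b (\<lambda>y. ext_d k \<delta> y vs) x = 0"
    proof -
      have "dirderiv b (dirderiv v (\<lambda>y. \<delta> y us)) x = 0" for v us
      proof -
        have "dirderiv b (\<lambda>y. \<delta> y us) = (\<lambda>x. 0)" using dirderiv\<delta> by blast
        then show ?thesis unfolding polyf_dirderiv_commute[OF pform_polyf[OF \<delta>(1)], of b v] by (simp add: dirderiv_const)
      qed
      then show ?thesis
        by (cases "length vs = Suc k") 
          (simp_all add: ext_d_def dirderiv_sum dirderiv_cmult dirderiv_const polyf_differentiable[OF polyf_dirderiv[OF pform_polyf[OF \<delta>(1)]]])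
    qed
    ultimately show ?thesis
      unfolding D'_def using Db[OF b] 
      by (simp add: dirderiv_diff pform_differentiable[OF D] pform_differentiable[OF pform_ext_d[OF \<delta>(1)]])
  qed
  note D' = this
  show ?case
  proof (intro exI conjI ballI allI)
    show "pform (Suc r) k (\<lambda>x vs. \<gamma> x vs + \<delta> x vs)" by (rule pform_add[OF \<gamma>(1) \<delta>(1)])
    fix b x ws vs assume b: "b \<in> insert e S"
    show "\<alpha> x (b # ws) = ext_d k (\<lambda>x vs. \<gamma> x vs + \<delta> x vs) x (b # ws)"
      using D'[OF b] sum[of x "b # ws"] by simp
    show "dirderiv b (\<lambda>y. \<alpha> y vs - ext_d k (\<lambda>x vs. \<gamma> x vs + \<delta> x vs) y vs) x = 0"
      unfolding sum using D'[OF b] by simp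
  qed
qed

lemma poincare:
  fixes \<alpha> :: "'a::euclidean_space form"
  assumes "pform r (Suc k) \<alpha>" "\<And>x vs. ext_d (Suc k) \<alpha> x vs = 0"
  obtains \<gamma> where "pform (Suc r) k \<gamma>" "\<And>x vs. ext_d k \<gamma> x vs = \<alpha> x vs"
proof -
  obtain \<gamma> where \<gamma>: "pform (Suc r) k \<gamma>" "\<And>b x ws. b \<in> Basis \<Longrightarrow> \<alpha> x (b # ws) = ext_d k \<gamma> x (b # ws)"
    using poincare_aux[OF finite_Basis subset_refl assms] by blast
  have "\<alpha> x vs = ext_d k \<gamma> x vs" for x vs
  proof (cases vs)
    case Nil
    then show ?thesis using alt_maps_length[OF pform_alt[OF assms(1)]] by (simp add: ext_d_def)
  next
    case (Cons v ws)
    have "linear (\<lambda>u. \<alpha> x (u # ws))" "linear (\<lambda>u. ext_d k \<gamma> x (u # ws))"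
      using alt_maps_linear[OF pform_alt[OF assms(1)], of x "[]"] 
        alt_maps_linear[OF pform_alt[OF pform_ext_d[OF \<gamma>(1)]], of x "[]"] by simp_all
    from linear_eq_stdbasis[OF this] \<gamma>(2) show ?thesis by (simp add: Cons fun_eq_iff)
  qed
  with \<gamma> show thesis using that by metis
qed

section \<open>Functions that are Lipschitz on bounded sets\<close>

definition loclip :: "('a::real_normed_vector \<Rightarrow> 'b::real_normed_vector) \<Rightarrow> bool" where
  "loclip f \<longleftrightarrow> (\<forall>B. \<exists>L. \<forall>x y. norm x \<le> B \<longrightarrow> norm y \<le> B \<longrightarrow> norm (f x - f y) \<le> L * norm (x - y))"

lemma loclipE:
  assumes "loclip f" shows "\<exists>L\<ge>0. \<forall>x y. norm x \<le> B \<longrightarrow> norm y \<le> B \<longrightarrow> norm (f x - f y) \<le> L * norm (x - y)"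
proof -
  obtain L where L: "\<And>x y. norm x \<le> B \<Longrightarrow> norm y \<le> B \<Longrightarrow> norm (f x - f y) \<le> L * norm (x - y)"
    using assms unfolding loclip_def by meson
  have "norm (f x - f y) \<le> max 0 L * norm (x - y)" if "norm x \<le> B" "norm y \<le> B" for x y
    by (rule order_trans[OF L[OF that]]) (intro mult_right_mono, auto)
  then show ?thesis by (intro exI[of _ "max 0 L"]) auto
qed

lemma loclip_bounded:
  assumes "loclip f" shows "\<exists>M\<ge>0. \<forall>x. norm x \<le> B \<longrightarrow> norm (f x) \<le> M"
proof -
  obtain L where L: "0 \<le> L" "\<And>x y. norm x \<le> B \<Longrightarrow> norm y \<le> B \<Longrightarrow> norm (f x - f y) \<le> L * norm (x - y)"
    using loclipE[OF assms, of B] by blast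
  have "norm (f x) \<le> norm (f 0) + L * \<bar>B\<bar>" if "norm x \<le> B" for x
  proof -
    have "norm (f x) \<le> norm (f 0) + norm (f x - f 0)" by (metis add.commute norm_triangle_sub)
    also have "norm (f x - f 0) \<le> L * norm (x - 0)" using that order_trans[OF norm_ge_zero that] by (intro L(2)) auto
    also have "\<dots> \<le> L * \<bar>B\<bar>" using that L(1) by (intro mult_left_mono) auto
    finally show ?thesis by simp
  qed
  then show ?thesis using L(1) by (intro exI[of _ "norm (f 0) + L * \<bar>B\<bar>"]) auto
qed

lemma loclip_const: "loclip (\<lambda>x. c)"
  unfolding loclip_def by (auto intro!: exI[of _ 0])

lemma loclip_bounded_linear: assumes "bounded_linear f" shows "loclip f"
  proof -
  obtain K where "\<And>x. norm (f x) \<le> norm x * K" using bounded_linear.bounded[OF assms] by blast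
  then show ?thesis unfolding loclip_def 
    by (auto simp: linear_diff[OF bounded_linear.linear[OF assms], symmetric] mult.commute intro!: exI[of _ K])
qed

lemma loclip_add: assumes "loclip f" "loclip g" shows "loclip (\<lambda>x. f x + g x)"
  unfolding loclip_def
proof
  fix B
  obtain L where "0 \<le> L" and L: "\<And>x y. norm x \<le> B \<Longrightarrow> norm y \<le> B \<Longrightarrow> norm (f x - f y) \<le> L * norm (x - y)"
    using loclipE[OF assms(1), of B] by blast
  obtain K where "0 \<le> K" and K: "\<And>x y. norm x \<le> B \<Longrightarrow> norm y \<le> B \<Longrightarrow> norm (g x - g y) \<le> K * norm (x - y)"
    using loclipE[OF assms(2), of B] by blast
  have "norm (f x + g x - (f y + g y)) \<le> (L + K) * norm (x - y)" if "norm x \<le> B" "norm y \<le> B" for x y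
    using norm_triangle_ineq[of "f x - f y" "g x - g y"] L[OF that] K[OF that] by (simp add: algebra_simps)
  then show "\<exists>L. \<forall>x y. norm x \<le> B \<longrightarrow> norm y \<le> B \<longrightarrow> norm (f x + g x - (f y + g y)) \<le> L * norm (x - y)" by blast
qed

lemma loclip_scaleR:
  assumes "loclip f" "loclip g" shows "loclip (\<lambda>x. f x *\<^sub>R g x)"
  unfolding loclip_def
proof
  fix B
  obtain L where "0 \<le> L" and L: "\<And>x y. norm x \<le> B \<Longrightarrow> norm y \<le> B \<Longrightarrow> norm (f x - f y) \<le> L * norm (x - y)"
    using loclipE[OF assms(1), of B] by blast
  obtain K where "0 \<le> K" and K: "\<And>x y. norm x \<le> B \<Longrightarrow> norm y \<le> B \<Longrightarrow> norm (g x - g y) \<le> K * norm (x - y)"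
    using loclipE[OF assms(2), of B] by blast
  obtain M where M: "0 \<le> M" "\<And>x. norm x \<le> B \<Longrightarrow> norm (f x) \<le> M" using loclip_bounded[OF assms(1), of B] by blast
  obtain N where N: "0 \<le> N" "\<And>x. norm x \<le> B \<Longrightarrow> norm (g x) \<le> N" using loclip_bounded[OF assms(2), of B] by blast
  have "norm (f x *\<^sub>R g x - f y *\<^sub>R g y) \<le> (M * K + N * L) * norm (x - y)" if "norm x \<le> B" "norm y \<le> B" for x y
  proof -
    have "f x *\<^sub>R g x - f y *\<^sub>R g y = f x *\<^sub>R (g x - g y) + (f x - f y) *\<^sub>R g y"
      by (simp add: algebra_simps)
    then have "norm (f x *\<^sub>R g x - f y *\<^sub>R g y) \<le> norm (f x) * norm (g x - g y) + norm (f x - f y) * norm (g y)"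
      by (metis norm_scaleR norm_triangle_ineq real_norm_def)
    also have "\<dots> \<le> M * (K * norm (x - y)) + (L * norm (x - y)) * N"
      using that M N K L order_trans[OF norm_ge_zero L[OF that]] by (intro add_mono mult_mono) auto
    finally show ?thesis by (simp add: algebra_simps)
  qed
  then show "\<exists>L. \<forall>x y. norm x \<le> B \<longrightarrow> norm y \<le> B \<longrightarrow> norm (f x *\<^sub>R g x - f y *\<^sub>R g y) \<le> L * norm (x - y)" by blast
qed

lemma loclip_diff: assumes "loclip f" "loclip g" shows "loclip (\<lambda>x. f x - g x)"
  using loclip_add[OF assms(1) loclip_scaleR[OF loclip_const assms(2)], of "-1"] by simp

lemma loclip_compose:
  assumes "loclip f" "loclip g" shows "loclip (\<lambda>x. f (g x))"
  unfolding loclip_def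
proof
  fix B
  obtain K where "0 \<le> K" and K: "\<And>x y. norm x \<le> B \<Longrightarrow> norm y \<le> B \<Longrightarrow> norm (g x - g y) \<le> K * norm (x - y)"
    using loclipE[OF assms(2), of B] by blast
  obtain N where "0 \<le> N" and N: "\<And>x. norm x \<le> B \<Longrightarrow> norm (g x) \<le> N" using loclip_bounded[OF assms(2), of B] by blast
  obtain L where L: "0 \<le> L" "\<And>x y. norm x \<le> N \<Longrightarrow> norm y \<le> N \<Longrightarrow> norm (f x - f y) \<le> L * norm (x - y)"
    using loclipE[OF assms(1), of N] by blast
  have "norm (f (g x) - f (g y)) \<le> (L * K) * norm (x - y)" if "norm x \<le> B" "norm y \<le> B" for x y
  proof -
    have "norm (f (g x) - f (g y)) \<le> L * norm (g x - g y)" using N that by (intro L(2)) auto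
    also have "\<dots> \<le> L * (K * norm (x - y))" using K that L(1) by (intro mult_left_mono) auto
    finally show ?thesis by simp
  qed
  then show "\<exists>L. \<forall>x y. norm x \<le> B \<longrightarrow> norm y \<le> B \<longrightarrow> norm (f (g x) - f (g y)) \<le> L * norm (x - y)" by blast
qed

text \<open>The retraction onto a piece is built from a minimum of affine functions.\<close>

lemma loclip_min:
  fixes f g :: "'a::real_normed_vector \<Rightarrow> real"
  assumes "loclip f" "loclip g" shows "loclip (\<lambda>x. min (f x) (g x))"
proof -
  have "loclip (\<lambda>x::real. \<bar>x\<bar>)" unfolding loclip_def by (auto intro!: exI[of _ 1])
  from loclip_compose[OF this loclip_diff[OF assms]]
  have "loclip (\<lambda>x. (1/2) *\<^sub>R (f x + g x - \<bar>f x - g x\<bar>))"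
    by (intro loclip_scaleR loclip_const loclip_diff loclip_add assms)
  moreover have "(1/2) *\<^sub>R (a + b - \<bar>a - b\<bar>) = min a b" for a b :: real by (simp add: min_def abs_if)
  ultimately show ?thesis by (simp only:)
qed

lemma loclip_Min:
  fixes f :: "'i \<Rightarrow> 'a::real_normed_vector \<Rightarrow> real"
  assumes "finite I" "I \<noteq> {}" "\<And>i. i \<in> I \<Longrightarrow> loclip (f i)"
  shows "loclip (\<lambda>x. Min ((\<lambda>i. f i x) ` I))"
  using assms
proof (induction I rule: finite_ne_induct)
  case (insert i I)
  then show ?case using loclip_min[of "f i" "\<lambda>x. Min ((\<lambda>i. f i x) ` I)"] by simp
qed simp

lemma loclip_polyf: "polyf r f \<Longrightarrow> loclip f"
proof (induction rule: polyf.induct)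
  case (coord r f b)
  then show ?case using loclip_scaleR[OF loclip_bounded_linear[OF bounded_linear_inner_left[of b]]] by fastforce
qed (auto intro: loclip_const loclip_add)

lemma loclip_continuous: assumes "loclip f" shows "continuous_on UNIV f"
proof -
  have "isCont f x" for x
  proof -
    obtain L where L: "0 \<le> L" "\<And>z y. norm z \<le> norm x + 1 \<Longrightarrow> norm y \<le> norm x + 1 \<Longrightarrow> norm (f z - f y) \<le> L * norm (z - y)"
    using loclipE[OF assms, of "norm x + 1"] by blast
    have "L-lipschitz_on (ball x 1) f"
    proof (rule lipschitz_onI)
      fix z y assume "z \<in> ball x 1" "y \<in> ball x 1"
      then have "norm z \<le> norm x + 1" "norm y \<le> norm x + 1"
        using norm_triangle_ineq2[of z x] norm_triangle_ineq2[of y x] by (auto simp: dist_norm norm_minus_commute)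
      then show "dist (f z) (f y) \<le> L * dist z y" using L(2) by (simp add: dist_norm)
    qed (rule L)
    then have "continuous_on (ball x 1) f" by (rule lipschitz_on_continuous_on)
    then show ?thesis by (simp add: continuous_on_eq_continuous_at)
  qed
  then show ?thesis by (simp add: continuous_on_eq_continuous_at)
qed

section \<open>Compatible families of polynomial forms\<close>

lemma pform_shear: "pform r k \<gamma> \<Longrightarrow> pform r k (\<lambda>x. \<gamma> (x - (c + a \<bullet> x) *\<^sub>R e))"
  unfolding pform_def using polyf_shear by blast

text \<open>The composition on the left is the pullback of \<open>\<gamma>\<close>, because \<open>\<gamma>\<close> is annihilated by \<open>e\<close>.  The claim is that \<open>d\<close> commutes
  with this pullback.\<close>

lemma ext_d_shear:
  assumes "pform r k \<gamma>" "\<And>x ws. \<gamma> x (e # ws) = 0"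
  shows "ext_d k (\<lambda>x. \<gamma> (x - (c + a \<bullet> x) *\<^sub>R e)) x vs 
    = ext_d k \<gamma> (x - (c + a \<bullet> x) *\<^sub>R e) (map (\<lambda>v. v - (a \<bullet> v) *\<^sub>R e) vs)"
proof -
  let ?m = "map (\<lambda>v. v - (a \<bullet> v) *\<^sub>R e)"
  have "\<gamma> y (omit i (?m vs)) = \<gamma> y (omit i vs)" for y i
    using alt_maps_contraction_zero[OF pform_alt[OF assms(1)] assms(2), of y "\<lambda>v. a \<bullet> v" "omit i vs"]
    by (simp add: take_map drop_map)
  then show ?thesis
    using dirderiv_shear[OF pform_differentiable[OF assms(1)]] by (simp add: ext_d_def)
qed

text \<open>
  The pieces are the sets where one of the affine functions \<open>c l + a l \<bullet> x\<close> is the least.  Transversality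
  says that the vector \<open>e m\<close> crosses every face of the piece \<open>m\<close> with unit speed.  This makes the
  projections of the other pieces along \<open>e m\<close> fit together to one continuous retraction.
\<close>

locale fan =
  fixes X :: "'i set" and c :: "'i \<Rightarrow> real" and a :: "'i \<Rightarrow> 'a::euclidean_space" and e :: "'i \<Rightarrow> 'a"
  assumes fin: "finite X" and nonempty: "X \<noteq> {}"
    and transverse: "\<And>l m. l \<in> X \<Longrightarrow> m \<in> X \<Longrightarrow> l \<noteq> m \<Longrightarrow> (a m - a l) \<bullet> e m = 1"
begin

definition lam :: "'i \<Rightarrow> 'a \<Rightarrow> real" where "lam l x = c l + a l \<bullet> x"

lemma lam_diff: "lam m x - lam l x = (c m - c l) + (a m - a l) \<bullet> x"
  by (simp add: lam_def inner_diff_left)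

lemma lam_loclip: "loclip (lam l)"
  unfolding lam_def[abs_def] by (intro loclip_add loclip_const loclip_bounded_linear bounded_linear_inner_right)

text \<open>
  A primitive of \<open>\<alpha> m\<close> relative to a single face serves all faces between \<open>m\<close> and \<open>Y\<close>: its composition with the projection along \<open>e m\<close> has
  the pullback of \<open>\<alpha> m\<close> to the face as its derivative, and this pullback agrees with that of \<open>\<alpha> l = 0\<close>.
\<close>

lemma primitive_step:
  assumes \<alpha>: "\<And>l. l \<in> X \<Longrightarrow> pform r (Suc k) (\<alpha> l)" 
    and closed: "\<And>l x vs. l \<in> X \<Longrightarrow> ext_d (Suc k) (\<alpha> l) x vs = 0"
    and compat: "\<And>l m x vs. l \<in> X \<Longrightarrow> m \<in> X \<Longrightarrow> lam l x = lam m x \<Longrightarrow> 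
          (\<And>v. v \<in> set vs \<Longrightarrow> (a m - a l) \<bullet> v = 0) \<Longrightarrow> \<alpha> l x vs = \<alpha> m x vs"
    and Y: "Y \<subseteq> X" "Y \<noteq> {}" "\<And>l x vs. l \<in> Y \<Longrightarrow> \<alpha> l x vs = 0" and m: "m \<in> X - Y"
  shows "\<exists>\<gamma>. pform (Suc r) k \<gamma> \<and> (\<forall>l\<in>insert m Y. \<forall>x vs. 
    ext_d k (\<lambda>x. \<gamma> (x - ((c m - c l) + (a m - a l) \<bullet> x) *\<^sub>R e m)) x vs = \<alpha> l x vs)"
proof -
  obtain l0 where l0: "l0 \<in> Y" using Y by blast
  have 1: "(a m - a l0) \<bullet> e m = 1" using l0 Y m by (intro transverse) auto
  have 2: "\<alpha> m x vs = 0" if "(c m - c l0) + (a m - a l0) \<bullet> x = 0" "\<And>v. v \<in> set vs \<Longrightarrow> (a m - a l0) \<bullet> v = 0" for x vs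
  proof -
    have "\<alpha> m x vs = \<alpha> l0 x vs" 
      using l0 Y m that(1) that(2)[unfolded inner_diff_left] unfolding lam_diff[symmetric] 
      by (intro compat[symmetric]) (auto simp: inner_diff_left)
    then show ?thesis using Y(3) l0 by simp
  qed
  obtain \<gamma> where \<gamma>: "pform (Suc r) k \<gamma>" "\<And>x ws. \<gamma> x (e m # ws) = 0" "\<And>x vs. ext_d k \<gamma> x vs = \<alpha> m x vs"
    using relative_poincare[OF \<alpha> closed 1 2] m by blast
  have "ext_d k (\<lambda>x. \<gamma> (x - ((c m - c l) + (a m - a l) \<bullet> x) *\<^sub>R e m)) x vs = \<alpha> l x vs" if "l \<in> insert m Y" for l x vs
  proof (cases "l = m")
    case True
    then show ?thesis using \<gamma>(3) by simp
  next
    case False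
    then have l: "l \<in> Y" using that by simp
    have 1: "(a m - a l) \<bullet> e m = 1" using l Y m False by (intro transverse) auto
    let ?y = "x - ((c m - c l) + (a m - a l) \<bullet> x) *\<^sub>R e m" and ?m = "map (\<lambda>v. v - ((a m - a l) \<bullet> v) *\<^sub>R e m)"
    have y: "lam m ?y - lam l ?y = 0" unfolding lam_diff using 1 by (simp add: inner_diff_right)
    have "\<alpha> m ?y (?m vs) = \<alpha> l ?y (?m vs)"
    proof (rule compat[symmetric])
      fix v assume "v \<in> set (?m vs)"
      then show "(a m - a l) \<bullet> v = 0" using 1 by (auto simp: inner_diff_right)
    qed (use l Y m y in auto)
    then show ?thesis unfolding ext_d_shear[OF \<gamma>(1,2)] \<gamma>(3) using Y(3)[OF l] by simp
  qed
  with \<gamma>(1) show ?thesis by blast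
qed

text \<open>Only derivatives tangent to the hyperplane occur, and these agree for functions that agree there.\<close>

lemma ext_d_compatible:
  assumes \<rho>: "\<And>l. l \<in> X \<Longrightarrow> pform s k (\<rho> l)" 
    and compat: "\<And>l m x. l \<in> X \<Longrightarrow> m \<in> X \<Longrightarrow> lam l x = lam m x \<Longrightarrow> \<rho> l x = \<rho> m x"
    and lm: "l \<in> X" "m \<in> X" "lam l x = lam m x" and tang: "\<And>v. v \<in> set vs \<Longrightarrow> (a m - a l) \<bullet> v = 0"
  shows "ext_d k (\<rho> l) x vs = ext_d k (\<rho> m) x vs"
proof -
  have "dirderiv (vs ! i) (\<lambda>y. \<rho> l y (omit i vs)) x = dirderiv (vs ! i) (\<lambda>y. \<rho> m y (omit i vs)) x" if "i < length vs" for i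
  proof -
    note d = pform_differentiable[OF \<rho>]
    have "(a m - a l) \<bullet> (vs ! i) = 0" using that by (intro tang) simp
    then have "lam l (x + t *\<^sub>R vs ! i) = lam m (x + t *\<^sub>R vs ! i)" for t
      using lm(3) by (simp add: lam_def inner_add_right inner_diff_left)
    then have "dirderiv (vs ! i) (\<lambda>y. \<rho> l y (omit i vs) - \<rho> m y (omit i vs)) x = 0"
      using compat[OF lm(1,2)] by (intro dirderiv_zero_line[OF differentiable_diff[OF d[OF lm(1)] d[OF lm(2)]]]) simp
    then show ?thesis by (simp add: dirderiv_diff d lm)
  qed
  then show ?thesis by (auto simp: ext_d_def intro!: sum.cong)
qed

text \<open>
  The induction constructs both a family \<open>\<rho>\<close> of polynomial forms, for which compatibility is required on the full
  hyperplanes, and the glued form \<open>R\<close>.  The latter is carried along because the retraction gives its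
  Lipschitz estimate directly.
\<close>

theorem continuous_primitive:
  assumes \<alpha>: "\<And>l. l \<in> X \<Longrightarrow> pform r (Suc k) (\<alpha> l)" 
    and closed: "\<And>l x vs. l \<in> X \<Longrightarrow> ext_d (Suc k) (\<alpha> l) x vs = 0"
    and compat: "\<And>l m x vs. l \<in> X \<Longrightarrow> m \<in> X \<Longrightarrow> lam l x = lam m x \<Longrightarrow> 
          (\<And>v. v \<in> set vs \<Longrightarrow> (a m - a l) \<bullet> v = 0) \<Longrightarrow> \<alpha> l x vs = \<alpha> m x vs"
  obtains \<rho> R where "\<And>l. l \<in> X \<Longrightarrow> pform (Suc r) k (\<rho> l)" 
    "\<And>l x vs. l \<in> X \<Longrightarrow> ext_d k (\<rho> l) x vs = \<alpha> l x vs"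
    "\<And>l x. l \<in> X \<Longrightarrow> (\<And>j. j \<in> X \<Longrightarrow> lam l x \<le> lam j x) \<Longrightarrow> R x = \<rho> l x"
    "\<And>vs. loclip (\<lambda>x. R x vs)"
proof -
  define P where "P Y \<rho> R \<longleftrightarrow> (\<forall>l\<in>X. pform (Suc r) k (\<rho> l)) \<and> (\<forall>l\<in>Y. \<forall>x vs. ext_d k (\<rho> l) x vs = \<alpha> l x vs) \<and>
    (\<forall>l\<in>X. \<forall>m\<in>X. \<forall>x. lam l x = lam m x \<longrightarrow> \<rho> l x = \<rho> m x) \<and>
    (\<forall>l\<in>X. \<forall>x. (\<forall>j\<in>X. lam l x \<le> lam j x) \<longrightarrow> R x = \<rho> l x) \<and> (\<forall>vs. loclip (\<lambda>x. R x vs))"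
    for Y and \<rho> :: "'i \<Rightarrow> 'a form" and R
  have "\<exists>\<rho> R. P Y \<rho> R"
    if "finite Y" "Y \<noteq> {}" "Y \<subseteq> X" for Y using that
  proof (induction Y rule: finite_ne_induct)
    case (singleton m)
    then have "m \<in> X" by simp
    then obtain \<gamma> where \<gamma>: "pform (Suc r) k \<gamma>" "\<And>x vs. ext_d k \<gamma> x vs = \<alpha> m x vs"
      using poincare[OF \<alpha> closed] by metis
    have "P {m} (\<lambda>_. \<gamma>) \<gamma>" unfolding P_def using \<gamma> by (simp add: loclip_polyf[OF pform_polyf])
    then show ?case by blast
  next
    case (insert m Y)
    have "Y \<subseteq> X" using insert.prems by simp
    from insert.IH[OF this] obtain \<rho> R where "P Y \<rho> R" by blast
    then have \<rho>: "\<And>l. l \<in> X \<Longrightarrow> pform (Suc r) k (\<rho> l)" 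
      "\<And>l x vs. l \<in> Y \<Longrightarrow> ext_d k (\<rho> l) x vs = \<alpha> l x vs"
      "\<And>l m x. l \<in> X \<Longrightarrow> m \<in> X \<Longrightarrow> lam l x = lam m x \<Longrightarrow> \<rho> l x = \<rho> m x"
      "\<And>l x. l \<in> X \<Longrightarrow> (\<And>j. j \<in> X \<Longrightarrow> lam l x \<le> lam j x) \<Longrightarrow> R x = \<rho> l x" 
      "\<And>vs. loclip (\<lambda>x. R x vs)" unfolding P_def by blast+
    define \<beta> where "\<beta> = (\<lambda>l x vs. \<alpha> l x vs - ext_d k (\<rho> l) x vs)"
    have \<beta>1: "pform r (Suc k) (\<beta> l)" if "l \<in> X" for l
      unfolding \<beta>_def using pform_ext_d[OF \<rho>(1)] that by (intro pform_diff \<alpha>) auto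
    have \<beta>2: "ext_d (Suc k) (\<beta> l) x vs = 0" if "l \<in> X" for l x vs
      using that unfolding \<beta>_def ext_d_diff[OF \<alpha>[OF that] pform_ext_d[OF \<rho>(1)[OF that]]] 
      by (simp add: ext_d_ext_d[OF \<rho>(1)] closed)
    have \<beta>3: "\<beta> l x vs = \<beta> m x vs" if "l \<in> X" "m \<in> X" "lam l x = lam m x" 
      "\<And>v. v \<in> set vs \<Longrightarrow> (a m - a l) \<bullet> v = 0" for l m x vs
    proof -
      have "\<alpha> l x vs = \<alpha> m x vs" by (rule compat[OF that(1-3)]) (rule that(4))
      moreover have "ext_d k (\<rho> l) x vs = ext_d k (\<rho> m) x vs"
        using \<rho>(1,3) that by (rule ext_d_compatible[of "Suc r" k \<rho> l m x vs])
      ultimately show ?thesis by (simp only: \<beta>_def)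
    qed
    have \<beta>4: "\<beta> l x vs = 0" if "l \<in> Y" for l x vs using \<rho>(2)[OF that] by (simp add: \<beta>_def)
    \<comment> \<open>\<open>?A l\<close> is the retraction \<open>?y\<close> on the piece \<open>l\<close>.\<close>
    let ?A = "\<lambda>l x. x - ((c m - c l) + (a m - a l) \<bullet> x) *\<^sub>R e m"
    have "\<exists>\<gamma>. pform (Suc r) k \<gamma> \<and> (\<forall>l\<in>insert m Y. \<forall>x vs. ext_d k (\<lambda>x. \<gamma> (?A l x)) x vs = \<beta> l x vs)"
    proof (rule primitive_step)
      show "pform r (Suc k) (\<beta> l)" if "l \<in> X" for l by (rule \<beta>1[OF that])
      show "ext_d (Suc k) (\<beta> l) x vs = 0" if "l \<in> X" for l x vs by (rule \<beta>2[OF that])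
      show "\<beta> l x vs = \<beta> j x vs" if "l \<in> X" "j \<in> X" "lam l x = lam j x" 
        "\<And>v. v \<in> set vs \<Longrightarrow> (a j - a l) \<bullet> v = 0" for l j x vs using that by (rule \<beta>3)
      show "\<beta> l x vs = 0" if "l \<in> Y" for l x vs by (rule \<beta>4[OF that])
    qed (use insert in auto)
    then obtain \<gamma> where \<gamma>: "pform (Suc r) k \<gamma>" 
      "\<And>l x vs. l \<in> insert m Y \<Longrightarrow> ext_d k (\<lambda>x. \<gamma> (?A l x)) x vs = \<beta> l x vs" by blast
    let ?\<rho> = "\<lambda>l x vs. \<rho> l x vs + \<gamma> (?A l x) vs"
    let ?y = "\<lambda>x. x - (lam m x - Min ((\<lambda>l. lam l x) ` X)) *\<^sub>R e m"
    let ?R = "\<lambda>x vs. R x vs + \<gamma> (?y x) vs"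
    have "pform (Suc r) k (?\<rho> l)" if "l \<in> X" for l
      using that by (intro pform_add \<rho>(1) pform_shear \<gamma>(1))
    moreover have "ext_d k (?\<rho> l) x vs = \<alpha> l x vs" if "l \<in> insert m Y" for l x vs
    proof -
      have "l \<in> X" using that insert by auto
      then show ?thesis using \<gamma>(2)[OF that] by (simp add: ext_d_add[OF \<rho>(1) pform_shear[OF \<gamma>(1)]] \<beta>_def)
    qed
    moreover have "?\<rho> l x = ?\<rho> j x" if "l \<in> X" "j \<in> X" "lam l x = lam j x" for l j x
      using that \<rho>(3)[OF that] unfolding lam_diff[symmetric] by simp
    moreover have "?R x = ?\<rho> l x" if "l \<in> X" "\<And>j. j \<in> X \<Longrightarrow> lam l x \<le> lam j x" for l x
    proof -
      have "Min ((\<lambda>l. lam l x) ` X) = lam l x" using that fin by (intro Min_eqI) auto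
      then show ?thesis using \<rho>(4)[OF that] unfolding lam_diff[symmetric] by simp
    qed
    moreover have "loclip (\<lambda>x. ?R x vs)" for vs
    proof -
      have "loclip ?y"
        by (intro loclip_diff loclip_scaleR loclip_const lam_loclip loclip_Min fin nonempty 
            loclip_bounded_linear[OF bounded_linear_ident])
      then show ?thesis
        by (intro loclip_add \<rho>(5) loclip_compose[OF loclip_polyf[OF pform_polyf[OF \<gamma>(1)]]])
    qed
    ultimately have "P (insert m Y) ?\<rho> ?R" unfolding P_def by blast
    then show ?case by blast
  qed
  from this[OF fin nonempty subset_refl] obtain \<rho> R where "P X \<rho> R" by blast
  then show thesis unfolding P_def by (elim conjE) (rule that[of \<rho> R]; blast)
qed

end

section \<open>Smooth bump functions\<close>

text \<open>The standard smooth function that is flat at \<open>0\<close> is \<open>flat 1\<close>.  General polynomials \<open>p\<close> are admitted in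
  order to have a class that is closed under differentiation (\<open>flat_deriv\<close>).\<close>

definition flat :: "real poly \<Rightarrow> real \<Rightarrow> real" where
  "flat p t = (if t > 0 then poly p (1 / t) * exp (- (1 / t)) else 0)"

lemma poly_exp_tendsto_0: "((\<lambda>s. poly p s * exp (- s)) \<longlongrightarrow> (0::real)) at_top"
proof -
  have "((\<lambda>s. \<Sum>i\<le>degree p. coeff p i * (s ^ i / exp s)) \<longlongrightarrow> (\<Sum>i\<le>degree p. coeff p i * 0)) at_top"
    by (intro tendsto_sum tendsto_mult tendsto_const tendsto_power_div_exp_0)
  moreover have "(\<Sum>i\<le>degree p. coeff p i * (s ^ i / exp s)) = poly p s * exp (- s)" for s
    by (simp add: poly_altdef sum_distrib_right exp_minus divide_inverse mult.assoc)
  ultimately show ?thesis by simp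
qed

lemma flat_tendsto_0: "(flat p \<longlongrightarrow> 0) (at_right 0)"
proof -
  have "((\<lambda>t. poly p (inverse t) * exp (- inverse t)) \<longlongrightarrow> 0) (at_right (0::real))"
    by (rule filterlim_compose[OF poly_exp_tendsto_0 filterlim_inverse_at_top_right])
  then show ?thesis
    by (rule Lim_transform_eventually) (auto simp: eventually_at_filter flat_def inverse_eq_divide)
qed

lemma flat_deriv: "(flat p has_field_derivative flat ([:0, 0, 1:] * (p - pderiv p)) t) (at t)"
proof (cases t "0::real" rule: linorder_cases)
  case greater
  have "((\<lambda>t. poly p (1 / t) * exp (- (1 / t))) has_field_derivative 
      poly (pderiv p) (1 / t) * (- 1 / t\<^sup>2) * exp (- (1 / t)) + poly p (1 / t) * (exp (- (1 / t)) * (1 / t\<^sup>2))) (at t)"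
    using greater by (auto intro!: derivative_eq_intros DERIV_chain2[OF poly_DERIV] simp: power2_eq_square)
  also have "poly (pderiv p) (1 / t) * (- 1 / t\<^sup>2) * exp (- (1 / t)) + poly p (1 / t) * (exp (- (1 / t)) * (1 / t\<^sup>2))
     = flat ([:0, 0, 1:] * (p - pderiv p)) t"
    using greater by (simp add: flat_def field_simps power2_eq_square)
  finally show ?thesis
    by (rule has_field_derivative_transform_within_open[of _ _ _ "{0<..}"]) (use greater in \<open>auto simp: flat_def\<close>)
next
  case less
  have "((\<lambda>t. 0) has_field_derivative flat ([:0, 0, 1:] * (p - pderiv p)) t) (at t)"
    using less by (simp add: flat_def)
  then show ?thesis
    by (rule has_field_derivative_transform_within_open[of _ _ _ "{..<0}"]) (use less in \<open>auto simp: flat_def\<close>)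
next
  case equal
  have "((\<lambda>h. (flat p (0 + h) - flat p 0) / h) \<longlongrightarrow> 0) (at (0::real))"
    unfolding filterlim_at_split
  proof
    show "((\<lambda>h. (flat p (0 + h) - flat p 0) / h) \<longlongrightarrow> 0) (at_left (0::real))"
      by (rule Lim_transform_eventually[OF tendsto_const]) (auto simp: eventually_at_filter flat_def)
    \<comment> \<open>For \<open>h > 0\<close> the difference quotient is again of the form \<open>flat\<close>, with one more factor \<open>1 / h\<close>.\<close>
    show "((\<lambda>h. (flat p (0 + h) - flat p 0) / h) \<longlongrightarrow> 0) (at_right (0::real))"
      by (rule Lim_transform_eventually[OF flat_tendsto_0[of "[:0, 1:] * p"]]) 
        (auto simp: eventually_at_filter flat_def)
  qed
  then show ?thesis using equal by (simp add: DERIV_def flat_def)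
qed

text \<open>Differentiable functions that form a class closed under directional derivatives are smooth.  Unlike \<open>C_diff m\<close>, this
  class is stable under products without keeping track of an order.\<close>

inductive smoothf :: "('a::euclidean_space \<Rightarrow> real) \<Rightarrow> bool" where
  const: "smoothf (\<lambda>x. c)"
| coord: "smoothf (\<lambda>x. x \<bullet> b)"
| add: "smoothf f \<Longrightarrow> smoothf g \<Longrightarrow> smoothf (\<lambda>x. f x + g x)"
| mult: "smoothf f \<Longrightarrow> smoothf g \<Longrightarrow> smoothf (\<lambda>x. f x * g x)"
| flat: "smoothf g \<Longrightarrow> smoothf (\<lambda>x. flat p (g x))"

lemma flat_compose_deriv:
  assumes "g differentiable (at x)"
  shows "(\<lambda>x. flat p (g x)) differentiable (at x)"
    and "dirderiv v (\<lambda>x. flat p (g x)) x = flat ([:0, 0, 1:] * (p - pderiv p)) (g x) * dirderiv v g x"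
proof -
  have "((\<lambda>x. flat p (g x)) has_derivative (\<lambda>v. flat ([:0, 0, 1:] * (p - pderiv p)) (g x) * dirderiv v g x)) (at x)"
    by (rule has_derivative_compose[OF differentiable_has_derivative_dirderiv[OF assms] 
          flat_deriv[unfolded has_field_derivative_def]])
  then show "(\<lambda>x. flat p (g x)) differentiable (at x)"
    "dirderiv v (\<lambda>x. flat p (g x)) x = flat ([:0, 0, 1:] * (p - pderiv p)) (g x) * dirderiv v g x"
    by (auto simp: differentiable_def intro: dirderiv_eq)
qed

lemma smoothf_differentiable: "smoothf f \<Longrightarrow> f differentiable (at x)"
  by (induction rule: smoothf.induct) (auto intro!: derivative_intros flat_compose_deriv)

lemma smoothf_dirderiv: "smoothf f \<Longrightarrow> smoothf (dirderiv v f)"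
proof (induction rule: smoothf.induct)
  case (add f g)
  have "dirderiv v (\<lambda>x. f x + g x) = (\<lambda>x. dirderiv v f x + dirderiv v g x)"
    using add by (auto simp: fun_eq_iff dirderiv_add smoothf_differentiable)
  then show ?case using add by (auto intro: smoothf.add)
next
  case (mult f g)
  have "dirderiv v (\<lambda>x. f x * g x) = (\<lambda>x. f x * dirderiv v g x + dirderiv v f x * g x)"
    using mult by (auto simp: fun_eq_iff dirderiv_mult smoothf_differentiable)
  then show ?case using mult by (auto intro: smoothf.add smoothf.mult)
next
  case (flat g p)
  have "dirderiv v (\<lambda>x. flat p (g x)) = (\<lambda>x. flat ([:0, 0, 1:] * (p - pderiv p)) (g x) * dirderiv v g x)"
    using flat_compose_deriv(2)[OF smoothf_differentiable[OF flat(1)]] by (auto simp: fun_eq_iff)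
  then show ?case using flat by (auto intro: smoothf.flat smoothf.mult)
qed (auto simp: dirderiv_const dirderiv_coord intro: smoothf.const)

lemma smoothf_C_diff: "smoothf f \<Longrightarrow> C_diff m f"
proof (induction m arbitrary: f)
  case 0
  then show ?case
    by (simp add: continuous_at_imp_continuous_on differentiable_imp_continuous_within smoothf_differentiable)
next
  case (Suc m)
  have "C_diff m (\<lambda>x. frechet_derivative f (at x) v)" for v
    using Suc.IH[OF smoothf_dirderiv[OF Suc.prems], of v] by (simp add: dirderiv_def[abs_def])
  then show ?case using Suc.prems by (simp add: smoothf_differentiable)
qed

lemma smoothf_sum: "(\<And>i. i \<in> I \<Longrightarrow> smoothf (f i)) \<Longrightarrow> smoothf (\<lambda>x. \<Sum>i\<in>I. f i x)"
  by (induction I rule: infinite_finite_induct) (auto intro: smoothf.const smoothf.add)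

definition bump :: "'a::euclidean_space \<Rightarrow> real \<Rightarrow> 'a \<Rightarrow> real" where
  "bump q R x = flat 1 (R\<^sup>2 - (norm (x - q))\<^sup>2)"

text \<open>The derivative of \<open>flat 1\<close>, as \<open>flat\<close> of \<open>s \<mapsto> s\<^sup>2\<close>, at the argument that occurs in \<open>bump\<close>.\<close>

definition bump_slope :: "'a::euclidean_space \<Rightarrow> real \<Rightarrow> 'a \<Rightarrow> real" where
  "bump_slope q R x = flat [:0, 0, 1:] (R\<^sup>2 - (norm (x - q))\<^sup>2)"

lemma bump_sign: "dist q x < R \<Longrightarrow> 0 < bump q R x" "0 \<le> R \<Longrightarrow> R \<le> dist q x \<Longrightarrow> bump q R x = 0"
  "dist q x < R \<Longrightarrow> 0 < bump_slope q R x" "0 \<le> R \<Longrightarrow> R \<le> dist q x \<Longrightarrow> bump_slope q R x = 0"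
proof -
  show "0 < bump q R x" "0 < bump_slope q R x" if "dist q x < R"
  proof -
    have "(norm (x - q))\<^sup>2 < R\<^sup>2" using that by (intro power_strict_mono) (auto simp: dist_norm norm_minus_commute)
    then show "0 < bump q R x" "0 < bump_slope q R x" by (auto simp: bump_def bump_slope_def flat_def)
  qed
  show "bump q R x = 0" "bump_slope q R x = 0" if "0 \<le> R" "R \<le> dist q x"
  proof -
    have "R\<^sup>2 \<le> (norm (x - q))\<^sup>2" using that by (intro power_mono) (auto simp: dist_norm norm_minus_commute)
    then show "bump q R x = 0" "bump_slope q R x = 0" by (auto simp: bump_def bump_slope_def flat_def)
  qed
qed

lemma dirderiv_bump: "dirderiv v (bump q R) x = - 2 * bump_slope q R x * ((x - q) \<bullet> v)"
proof -
  let ?g = "\<lambda>x. R\<^sup>2 - (norm (x - q))\<^sup>2"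
  have g: "(?g has_derivative (\<lambda>v. - (2 * ((x - q) \<bullet> v)))) (at x)"
    unfolding power2_norm_eq_inner by (auto intro!: derivative_eq_intros simp: inner_commute)
  have "dirderiv v (\<lambda>x. flat 1 (?g x)) x = flat ([:0, 0, 1:] * (1 - pderiv 1)) (?g x) * dirderiv v ?g x"
    using g by (intro flat_compose_deriv) (auto simp: differentiable_def)
  then show ?thesis unfolding dirderiv_eq[OF g] by (simp add: bump_def[abs_def] bump_slope_def)
qed

lemma bump_test_function:
  assumes "0 \<le> R" "cball q R \<subseteq> U"
  shows "bump q R \<in> test_functions U"
proof -
  have "bump q R = (\<lambda>x. flat 1 (R\<^sup>2 + (\<Sum>b\<in>Basis. (-1) * ((x \<bullet> b + - (q \<bullet> b)) * (x \<bullet> b + - (q \<bullet> b))))))"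
    unfolding bump_def[abs_def] power2_norm_eq_inner
    by (subst euclidean_inner) (simp add: inner_diff_left sum_negf)
  moreover have "smoothf (\<lambda>x. flat 1 (R\<^sup>2 + (\<Sum>b\<in>Basis. (-1) * ((x \<bullet> b + - (q \<bullet> b)) * (x \<bullet> b + - (q \<bullet> b))))))"
    by (intro smoothf.intros smoothf_sum)
  ultimately have "smoothf (bump q R)" by simp
  moreover have "closure {x. bump q R x \<noteq> 0} \<subseteq> cball q R"
    by (rule closure_minimal) (use bump_sign(2)[OF assms(1), of q] in \<open>force simp: not_le\<close>, simp)
  moreover from this have "compact (closure {x. bump q R x \<noteq> 0})"
    by (metis bounded_cball bounded_subset closed_closure compact_eq_bounded_closed)
  ultimately show ?thesis using assms(2) smoothf_C_diff by (auto simp: test_functions_def)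
qed

section \<open>Integration by parts\<close>

lemma test_function_differentiable: "\<phi> \<in> test_functions U \<Longrightarrow> \<phi> differentiable (at x)"
  unfolding test_functions_def by (metis (mono_tags, lifting) C_diff.simps(2) mem_Collect_eq)

lemma test_function_dirderiv_continuous: "\<phi> \<in> test_functions U \<Longrightarrow> continuous_on UNIV (dirderiv v \<phi>)"
proof -
  assume "\<phi> \<in> test_functions U"
  then have "C_diff (Suc 0) \<phi>" by (auto simp: test_functions_def)
  then show ?thesis by (simp add: dirderiv_def[abs_def])
qed

lemma test_function_dirderiv_outside:
  assumes "\<phi> \<in> test_functions U" "x \<notin> closure {x. \<phi> x \<noteq> 0}" shows "dirderiv v \<phi> x = 0"
proof -
  have "(\<phi> has_derivative (\<lambda>v. 0)) (at x)"
    by (rule has_derivative_transform_within_open[of "\<lambda>x. 0" _ _ _ "- closure {x. \<phi> x \<noteq> 0}"]) 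
       (use assms(2) closure_subset[of "{x. \<phi> x \<noteq> 0}"] in auto)
  then show ?thesis using dirderiv_eq[of \<phi> "\<lambda>v. 0" x v] by simp
qed

lemma test_function_outside:
  assumes "\<phi> \<in> test_functions U" "x \<notin> U" shows "\<phi> x = 0" "dirderiv v \<phi> x = 0"
proof -
  have "x \<notin> closure {x. \<phi> x \<noteq> 0}" using assms by (auto simp: test_functions_def)
  then show "dirderiv v \<phi> x = 0" "\<phi> x = 0" using test_function_dirderiv_outside[OF assms(1)] closure_subset[of "{x. \<phi> x \<noteq> 0}"] by auto
qed

lemma test_function_mono: "\<phi> \<in> test_functions U \<Longrightarrow> U \<subseteq> V \<Longrightarrow> \<phi> \<in> test_functions V"
  by (auto simp: test_functions_def)

lemma test_function_support:
  assumes "\<phi> \<in> test_functions U"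
  obtains B where "0 < B" "\<And>x. B < norm x \<Longrightarrow> \<phi> x = 0" "\<And>x v. B < norm x \<Longrightarrow> dirderiv v \<phi> x = 0"
proof -
  have "bounded (closure {x. \<phi> x \<noteq> 0})" using assms compact_imp_bounded by (auto simp: test_functions_def)
  then obtain B where B: "0 < B" "\<And>x. x \<in> closure {x. \<phi> x \<noteq> 0} \<Longrightarrow> norm x \<le> B" 
    using bounded_pos by metis
  show thesis
  proof (rule that[OF B(1)])
    fix x v :: 'a assume "B < norm x"
    then have "x \<notin> closure {x. \<phi> x \<noteq> 0}" using B(2)[of x] by auto
    then show "\<phi> x = 0" "dirderiv v \<phi> x = 0" using test_function_dirderiv_outside[OF assms] closure_subset[of "{x. \<phi> x \<noteq> 0}"] by auto
  qed
qed

lemma test_function_lipschitz: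
  assumes "\<phi> \<in> test_functions U"
  obtains L where "0 \<le> L" "\<And>x y. \<bar>\<phi> x - \<phi> y\<bar> \<le> L * norm (x - y)"
proof -
  obtain B where B: "0 < B" "\<And>x. B < norm x \<Longrightarrow> \<phi> x = 0" "\<And>x v. B < norm x \<Longrightarrow> dirderiv v \<phi> x = 0"
    using test_function_support[OF assms] by blast
  have "\<exists>M. \<forall>x. \<bar>dirderiv b \<phi> x\<bar> \<le> M" for b
  proof -
    have "continuous_on (cball 0 B) (dirderiv b \<phi>)" 
      using test_function_dirderiv_continuous[OF assms] continuous_on_subset by blast
    then have "bounded (dirderiv b \<phi> ` cball 0 B)" by (intro compact_imp_bounded compact_continuous_image) auto
    then obtain M where M: "0 < M" "\<And>x. x \<in> cball 0 B \<Longrightarrow> \<bar>dirderiv b \<phi> x\<bar> \<le> M" 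
      unfolding bounded_pos by auto
    have "\<bar>dirderiv b \<phi> x\<bar> \<le> M" for x using M(1) M(2)[of x] B(3)[of x b] by (cases "norm x \<le> B") auto
    then show ?thesis by blast
  qed
  then obtain M where M: "\<And>b x. \<bar>dirderiv b \<phi> x\<bar> \<le> M b" by metis
  let ?L = "\<Sum>b\<in>Basis. M b"
  have "norm (\<phi> x - \<phi> y) \<le> ?L * norm (x - y)" for x y
  proof (rule differentiable_bound[of UNIV \<phi> "\<lambda>x v. dirderiv v \<phi> x"])
    show "(\<phi> has_derivative (\<lambda>v. dirderiv v \<phi> x)) (at x within UNIV)" for x
      using differentiable_has_derivative_dirderiv[OF test_function_differentiable[OF assms]] by simp
    show "onorm (\<lambda>v. dirderiv v \<phi> x) \<le> ?L" for x
    proof (rule onorm_le)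
      fix v
      have lin: "linear (\<lambda>v. dirderiv v \<phi> x)" by (rule linear_dirderiv[OF test_function_differentiable[OF assms]])
      have "dirderiv v \<phi> x = dirderiv (\<Sum>b\<in>Basis. (v \<bullet> b) *\<^sub>R b) \<phi> x" by (simp add: euclidean_representation)
      also have "\<dots> = (\<Sum>b\<in>Basis. (v \<bullet> b) * dirderiv b \<phi> x)" 
        unfolding linear_sum[OF lin] by (simp add: linear_cmul[OF lin])
      also have "norm \<dots> \<le> (\<Sum>b\<in>Basis. norm v * M b)"
        by (intro sum_norm_le) (auto simp: abs_mult intro!: mult_mono M Basis_le_norm)
      finally show "norm (dirderiv v \<phi> x) \<le> ?L * norm v" by (simp add: sum_distrib_left mult.commute)
    qed
  qed auto
  moreover have "0 \<le> ?L" using M by (intro sum_nonneg) (meson abs_ge_zero order_trans)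
  ultimately show thesis using that[of ?L] by auto
qed

lemma continuous_borel_measurable_lebesgue:
  fixes f :: "'a::euclidean_space \<Rightarrow> real"
  shows "continuous_on UNIV f \<Longrightarrow> f \<in> borel_measurable lebesgue"
  by (rule measurable_completion) (simp add: borel_measurable_continuous_onI)

lemma continuous_compact_support_integrable:
  fixes f :: "'a::euclidean_space \<Rightarrow> real"
  assumes "continuous_on UNIV f" "\<And>x. B < norm x \<Longrightarrow> f x = 0"
  shows "integrable lebesgue f"
proof -
  have "integrable lborel (\<lambda>x. indicator (cball 0 B) x *\<^sub>R f x)"
    using assms(1) continuous_on_subset by (intro borel_integrable_compact) auto
  also have "(\<lambda>x. indicator (cball 0 B) x *\<^sub>R f x) = f"
    using assms(2) by (auto simp: fun_eq_iff indicator_def not_le)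
  finally show ?thesis using assms(1) by (simp add: integrable_completion borel_measurable_continuous_onI)
qed

lemma integral_translate:
  fixes f :: "'a::euclidean_space \<Rightarrow> real"
  assumes "continuous_on UNIV f"
  shows "(LINT x|lebesgue. f (x + v)) = (LINT x|lebesgue. f x)"
proof -
  have m: "f \<in> borel_measurable borel" "(\<lambda>x. f (x + v)) \<in> borel_measurable borel"
    using assms by (auto intro!: borel_measurable_continuous_onI continuous_intros continuous_on_compose2[OF assms])
  have "(LINT x|lborel. f x) = (LINT x|distr lborel borel ((+) v). f x)" by (simp add: lborel_distr_plus)
  also have "\<dots> = (LINT x|lborel. f (v + x))" by (rule integral_distr) (use m in auto)
  finally show ?thesis using m by (simp add: integral_completion add.commute)
qed

text \<open>
  The difference quotients have integral \<open>0\<close> by translation invariance of the Lebesgue measure.  They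
  are bounded by the Lipschitz constant and vanish outside a fixed ball, so that the
  limit may be taken under the integral.
\<close>

lemma integral_derivative_zero:
  fixes f :: "'a::euclidean_space \<Rightarrow> real"
  assumes lip: "\<And>x y. \<bar>f x - f y\<bar> \<le> L * norm (x - y)" and supp: "\<And>x. B < norm x \<Longrightarrow> f x = 0"
    and meas: "f' \<in> borel_measurable lebesgue"
    and deriv: "AE x in lebesgue. ((\<lambda>t. f (x + t *\<^sub>R v)) has_field_derivative f' x) (at 0)"
  shows "integrable lebesgue f'" "(LINT x|lebesgue. f' x) = 0"
proof -
  define h where "h n = inverse (real (Suc n))" for n
  have h: "0 < h n" "h n \<le> 1" for n by (auto simp: h_def inverse_le_1_iff)
  define s where "s n x = (f (x + h n *\<^sub>R v) - f x) / h n" for n x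
  have "loclip f" unfolding loclip_def using lip by auto
  then have cont: "continuous_on UNIV f" by (rule loclip_continuous)
  have cont': "continuous_on UNIV (\<lambda>x. f (x + w))" for w
    by (intro continuous_on_compose2[OF cont] continuous_intros) auto
  have supp': "f (x + h n *\<^sub>R v) = 0" if "B + norm v < norm x" for x n
  proof (rule supp)
    have "norm (h n *\<^sub>R v) \<le> norm v" using h[of n] by (simp add: mult_left_le_one_le)
    then show "B < norm (x + h n *\<^sub>R v)" using that norm_diff_ineq[of x "h n *\<^sub>R v"] by linarith
  qed
  have int: "integrable lebesgue f" "integrable lebesgue (\<lambda>x. f (x + h n *\<^sub>R v))" for n
    using continuous_compact_support_integrable[OF cont supp] 
      continuous_compact_support_integrable[OF cont' supp'] by auto
  have s0: "(LINT x|lebesgue. s n x) = 0" for n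
    unfolding s_def using int by (simp add: integral_translate[OF cont])
  have sm: "s n \<in> borel_measurable lebesgue" for n
    unfolding s_def by (intro borel_measurable_divide borel_measurable_diff borel_measurable_const 
      borel_measurable_integrable[OF int(1)] borel_measurable_integrable[OF int(2)])
  let ?w = "\<lambda>x. indicator (cball 0 (B + norm v)) x *\<^sub>R (L * norm v)"
  have w: "integrable lebesgue ?w"
    using borel_integrable_compact[of "cball 0 (B + norm v)" "\<lambda>x. L * norm v"] by (subst integrable_completion) auto
  have bound: "AE x in lebesgue. norm (s n x) \<le> ?w x" for n
  proof (intro AE_I2)
    fix x
    show "norm (s n x) \<le> ?w x"
    proof (cases "norm x \<le> B + norm v")
      case True
      have "\<bar>f (x + h n *\<^sub>R v) - f x\<bar> \<le> L * norm v * h n" 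
        using lip[of "x + h n *\<^sub>R v" x] h(1)[of n] by (simp add: mult_ac)
      then show ?thesis using True h(1)[of n] by (simp add: s_def abs_divide divide_le_eq)
    next
      case False
      then have "f x = 0" using norm_ge_zero[of v] by (intro supp) linarith
      then show ?thesis using supp'[of x n] False by (simp add: s_def)
    qed
  qed
  have lim: "AE x in lebesgue. (\<lambda>n. s n x) \<longlonglongrightarrow> f' x"
    using deriv
  proof (rule AE_mp, intro AE_I2 impI)
    fix x assume "((\<lambda>t. f (x + t *\<^sub>R v)) has_field_derivative f' x) (at 0)"
    then have "((\<lambda>t. (f (x + t *\<^sub>R v) - f x) / t) \<longlongrightarrow> f' x) (at 0)" by (simp add: DERIV_def)
    moreover have "filterlim h (at 0) sequentially"
      unfolding filterlim_at h_def[abs_def] using LIMSEQ_inverse_real_of_nat by (auto simp del: of_nat_Suc)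
    ultimately show "(\<lambda>n. s n x) \<longlonglongrightarrow> f' x" unfolding s_def by (rule filterlim_compose)
  qed
  show "integrable lebesgue f'" by (rule integrable_dominated_convergence[OF meas sm w lim bound])
  have "(\<lambda>n. LINT x|lebesgue. s n x) \<longlonglongrightarrow> (LINT x|lebesgue. f' x)"
    by (rule integral_dominated_convergence[OF meas sm w lim bound])
  then show "(LINT x|lebesgue. f' x) = 0" by (simp add: s0 LIMSEQ_const_iff)
qed

text \<open>The product \<open>g * \<phi>\<close> is Lipschitz on the whole space because \<open>\<phi>\<close> vanishes outside a ball.\<close>

lemma integration_by_parts:
  fixes g :: "'a::euclidean_space \<Rightarrow> real"
  assumes g: "loclip g" and \<phi>: "\<phi> \<in> test_functions U" and meas: "g' \<in> borel_measurable lebesgue"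
    and deriv: "AE x in lebesgue. ((\<lambda>t. g (x + t *\<^sub>R v)) has_field_derivative g' x) (at 0)"
  shows "integrable lebesgue (\<lambda>x. g x * dirderiv v \<phi> x)" 
    and "integrable lebesgue (\<lambda>x. g' x * \<phi> x)"
    and "(LINT x|lebesgue. g' x * \<phi> x) = - (LINT x|lebesgue. g x * dirderiv v \<phi> x)"
proof -
  obtain B where B: "0 < B" "\<And>x. B < norm x \<Longrightarrow> \<phi> x = 0" "\<And>x v. B < norm x \<Longrightarrow> dirderiv v \<phi> x = 0"
    using test_function_support[OF \<phi>] by blast
  obtain L where L: "0 \<le> L" "\<And>x y. \<bar>\<phi> x - \<phi> y\<bar> \<le> L * norm (x - y)" 
    using test_function_lipschitz[OF \<phi>] by blast
  obtain K where K: "0 \<le> K" "\<And>x y. norm x \<le> B \<Longrightarrow> norm y \<le> B \<Longrightarrow> \<bar>g x - g y\<bar> \<le> K * norm (x - y)"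
    using loclipE[OF g, of B] by auto
  obtain M where M: "0 \<le> M" "\<And>x. norm x \<le> B \<Longrightarrow> \<bar>g x\<bar> \<le> M" using loclip_bounded[OF g, of B] by auto
  have "loclip \<phi>" unfolding loclip_def using L(2) by auto
  then have B2: "\<bar>\<phi> x\<bar> \<le> N" if "\<And>x. norm x \<le> B \<Longrightarrow> \<bar>\<phi> x\<bar> \<le> N" "0 \<le> N" for N x
    using that B(2)[of x] by (cases "norm x \<le> B") auto
  obtain N where N: "0 \<le> N" "\<And>x. \<bar>\<phi> x\<bar> \<le> N" 
    using loclip_bounded[OF \<open>loclip \<phi>\<close>, of B] B2 by (metis real_norm_def)
  have c\<phi>: "continuous_on UNIV \<phi>" by (rule loclip_continuous) fact
  have cg: "continuous_on UNIV g" by (rule loclip_continuous[OF g])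
  have both: "\<bar>g x * \<phi> x - g y * \<phi> y\<bar> \<le> (M * L + K * N) * norm (x - y)" if "norm x \<le> B" for x y
  proof (cases "norm y \<le> B")
    case True
    have "g x * \<phi> x - g y * \<phi> y = g x * (\<phi> x - \<phi> y) + (g x - g y) * \<phi> y" by (simp add: algebra_simps)
    then have "\<bar>g x * \<phi> x - g y * \<phi> y\<bar> \<le> \<bar>g x\<bar> * \<bar>\<phi> x - \<phi> y\<bar> + \<bar>g x - g y\<bar> * \<bar>\<phi> y\<bar>"
      by (metis abs_mult abs_triangle_ineq)
    also have "\<dots> \<le> M * (L * norm (x - y)) + (K * norm (x - y)) * N"
      using M K L N that True by (intro add_mono mult_mono) auto
    finally show ?thesis by (simp add: algebra_simps)
  next
    case False
    then have "\<phi> y = 0" using B(2) by simp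
    then have "\<bar>g x * \<phi> x - g y * \<phi> y\<bar> = \<bar>g x\<bar> * \<bar>\<phi> x - \<phi> y\<bar>" by (simp add: abs_mult)
    also have "\<dots> \<le> M * (L * norm (x - y))" using M L that by (intro mult_mono) auto
    also have "\<dots> \<le> (M * L + K * N) * norm (x - y)" using K N by (simp add: distrib_right)
    finally show ?thesis .
  qed
  have lip: "\<bar>g x * \<phi> x - g y * \<phi> y\<bar> \<le> (M * L + K * N) * norm (x - y)" for x y
  proof -
    consider "norm x \<le> B" | "norm y \<le> B" | "B < norm x" "B < norm y" by linarith
    then show ?thesis
    proof cases
      case 2
      then show ?thesis using both[of y x] by (simp add: abs_minus_commute norm_minus_commute)
    next
      case 3
      then show ?thesis using B(2) M L K N by simp
    qed (rule both)
  qed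
  have meas2: "(\<lambda>x. g x * dirderiv v \<phi> x + g' x * \<phi> x) \<in> borel_measurable lebesgue"
    using cg c\<phi> test_function_dirderiv_continuous[OF \<phi>, of v]
    by (intro borel_measurable_add borel_measurable_times meas continuous_borel_measurable_lebesgue)
  have deriv2: "AE x in lebesgue. ((\<lambda>t. g (x + t *\<^sub>R v) * \<phi> (x + t *\<^sub>R v)) has_field_derivative g x * dirderiv v \<phi> x + g' x * \<phi> x) (at 0)"
    using deriv
  proof (rule AE_mp, intro AE_I2 impI)
    fix x assume "((\<lambda>t. g (x + t *\<^sub>R v)) has_field_derivative g' x) (at 0)"
    from DERIV_mult[OF this has_field_derivative_line[OF test_function_differentiable[OF \<phi>]]]
    show "((\<lambda>t. g (x + t *\<^sub>R v) * \<phi> (x + t *\<^sub>R v)) has_field_derivative g x * dirderiv v \<phi> x + g' x * \<phi> x) (at 0)"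
      by (simp add: algebra_simps)
  qed
  have supp: "g x * \<phi> x = 0" if "B < norm x" for x using B(2)[OF that] by simp
  have r: "integrable lebesgue (\<lambda>x. g x * dirderiv v \<phi> x + g' x * \<phi> x)"
    "(LINT x|lebesgue. g x * dirderiv v \<phi> x + g' x * \<phi> x) = 0"
    by (rule integral_derivative_zero[OF lip _ meas2 deriv2], erule supp)+
  show 1: "integrable lebesgue (\<lambda>x. g x * dirderiv v \<phi> x)"
    using B(3) by (intro continuous_compact_support_integrable[of _ B] continuous_on_mult cg test_function_dirderiv_continuous[OF \<phi>]) auto
  from Bochner_Integration.integrable_diff[OF r(1) 1] 
  show 2: "integrable lebesgue (\<lambda>x. g' x * \<phi> x)" by simp
  show "(LINT x|lebesgue. g' x * \<phi> x) = - (LINT x|lebesgue. g x * dirderiv v \<phi> x)"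
    using r(2) Bochner_Integration.integral_add[OF 1 2] by simp
qed

lemma integral_pos:
  fixes f :: "'a::euclidean_space \<Rightarrow> real"
  assumes "integrable lebesgue f" "\<And>x. 0 \<le> f x" "open U" "p \<in> U" "\<And>x. x \<in> U \<Longrightarrow> 0 < f x"
  shows "0 < (LINT x|lebesgue. f x)"
proof -
  have "(LINT x|lebesgue. f x) \<noteq> 0"
  proof
    assume "(LINT x|lebesgue. f x) = 0"
    then have "AE x in lebesgue. f x = 0"
      using integral_nonneg_eq_0_iff_AE[OF assms(1)] assms(2) by simp
    then have "AE x in lebesgue. x \<notin> U" by (rule AE_mp) (use assms(5) in \<open>force intro!: AE_I2\<close>)
    then have "negligible U" using assms(3) by (simp add: negligible_iff_null_sets AE_iff_null_sets)
    then show False using open_not_negligible[OF assms(3)] assms(4) by blast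
  qed
  moreover have "0 \<le> (LINT x|lebesgue. f x)" using assms(2) by simp
  ultimately show ?thesis by linarith
qed

section \<open>Weakly closed piecewise polynomial forms\<close>

lemma polyf_continuous: "polyf r f \<Longrightarrow> continuous_on UNIV f"
  by (intro loclip_continuous loclip_polyf)

lemma polyf_integration_by_parts:
  assumes "polyf r f" "\<phi> \<in> test_functions U"
  shows "integrable lebesgue (\<lambda>x. f x * dirderiv v \<phi> x)" 
    and "integrable lebesgue (\<lambda>x. dirderiv v f x * \<phi> x)"
    and "(LINT x|lebesgue. dirderiv v f x * \<phi> x) = - (LINT x|lebesgue. f x * dirderiv v \<phi> x)"
proof -
  have "((\<lambda>t. f (x + t *\<^sub>R v)) has_field_derivative dirderiv v f x) (at 0)" for x
    using has_field_derivative_line[of f x 0 v] polyf_differentiable[OF assms(1)] by simp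
  then have d: "AE x in lebesgue. ((\<lambda>t. f (x + t *\<^sub>R v)) has_field_derivative dirderiv v f x) (at 0)" by simp
  have m: "dirderiv v f \<in> borel_measurable lebesgue"
    by (intro continuous_borel_measurable_lebesgue polyf_continuous[OF polyf_dirderiv[OF assms(1)]])
  note r = integration_by_parts[OF loclip_polyf[OF assms(1)] assms(2) m d]
  show "integrable lebesgue (\<lambda>x. f x * dirderiv v \<phi> x)" "integrable lebesgue (\<lambda>x. dirderiv v f x * \<phi> x)"
    "(LINT x|lebesgue. dirderiv v f x * \<phi> x) = - (LINT x|lebesgue. f x * dirderiv v \<phi> x)" by (fact r)+
qed

lemma pform_weak_ext_d:
  assumes \<alpha>: "pform r k \<alpha>" and \<phi>: "\<phi> \<in> test_functions U" and vs: "length vs = Suc k"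
  shows "integrable lebesgue (\<lambda>x. ext_d k \<alpha> x vs * \<phi> x)"
    and "(LINT x|lebesgue. ext_d k \<alpha> x vs * \<phi> x) = 
    - (\<Sum>i\<le>k. (- 1) ^ i * (LINT x|lebesgue. \<alpha> x (omit i vs) * dirderiv (vs ! i) \<phi> x))"
proof -
  note r = polyf_integration_by_parts[OF pform_polyf[OF \<alpha>] \<phi>]
  have eq: "ext_d k \<alpha> x vs * \<phi> x = (\<Sum>i\<le>k. (- 1) ^ i * (dirderiv (vs ! i) (\<lambda>y. \<alpha> y (omit i vs)) x * \<phi> x))" for x
    using vs by (simp add: ext_d_def sum_distrib_right mult.assoc)
  show "integrable lebesgue (\<lambda>x. ext_d k \<alpha> x vs * \<phi> x)"
    unfolding eq by (intro Bochner_Integration.integrable_sum integrable_mult_right r)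
  have "(LINT x|lebesgue. ext_d k \<alpha> x vs * \<phi> x) = 
     (\<Sum>i\<le>k. (- 1) ^ i * (LINT x|lebesgue. dirderiv (vs ! i) (\<lambda>y. \<alpha> y (omit i vs)) x * \<phi> x))"
    unfolding eq by (subst Bochner_Integration.integral_sum) (auto intro!: integrable_mult_right r)
  then show "(LINT x|lebesgue. ext_d k \<alpha> x vs * \<phi> x) = 
    - (\<Sum>i\<le>k. (- 1) ^ i * (LINT x|lebesgue. \<alpha> x (omit i vs) * dirderiv (vs ! i) \<phi> x))"
    by (simp add: r(3) sum_negf)
qed

lemma open_contains_segment:
  fixes p v :: "'a::real_normed_vector"
  assumes "open U" "p \<in> U" shows "\<exists>\<epsilon>>0. \<forall>t. 0 < t \<longrightarrow> t < \<epsilon> \<longrightarrow> p + t *\<^sub>R v \<in> U"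
proof -
  have "isCont (\<lambda>t. p + t *\<^sub>R v) 0" by (intro continuous_intros)
  then have "((\<lambda>t. p + t *\<^sub>R v) \<longlongrightarrow> p) (at (0::real))" by (simp add: isCont_def)
  from topological_tendstoD[OF this assms] obtain d where "0 < d" "\<And>t::real. t \<noteq> 0 \<Longrightarrow> dist t 0 < d \<Longrightarrow> p + t *\<^sub>R v \<in> U"
    unfolding eventually_at by auto
  then show ?thesis by (intro exI[of _ d]) auto
qed

context fan
begin

definition cell :: "'i \<Rightarrow> 'a set" where
  "cell l = {x. \<forall>j\<in>X - {l}. lam l x < lam j x}"

text \<open>The value of \<open>pw f\<close> is \<open>0\<close> where two pieces meet, which is a null set (\<open>AE_cell\<close>).\<close>

definition pw :: "('i \<Rightarrow> 'a \<Rightarrow> real) \<Rightarrow> 'a \<Rightarrow> real" where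
  "pw f x = (\<Sum>l\<in>X. indicat_real (cell l) x * f l x)"

lemma lam_continuous: "continuous_on UNIV (lam l)"
  by (rule loclip_continuous[OF lam_loclip])

lemma open_lam_less: "open {x. lam l x < lam j x}"
  by (intro open_Collect_less lam_continuous)

lemma open_cell: "open (cell l)"
proof -
  have "cell l = (\<Inter>j\<in>X - {l}. {x. lam l x < lam j x})" by (auto simp: cell_def)
  then show ?thesis using fin by (auto intro!: open_INT open_lam_less)
qed

lemma cell_disjoint: "l \<in> X \<Longrightarrow> m \<in> X \<Longrightarrow> x \<in> cell l \<Longrightarrow> x \<in> cell m \<Longrightarrow> l = m"
  unfolding cell_def by (metis (mono_tags, lifting) DiffI empty_iff insert_iff less_asym mem_Collect_eq)

lemma pw_cell: assumes "l \<in> X" "x \<in> cell l" shows "pw f x = f l x"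
proof -
  have "pw f x = (\<Sum>j\<in>X. if j = l then f l x else 0)"
    unfolding pw_def using assms by (intro sum.cong) (auto simp: indicator_def dest: cell_disjoint)
  then show ?thesis using assms fin by simp
qed

lemma normal_nonzero: "l \<in> X \<Longrightarrow> m \<in> X \<Longrightarrow> l \<noteq> m \<Longrightarrow> a m - a l \<noteq> 0"
  using transverse[of l m] by auto

lemma AE_cell: "AE x in lebesgue. \<exists>l\<in>X. x \<in> cell l"
proof -
  let ?N = "\<lambda>l j. {x. (a j - a l) \<bullet> x = c l - c j}"
  have "AE x in lebesgue. x \<notin> ?N l j" if "l \<in> X" "j \<in> X" "l \<noteq> j" for l j
    using negligible_hyperplane[of "a j - a l" "c l - c j"] normal_nonzero[OF that]
    by (intro AE_not_in) (simp add: negligible_iff_null_sets)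
  then have "\<forall>l\<in>X. \<forall>j\<in>X - {l}. AE x in lebesgue. x \<notin> ?N l j" by auto
  then have "AE x in lebesgue. \<forall>l\<in>X. \<forall>j\<in>X - {l}. x \<notin> ?N l j"
    using fin by (simp add: AE_ball_countable' countable_finite AE_finite_all)
  then show ?thesis
  proof (rule AE_mp, intro AE_I2 impI)
    fix x assume *: "\<forall>l\<in>X. \<forall>j\<in>X - {l}. x \<notin> ?N l j"
    have ne: "lam l x \<noteq> lam j x" if "l \<in> X" "j \<in> X - {l}" for l j
      using * that lam_diff[of j x l] by force
    obtain l where l: "l \<in> X" "\<And>j. j \<in> X \<Longrightarrow> lam l x \<le> lam j x"
      using arg_min_if_finite[OF fin nonempty, of "\<lambda>l. lam l x"] by (metis not_le)
    then have "x \<in> cell l" using ne[OF l(1)] unfolding cell_def by (auto simp: order_less_le)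
    then show "\<exists>l\<in>X. x \<in> cell l" using l by blast
  qed
qed

lemma pw_integrable: 
  assumes "\<And>l. l \<in> X \<Longrightarrow> integrable lebesgue (\<lambda>x. f l x * g x)" 
  shows "integrable lebesgue (\<lambda>x. pw f x * g x)"
proof -
  have "integrable lebesgue (\<lambda>x. \<Sum>l\<in>X. indicat_real (cell l) x *\<^sub>R (f l x * g x))"
    using open_cell by (intro Bochner_Integration.integrable_sum integrable_mult_indicator assms) auto
  then show ?thesis by (simp add: pw_def sum_distrib_right mult.assoc)
qed

lemma pw_measurable:
  assumes "\<And>l. l \<in> X \<Longrightarrow> continuous_on UNIV (f l)" 
  shows "pw f \<in> borel_measurable lebesgue"
  unfolding pw_def[abs_def] using open_cell
  by (intro borel_measurable_sum borel_measurable_times borel_measurable_indicator 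
     continuous_borel_measurable_lebesgue assms) auto

text \<open>The weak equation \<open>d\<omega> = 0\<close> on \<open>W\<close> for the form with pieces \<open>\<alpha> l\<close>.\<close>

definition weakly_closed :: "'a set \<Rightarrow> nat \<Rightarrow> ('i \<Rightarrow> 'a form) \<Rightarrow> bool" where
  "weakly_closed W k \<alpha> \<longleftrightarrow> (\<forall>\<phi>\<in>test_functions W. \<forall>vs. length vs = Suc k \<longrightarrow>
     (\<Sum>i\<le>k. (- 1) ^ i * (LINT x|lebesgue. pw (\<lambda>l x. \<alpha> l x (omit i vs)) x * dirderiv (vs ! i) \<phi> x)) = 0)"

text \<open>
  If \<open>d (\<alpha> l)\<close> were nonzero at a point of the cell, it would have a constant sign in a small ball, and a bump supported there
  would detect it.  The vanishing in the cell extends to the whole space, as the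
  coefficients are polynomials.
\<close>

lemma weakly_closed_piece:
  assumes \<alpha>: "\<And>l. l \<in> X \<Longrightarrow> pform r k (\<alpha> l)" and weak: "weakly_closed W k \<alpha>" 
    and W: "open W" "p \<in> W" "p \<in> cell l" and l: "l \<in> X"
  shows "ext_d k (\<alpha> l) x vs = 0"
proof (cases "length vs = Suc k")
  case True
  let ?f = "\<lambda>x. ext_d k (\<alpha> l) x vs"
  have poly: "polyf (r - 1) ?f" by (intro pform_polyf[OF pform_ext_d] \<alpha> l)
  have "?f q = 0" if q: "q \<in> W \<inter> cell l" for q
  proof (rule ccontr)
    assume nz: "?f q \<noteq> 0"
    define s where "s = sgn (?f q)"
    have op: "open (W \<inter> cell l \<inter> {x. 0 < s * ?f x})"
      using W(1) open_cell by (intro open_Int open_Collect_less continuous_intros polyf_continuous[OF poly]) auto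
    moreover have "q \<in> W \<inter> cell l \<inter> {x. 0 < s * ?f x}"
      using q nz by (auto simp: s_def sgn_if)
    ultimately obtain R where R: "0 < R" "cball q R \<subseteq> W \<inter> cell l \<inter> {x. 0 < s * ?f x}" 
      by (meson open_contains_cball)
    have \<phi>: "bump q R \<in> test_functions (W \<inter> cell l)" using R by (intro bump_test_function) auto
    then have \<phi>W: "bump q R \<in> test_functions W" using test_function_mono by blast
    have "pw (\<lambda>l x. \<alpha> l x (omit i vs)) x * dirderiv (vs ! i) (bump q R) x = \<alpha> l x (omit i vs) * dirderiv (vs ! i) (bump q R) x" for i x
      using pw_cell[OF l] test_function_outside(2)[OF \<phi>] by (cases "x \<in> cell l") auto
    moreover have "(\<Sum>i\<le>k. (- 1) ^ i * (LINT x|lebesgue. pw (\<lambda>l x. \<alpha> l x (omit i vs)) x * dirderiv (vs ! i) (bump q R) x)) = 0"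
      using weak \<phi>W True unfolding weakly_closed_def by blast
    ultimately have "(\<Sum>i\<le>k. (- 1) ^ i * (LINT x|lebesgue. \<alpha> l x (omit i vs) * dirderiv (vs ! i) (bump q R) x)) = 0"
      by (simp only:)
    then have "(LINT x|lebesgue. ?f x * bump q R x) = 0"
      by (simp add: pform_weak_ext_d(2)[OF \<alpha>[OF l] \<phi> True])
    moreover have "0 < (LINT x|lebesgue. s * (?f x * bump q R x))"
    proof (rule integral_pos[of _ "ball q R" q])
      show "integrable lebesgue (\<lambda>x. s * (?f x * bump q R x))"
        by (intro integrable_mult_right pform_weak_ext_d(1)[OF \<alpha>[OF l] \<phi> True])
      have pos: "0 < s * ?f x * bump q R x" if "x \<in> ball q R" for x
      proof (rule mult_pos_pos)
        have "x \<in> cball q R" using that by simp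
        then show "0 < s * ?f x" using R(2) by blast
        show "0 < bump q R x" using that bump_sign(1)[of q x R] by simp
      qed
      then show "0 < s * (?f x * bump q R x)" if "x \<in> ball q R" for x using that by (simp add: mult.assoc)
      show "0 \<le> s * (?f x * bump q R x)" for x
        using pos[of x] bump_sign(2)[of R q x] R(1) by (cases "x \<in> ball q R") (auto simp: mult.assoc)
    qed (use R in auto)
    ultimately show False by simp
  qed
  then show ?thesis
    using polyf_zero_open[OF poly, of "W \<inter> cell l" p x] W open_cell by auto
qed (simp add: ext_d_def)

text \<open>
  Subtracting the closed form \<open>\<alpha> l\<close> leaves the jump \<open>\<delta> = \<alpha> m - \<alpha> l\<close> on one side of the face, and \<open>0\<close> on the other side.
  The test function is a bump with centre \<open>q\<close> on the other side and with a support that reaches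
  across the face only in a small cap near \<open>p\<close>.  In the cap, its gradient is nearly normal to the
  face.  So, with the normal vector \<open>N\<close> as additional argument, the integrand has the sign of \<open>\<delta> p vs\<close> throughout the
  cap, and the integral cannot vanish.
\<close>

lemma weakly_closed_tangential_at:
  assumes \<alpha>: "\<And>l. l \<in> X \<Longrightarrow> pform r k (\<alpha> l)" and weak: "weakly_closed W k \<alpha>" 
    and closed: "\<And>x vs. ext_d k (\<alpha> l) x vs = 0"
    and W: "open W" "p \<in> W" and lm: "l \<in> X" "m \<in> X" "l \<noteq> m"
    and p: "lam l p = lam m p" "\<And>j. j \<in> X - {l, m} \<Longrightarrow> lam l p < lam j p"
    and tang: "\<And>v. v \<in> set vs \<Longrightarrow> (a m - a l) \<bullet> v = 0" and vs: "length vs = k"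
  shows "\<alpha> l p vs = \<alpha> m p vs"
proof (rule ccontr)
  assume nz: "\<alpha> l p vs \<noteq> \<alpha> m p vs"
  define N where "N = a l - a m"
  have N0: "N \<noteq> 0" using normal_nonzero[of m l] lm by (simp add: N_def)
  have Nt: "N \<bullet> v = 0" "v \<bullet> N = 0" if "v \<in> set vs" for v 
    using tang[OF that] by (auto simp: N_def inner_diff_left inner_diff_right inner_commute)
  have H: "lam l x - lam m x = N \<bullet> (x - p)" for x
    using p(1) unfolding N_def by (simp add: lam_def inner_diff_left inner_diff_right)
  define V where "V = W \<inter> (\<Inter>j\<in>X - {l, m}. {x. lam l x < lam j x} \<inter> {x. lam m x < lam j x})"
  have V: "open V" "p \<in> V"
    unfolding V_def using W fin p by (auto intro!: open_Int open_INT open_lam_less)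
  define \<delta> where "\<delta> x ws = \<alpha> m x ws - \<alpha> l x ws" for x ws
  define s where "s = sgn (\<delta> p vs)"
  have s: "0 < s * \<delta> p vs" using nz by (auto simp: s_def \<delta>_def sgn_if)
  have c\<delta>: "continuous_on UNIV (\<lambda>x. \<delta> x ws)" for ws
    unfolding \<delta>_def by (intro continuous_intros polyf_continuous[OF pform_polyf[OF \<alpha>]] lm)
  obtain \<epsilon> where \<epsilon>: "0 < \<epsilon>" "ball p \<epsilon> \<subseteq> V" using V openE by blast
  define \<sigma> where "\<sigma> = \<epsilon> / (4 * norm N)"
  have \<sigma>: "0 < \<sigma>" "\<sigma> * norm N = \<epsilon> / 4" using \<epsilon> N0 by (auto simp: \<sigma>_def)
  define q where "q = p - \<sigma> *\<^sub>R N"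
  \<comment> \<open>Up to a positive factor and a sign, \<open>E\<close> is the integrand in the cap.  At \<open>p\<close> only the normal term remains.\<close>
  define E where "E x = \<delta> x vs * ((x - q) \<bullet> N) - (\<Sum>i<k. (- 1) ^ i * \<delta> x (N # omit i vs) * ((x - q) \<bullet> (vs ! i)))" for x
  have Ep: "0 < s * E p"
  proof -
    have "E p = \<delta> p vs * (\<sigma> * (N \<bullet> N))"
      unfolding E_def q_def using Nt vs by simp
    then have "s * E p = (s * \<delta> p vs) * (\<sigma> * (N \<bullet> N))" by simp
    also have "0 < \<dots>" using s \<sigma>(1) N0 by (intro mult_pos_pos[OF s] mult_pos_pos) auto
    finally show ?thesis .
  qed
  have "open {x. 0 < s * E x}"
    unfolding E_def by (intro open_Collect_less continuous_intros c\<delta>)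
  then obtain \<tau>' where \<tau>': "0 < \<tau>'" "ball p \<tau>' \<subseteq> {x. 0 < s * E x}" using Ep openE by blast
  define \<tau> where "\<tau> = min \<tau>' (\<epsilon> / 4)"
  have \<tau>: "0 < \<tau>" "\<tau> \<le> \<epsilon> / 4" "\<And>x. norm (x - p) < \<tau> \<Longrightarrow> 0 < s * E x" 
    using \<tau>' \<epsilon> by (auto simp: \<tau>_def dist_norm norm_minus_commute subset_iff)
  \<comment> \<open>By Pythagoras, the ball of radius \<open>R\<close> about \<open>q\<close> meets the face in the ball of radius \<open>\<tau>\<close> about \<open>p\<close>.\<close>
  define R where "R = sqrt ((\<sigma> * norm N)\<^sup>2 + \<tau>\<^sup>2)"
  have R2: "R\<^sup>2 = (\<sigma> * norm N)\<^sup>2 + \<tau>\<^sup>2" by (simp add: R_def)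
  have R: "0 < R" "\<sigma> * norm N < R" "R \<le> \<epsilon> / 2"
  proof -
    show *: "\<sigma> * norm N < R" unfolding R_def using \<tau>(1) \<sigma> \<epsilon> by (intro real_less_rsqrt) simp
    then show "0 < R" using \<sigma> \<epsilon> by simp
    have "R \<le> \<sigma> * norm N + \<tau>" unfolding R_def using \<sigma> \<tau> \<epsilon> by (intro sqrt_sum_squares_le_sum) auto
    then show "R \<le> \<epsilon> / 2" using \<sigma> \<tau> by simp
  qed
  have "cball q R \<subseteq> V"
  proof
    fix x assume "x \<in> cball q R"
    then have "dist p x \<le> \<epsilon> / 4 + \<epsilon> / 2" 
      using dist_triangle[of p x q] R(3) \<sigma> by (simp add: q_def dist_norm)
    then show "x \<in> V" using \<epsilon> by auto
  qed
  then have \<phi>V: "bump q R \<in> test_functions V" using R(1) by (intro bump_test_function) auto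
  then have \<phi>: "bump q R \<in> test_functions W" by (rule test_function_mono) (auto simp: V_def)
  let ?\<phi> = "bump q R" and ?H = "{x. lam m x < lam l x}" and ?vs = "N # vs"
  have vs': "length ?vs = Suc k" using vs by simp
  have cap: "norm (x - p) < \<tau>" if "x \<in> ?H" "dist q x < R" for x
  proof -
    have "(norm (x - q))\<^sup>2 < R\<^sup>2" using that(2) by (intro power_strict_mono) (auto simp: dist_norm norm_minus_commute)
    moreover have xq: "x - q = (x - p) + \<sigma> *\<^sub>R N" by (simp add: q_def)
    have "(norm (x - q))\<^sup>2 = (norm (x - p))\<^sup>2 + 2 * \<sigma> * (N \<bullet> (x - p)) + (\<sigma> * norm N)\<^sup>2"
      unfolding power_mult_distrib xq power2_norm_eq_inner inner_add_left[of "x - p"] inner_add_right[of _ "x - p"]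
      by (simp add: inner_commute[of "x - p" N] power2_eq_square)
    moreover have "0 < N \<bullet> (x - p)" using that(1) H[of x] by simp
    ultimately have "(norm (x - p))\<^sup>2 < \<tau>\<^sup>2" using \<sigma>(1) R2 mult_pos_pos[of \<sigma> "N \<bullet> (x - p)"] by linarith
    then show ?thesis by (rule power_less_imp_less_base) (use \<tau> in auto)
  qed
  define G where "G x = indicat_real ?H x * (2 * bump_slope q R x * (s * E x))" for x
  let ?J = "\<lambda>i x. indicat_real ?H x * (\<delta> x (omit i ?vs) * dirderiv (?vs ! i) ?\<phi> x)"
  have intl: "integrable lebesgue (\<lambda>x. \<alpha> j x ws * dirderiv v ?\<phi> x)" if "j \<in> X" for j ws v
    by (rule polyf_integration_by_parts(1)[OF pform_polyf[OF \<alpha>[OF that]] \<phi>])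
  have intJ: "integrable lebesgue (?J i)" for i
  proof -
    have "integrable lebesgue (\<lambda>x. indicat_real ?H x *\<^sub>R (\<alpha> m x (omit i ?vs) * dirderiv (?vs ! i) ?\<phi> x - \<alpha> l x (omit i ?vs) * dirderiv (?vs ! i) ?\<phi> x))"
      using open_lam_less by (intro integrable_mult_indicator Bochner_Integration.integrable_diff intl lm) auto
    then show ?thesis by (simp add: \<delta>_def left_diff_distrib)
  qed
  have J: "(LINT x|lebesgue. pw (\<lambda>l x. \<alpha> l x (omit i ?vs)) x * dirderiv (?vs ! i) ?\<phi> x) 
     - (LINT x|lebesgue. \<alpha> l x (omit i ?vs) * dirderiv (?vs ! i) ?\<phi> x) = (LINT x|lebesgue. ?J i x)" for i
  proof -
    have intpw: "integrable lebesgue (\<lambda>x. pw (\<lambda>l x. \<alpha> l x (omit i ?vs)) x * dirderiv (?vs ! i) ?\<phi> x)"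
      by (intro pw_integrable intl)
    have "AE x in lebesgue. pw (\<lambda>l x. \<alpha> l x (omit i ?vs)) x * dirderiv (?vs ! i) ?\<phi> x 
       - \<alpha> l x (omit i ?vs) * dirderiv (?vs ! i) ?\<phi> x = ?J i x"
      using AE_cell
    proof (rule AE_mp, intro AE_I2 impI)
      fix x assume "\<exists>j\<in>X. x \<in> cell j"
      then obtain j where j: "j \<in> X" "x \<in> cell j" by blast
      show "pw (\<lambda>l x. \<alpha> l x (omit i ?vs)) x * dirderiv (?vs ! i) ?\<phi> x 
       - \<alpha> l x (omit i ?vs) * dirderiv (?vs ! i) ?\<phi> x = ?J i x"
      proof (cases "x \<in> V")
        case True
        have "j \<in> {l, m}"
        proof (rule ccontr)
          assume "j \<notin> {l, m}"
          then have "lam l x < lam j x" "lam j x < lam l x" using True j lm by (auto simp: V_def cell_def)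
          then show False by simp
        qed
        then show ?thesis
        proof (elim insertE)
          assume "j = l"
          then have "lam l x < lam m x" using j lm unfolding cell_def by blast
          then have "x \<notin> ?H" by simp
          then show ?thesis using pw_cell[OF j] \<open>j = l\<close> by simp
        next
          assume "j = m"
          then have "x \<in> ?H" using j lm unfolding cell_def by blast
          then show ?thesis using pw_cell[OF j] \<open>j = m\<close> by (simp add: \<delta>_def left_diff_distrib)
        qed simp
      next
        case False
        then show ?thesis using test_function_outside(2)[OF \<phi>V] by simp
      qed
    qed
    then have "(LINT x|lebesgue. pw (\<lambda>l x. \<alpha> l x (omit i ?vs)) x * dirderiv (?vs ! i) ?\<phi> x 
       - \<alpha> l x (omit i ?vs) * dirderiv (?vs ! i) ?\<phi> x) = (LINT x|lebesgue. ?J i x)"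
      using intpw intl[OF lm(1)] intJ 
      by (intro integral_cong_AE borel_measurable_integrable Bochner_Integration.integrable_diff)
    then show ?thesis
      using Bochner_Integration.integral_diff[OF intpw intl[OF lm(1)], of "omit i ?vs" "?vs ! i"] by simp
  qed
  have "(\<Sum>i\<le>k. (- 1) ^ i * (LINT x|lebesgue. pw (\<lambda>l x. \<alpha> l x (omit i ?vs)) x * dirderiv (?vs ! i) ?\<phi> x)) = 0"
    using weak \<phi> vs' unfolding weakly_closed_def by blast
  moreover have "(\<Sum>i\<le>k. (- 1) ^ i * (LINT x|lebesgue. \<alpha> l x (omit i ?vs) * dirderiv (?vs ! i) ?\<phi> x)) = 0"
    using pform_weak_ext_d(2)[OF \<alpha>[OF lm(1)] \<phi> vs'] by (simp only: closed) simp
  ultimately have "(\<Sum>i\<le>k. (- 1) ^ i * (LINT x|lebesgue. ?J i x)) = 0"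
    unfolding J[symmetric] right_diff_distrib sum_subtractf by simp
  also have "(\<Sum>i\<le>k. (- 1) ^ i * (LINT x|lebesgue. ?J i x)) = (LINT x|lebesgue. (\<Sum>i\<le>k. (- 1) ^ i * ?J i x))"
    using intJ by (subst Bochner_Integration.integral_sum) (auto intro!: integrable_mult_right)
  finally have int0: "(LINT x|lebesgue. (\<Sum>i\<le>k. (- 1) ^ i * ?J i x)) = 0" .
  have G: "G x = - s * (\<Sum>i\<le>k. (- 1) ^ i * ?J i x)" for x
  proof -
    have "(\<Sum>i\<le>k. (- 1) ^ i * ?J i x) = indicat_real ?H x * (\<delta> x vs * dirderiv N ?\<phi> x 
       - (\<Sum>i<k. (- 1) ^ i * \<delta> x (N # omit i vs) * dirderiv (vs ! i) ?\<phi> x))"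
      by (simp add: sum.atMost_shift sum_negf sum_distrib_left right_diff_distrib mult_ac)
    also have "\<dots> = indicat_real ?H x * (- 2 * bump_slope q R x * E x)"
      by (simp add: dirderiv_bump E_def sum_distrib_left right_diff_distrib sum_negf mult_ac)
    finally show ?thesis by (simp add: G_def)
  qed
  have "0 < (LINT x|lebesgue. G x)"
  proof (rule integral_pos[of G "?H \<inter> ball q R" "p + ((R - \<sigma> * norm N) / (2 * norm N)) *\<^sub>R N"])
    show "integrable lebesgue G"
      unfolding G[abs_def] by (intro integrable_mult_right Bochner_Integration.integrable_sum intJ)
    show pos: "0 < G x" if "x \<in> ?H \<inter> ball q R" for x
      using that \<tau>(3)[OF cap[of x]] bump_sign(3)[of q x R] by (simp add: G_def zero_less_mult_iff)
    show "0 \<le> G x" for x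
    proof (cases "x \<in> ?H \<inter> ball q R")
      case False
      then show ?thesis using bump_sign(4)[of R q x] R(1) by (auto simp: G_def indicator_def)
    qed (use pos in force)
    show "open (?H \<inter> ball q R)" using open_lam_less by auto
    let ?t = "(R - \<sigma> * norm N) / (2 * norm N)"
    have t: "0 < ?t" "(?t + \<sigma>) * norm N < R" using R N0 by (auto simp: field_simps)
    have "0 < ?t * (N \<bullet> N)" by (rule mult_pos_pos[OF t(1)]) (use N0 in simp)
    then have "0 < lam l (p + ?t *\<^sub>R N) - lam m (p + ?t *\<^sub>R N)" 
      unfolding H add_diff_cancel_left' inner_scaleR_right .
    moreover have "q - (p + ?t *\<^sub>R N) = - ((?t + \<sigma>) *\<^sub>R N)" by (simp add: q_def algebra_simps)
    then have "dist q (p + ?t *\<^sub>R N) = (?t + \<sigma>) * norm N" 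
      unfolding dist_norm using t(1) \<sigma>(1) by simp
    ultimately show "p + ?t *\<^sub>R N \<in> ?H \<inter> ball q R" using t(2) by simp
  qed
  then show False unfolding G using int0 by simp
qed

text \<open>Near \<open>p\<close>, the hyperplane is the common face of the two pieces, and the previous lemma applies.  Along the line from \<open>p\<close> to \<open>x\<close>
  the identity then extends as one between polynomials.\<close>

lemma weakly_closed_tangential:
  assumes \<alpha>: "\<And>l. l \<in> X \<Longrightarrow> pform r k (\<alpha> l)" and weak: "weakly_closed W k \<alpha>" 
    and closed: "\<And>x vs. ext_d k (\<alpha> l) x vs = 0"
    and W: "open W" "p \<in> W" and lm: "l \<in> X" "m \<in> X" "l \<noteq> m"
    and p: "lam l p = lam m p" "\<And>j. j \<in> X - {l, m} \<Longrightarrow> lam l p < lam j p"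
    and x: "lam l x = lam m x" and tang: "\<And>v. v \<in> set vs \<Longrightarrow> (a m - a l) \<bullet> v = 0"
  shows "\<alpha> l x vs = \<alpha> m x vs"
proof (cases "length vs = k")
  case True
  let ?V = "W \<inter> (\<Inter>j\<in>X - {l, m}. {x. lam l x < lam j x})"
  have V: "open ?V" "p \<in> ?V" using W fin p by (auto intro!: open_Int open_INT open_lam_less)
  obtain \<epsilon> where \<epsilon>: "0 < \<epsilon>" "\<forall>t. 0 < t \<longrightarrow> t < \<epsilon> \<longrightarrow> p + t *\<^sub>R (x - p) \<in> ?V" 
    using open_contains_segment[OF V, of "x - p"] by blast
  have "(\<lambda>x. \<alpha> l x vs - \<alpha> m x vs) (p + 1 *\<^sub>R (x - p)) = 0"
  proof (rule polyf_zero_line[OF polyf_diff[OF pform_polyf[OF \<alpha>[OF lm(1)]] pform_polyf[OF \<alpha>[OF lm(2)]]] \<epsilon>(1)])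
    fix t assume "0 < t" "t < \<epsilon>"
    then have y: "p + t *\<^sub>R (x - p) \<in> ?V" using \<epsilon>(2) by blast
    have "lam l y = lam m y \<longleftrightarrow> (c m - c l) + (a m - a l) \<bullet> y = 0" for y
      unfolding lam_diff[symmetric] by auto
    then have "(c m - c l) + (a m - a l) \<bullet> p = 0" "(a m - a l) \<bullet> x = (a m - a l) \<bullet> p" using x p(1) by force+
    then have "lam m (p + t *\<^sub>R (x - p)) - lam l (p + t *\<^sub>R (x - p)) = 0"
      unfolding lam_diff inner_add_right inner_scaleR_right by (simp add: inner_diff_right)
    then have "\<alpha> l (p + t *\<^sub>R (x - p)) vs = \<alpha> m (p + t *\<^sub>R (x - p)) vs"
      using y lm tang True
      by (intro weakly_closed_tangential_at[of r k \<alpha> W l _ m, OF \<alpha> weak closed W(1)]) auto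
    then show "\<alpha> l (p + t *\<^sub>R (x - p)) vs - \<alpha> m (p + t *\<^sub>R (x - p)) vs = 0" by simp
  qed
  then show ?thesis by simp
next
  case False
  then show ?thesis using alt_maps_length[OF pform_alt[OF \<alpha>]] lm by simp
qed

lemma weak_derivative_of_primitive:
  assumes \<rho>: "\<And>l. l \<in> X \<Longrightarrow> pform s k (\<rho> l)" "\<And>l x vs. l \<in> X \<Longrightarrow> ext_d k (\<rho> l) x vs = \<alpha> l x vs"
    and R: "\<And>l x. l \<in> X \<Longrightarrow> x \<in> cell l \<Longrightarrow> R x = \<rho> l x" "\<And>vs. loclip (\<lambda>x. R x vs)"
    and \<phi>: "\<phi> \<in> test_functions W" and vs: "length vs = Suc k"
  shows "(LINT x|lebesgue. pw (\<lambda>l x. \<alpha> l x vs) x * \<phi> x) =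
    - (\<Sum>i\<le>k. (- 1) ^ i * (LINT x|lebesgue. R x (omit i vs) * dirderiv (vs ! i) \<phi> x))"
proof -
  let ?g = "\<lambda>i. pw (\<lambda>l. dirderiv (vs ! i) (\<lambda>y. \<rho> l y (omit i vs)))"
  have meas: "?g i \<in> borel_measurable lebesgue" for i
    by (intro pw_measurable polyf_continuous[OF polyf_dirderiv[OF pform_polyf[OF \<rho>(1)]]])
  have deriv: "AE x in lebesgue. ((\<lambda>t. R (x + t *\<^sub>R (vs ! i)) (omit i vs)) has_field_derivative ?g i x) (at 0)" for i
    using AE_cell
  proof (rule AE_mp, intro AE_I2 impI)
    fix x assume "\<exists>l\<in>X. x \<in> cell l"
    then obtain l where l: "l \<in> X" "x \<in> cell l" by blast
    have "((\<lambda>t. \<rho> l (x + t *\<^sub>R (vs ! i)) (omit i vs)) has_field_derivative ?g i x) (at 0)"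
      using has_field_derivative_line[of "\<lambda>y. \<rho> l y (omit i vs)" x 0 "vs ! i", OF pform_differentiable[OF \<rho>(1)[OF l(1)]]]
      by (simp add: pw_cell[OF l])
    then show "((\<lambda>t. R (x + t *\<^sub>R (vs ! i)) (omit i vs)) has_field_derivative ?g i x) (at 0)"
    proof (rule has_field_derivative_transform_within_open[of _ _ _ "(\<lambda>t. x + t *\<^sub>R (vs ! i)) -` cell l"])
      show "open ((\<lambda>t. x + t *\<^sub>R (vs ! i)) -` cell l)"
        by (intro open_vimage open_cell continuous_intros)
    qed (use l R(1)[OF l(1)] in auto)
  qed
  note r = integration_by_parts[OF R(2) \<phi> meas deriv]
  have "AE x in lebesgue. pw (\<lambda>l x. \<alpha> l x vs) x * \<phi> x = (\<Sum>i\<le>k. (- 1) ^ i * (?g i x * \<phi> x))"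
    using AE_cell
  proof (rule AE_mp, intro AE_I2 impI)
    fix x assume "\<exists>l\<in>X. x \<in> cell l"
    then obtain l where l: "l \<in> X" "x \<in> cell l" by blast
    show "pw (\<lambda>l x. \<alpha> l x vs) x * \<phi> x = (\<Sum>i\<le>k. (- 1) ^ i * (?g i x * \<phi> x))"
      using vs \<rho>(2)[OF l(1), of x vs, symmetric] 
      by (simp add: pw_cell[OF l] ext_d_def sum_distrib_right mult.assoc)
  qed
  moreover have "continuous_on UNIV (\<lambda>x. \<alpha> l x vs)" if "l \<in> X" for l
    using polyf_continuous[OF pform_polyf[OF pform_ext_d[OF \<rho>(1)[OF that]]]] \<rho>(2)[OF that] by simp
  then have "(\<lambda>x. pw (\<lambda>l x. \<alpha> l x vs) x * \<phi> x) \<in> borel_measurable lebesgue"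
    using continuous_at_imp_continuous_on[of UNIV \<phi>] 
      differentiable_imp_continuous_within[OF test_function_differentiable[OF \<phi>]]
    by (intro borel_measurable_times pw_measurable continuous_borel_measurable_lebesgue) auto
  moreover have int: "integrable lebesgue (\<lambda>x. (- 1) ^ i * (?g i x * \<phi> x))" for i
    by (intro integrable_mult_right r(2))
  ultimately have "(LINT x|lebesgue. pw (\<lambda>l x. \<alpha> l x vs) x * \<phi> x) = 
      (LINT x|lebesgue. (\<Sum>i\<le>k. (- 1) ^ i * (?g i x * \<phi> x)))"
    by (intro integral_cong_AE borel_measurable_integrable[OF Bochner_Integration.integrable_sum]) auto
  also have "\<dots> = (\<Sum>i\<le>k. (- 1) ^ i * (LINT x|lebesgue. ?g i x * \<phi> x))"
    using int by (subst Bochner_Integration.integral_sum) auto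
  finally show ?thesis by (simp add: r(3) sum_negf)
qed

end

section \<open>The Alfeld split\<close>

locale simplex =
  fixes X :: "'a::euclidean_space set"
  assumes indep: "\<not> affine_dependent X" and card_X: "card X = DIM('a) + 1"
begin

lemma finite_X: "finite X" and X_nonempty: "X \<noteq> {}"
  using card_X card.infinite by fastforce+

lemma barycentric_coordinate:
  assumes "l \<in> X" shows "\<exists>c a. \<forall>j\<in>X. c + a \<bullet> j = (if j = l then 1 else 0)"
proof -
  have "X \<noteq> {l}" using card_X by auto
  then obtain x0 where x0: "x0 \<in> X" "x0 \<noteq> l" using assms by blast
  have "independent ((\<lambda>x. - x0 + x) ` (X - {x0}))"
    using affine_dependent_iff_dependent2[OF x0(1)] indep by simp
  from linear_independent_extend[OF this, of "\<lambda>y. if y = - x0 + l then 1 else 0::real"]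
  obtain g where g: "linear g" "\<And>y. y \<in> (\<lambda>x. - x0 + x) ` (X - {x0}) \<Longrightarrow> g y = (if y = - x0 + l then 1 else 0::real)" 
    by blast
  define a where "a = (\<Sum>b\<in>Basis. g b *\<^sub>R b)"
  have a: "a \<bullet> y = g y" for y
  proof -
    have "g y = g (\<Sum>b\<in>Basis. (y \<bullet> b) *\<^sub>R b)" by (simp add: euclidean_representation)
    also have "\<dots> = a \<bullet> y"
      unfolding linear_sum[OF g(1)] linear_cmul[OF g(1)] a_def 
      by (simp add: inner_sum_left inner_sum_right inner_commute mult.commute)
    finally show ?thesis by simp
  qed
  have "- (a \<bullet> x0) + a \<bullet> j = (if j = l then 1 else 0)" if "j \<in> X" for j
  proof -
    have "- (a \<bullet> x0) + a \<bullet> j = g (- x0 + j)" unfolding a[symmetric] by (simp add: inner_diff_right)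
    also have "\<dots> = (if j = l then 1 else 0)"
      using g(2)[of "- x0 + j"] that x0 linear_0[OF g(1)] by (cases "j = x0") auto
    finally show ?thesis .
  qed
  then show ?thesis by blast
qed

text \<open>The barycentric coordinate of the vertex \<open>l\<close> is \<open>x \<mapsto> bc l + ba l \<bullet> x\<close>.\<close>

definition bc :: "'a \<Rightarrow> real" where
  "bc l = (SOME c. \<exists>a. \<forall>j\<in>X. c + a \<bullet> j = (if j = l then 1 else 0))"

definition ba :: "'a \<Rightarrow> 'a" where
  "ba l = (SOME a. \<forall>j\<in>X. bc l + a \<bullet> j = (if j = l then 1 else 0))"

lemma bary_vertex: "l \<in> X \<Longrightarrow> j \<in> X \<Longrightarrow> bc l + ba l \<bullet> j = (if j = l then 1 else 0)"
proof -
  assume l: "l \<in> X" and j: "j \<in> X"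
  have "\<exists>a. \<forall>j\<in>X. bc l + a \<bullet> j = (if j = l then 1 else 0)"
    unfolding bc_def by (rule someI_ex[OF barycentric_coordinate[OF l]])
  from someI_ex[OF this] j show ?thesis unfolding ba_def by blast
qed

lemma bary_sum:
  assumes "l \<in> X" "sum u X = 1" shows "bc l + ba l \<bullet> (\<Sum>j\<in>X. u j *\<^sub>R j) = u l"
proof -
  have "bc l + ba l \<bullet> (\<Sum>j\<in>X. u j *\<^sub>R j) = (\<Sum>j\<in>X. u j * (bc l + ba l \<bullet> j))"
    using assms(2) by (simp add: inner_sum_right distrib_left sum.distrib flip: sum_distrib_right)
  also have "\<dots> = (\<Sum>j\<in>X. if j = l then u l else 0)"
    using assms(1) by (intro sum.cong) (auto simp: bary_vertex)
  finally show ?thesis using assms(1) finite_X by simp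
qed

lemma bary_barycenter: "l \<in> X \<Longrightarrow> bc l + ba l \<bullet> barycenter X = 1 / real (card X)"
  using bary_sum[of l "\<lambda>_. 1 / real (card X)"] card_X 
  by (simp add: barycenter_def scaleR_sum_right)

sublocale fan X bc ba "\<lambda>m. m - barycenter X"
proof
  fix l m assume lm: "l \<in> X" "m \<in> X" "l \<noteq> m"
  have "ba m \<bullet> m - ba m \<bullet> barycenter X = 1 - 1 / real (card X)"
    using bary_vertex[of m m] bary_barycenter[of m] lm by simp
  moreover have "ba l \<bullet> m - ba l \<bullet> barycenter X = - (1 / real (card X))"
    using bary_vertex[of l m] bary_barycenter[of l] lm by simp
  ultimately show "(ba m - ba l) \<bullet> (m - barycenter X) = 1"
    by (simp add: inner_diff_left inner_diff_right)
qed (rule finite_X X_nonempty)+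

lemma lam_sum: "l \<in> X \<Longrightarrow> sum u X = 1 \<Longrightarrow> lam l (\<Sum>j\<in>X. u j *\<^sub>R j) = u l"
  unfolding lam_def by (rule bary_sum)

lemma representation: "(\<Sum>l\<in>X. lam l x) = 1" "(\<Sum>l\<in>X. lam l x *\<^sub>R l) = x"
proof -
  have "x \<in> affine hull X" using affine_independent_span_eq[OF indep] card_X by simp
  then obtain u where u: "sum u X = 1" "(\<Sum>j\<in>X. u j *\<^sub>R j) = x"
    unfolding affine_hull_finite[OF finite_X] by blast
  have "lam l x = u l" if "l \<in> X" for l using lam_sum[OF that u(1)] u(2) by simp
  then show "(\<Sum>l\<in>X. lam l x) = 1" "(\<Sum>l\<in>X. lam l x *\<^sub>R l) = x" using u by simp_all
qed

lemma simplex_eq: "convex hull X = {x. \<forall>l\<in>X. 0 \<le> lam l x}"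
proof (intro equalityI subsetI)
  fix x assume "x \<in> convex hull X"
  then obtain u where u: "\<forall>j\<in>X. 0 \<le> u j" "sum u X = 1" "(\<Sum>j\<in>X. u j *\<^sub>R j) = x"
    unfolding convex_hull_finite[OF finite_X] by blast
  have "0 \<le> lam l x" if "l \<in> X" for l using lam_sum[OF that u(2)] u(1,3) that by simp
  then show "x \<in> {x. \<forall>l\<in>X. 0 \<le> lam l x}" by simp
next
  fix x assume "x \<in> {x. \<forall>l\<in>X. 0 \<le> lam l x}"
  then show "x \<in> convex hull X"
    unfolding convex_hull_finite[OF finite_X] using representation[of x] 
    by (intro CollectI exI[of _ "\<lambda>l. lam l x"]) simp
qed

definition piece :: "'a \<Rightarrow> 'a set" where
  "piece l = convex hull (insert (barycenter X) (X - {l}))"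

lemma piece_eq:
  assumes l: "l \<in> X" shows "piece l = {x \<in> convex hull X. \<forall>j\<in>X. lam l x \<le> lam j x}"
proof (intro equalityI subsetI)
  have "convex {x. lam l x \<le> lam j x}" for j
  proof -
    have "{x. lam l x \<le> lam j x} = {x. (ba l - ba j) \<bullet> x \<le> bc j - bc l}"
      by (auto simp: lam_def inner_diff_left)
    then show ?thesis by (simp add: convex_halfspace_le)
  qed
  then have "convex (convex hull X \<inter> (\<Inter>j\<in>X. {x. lam l x \<le> lam j x}))"
    by (intro convex_Int convex_INT convex_convex_hull) auto
  moreover have "insert (barycenter X) (X - {l}) \<subseteq> convex hull X \<inter> (\<Inter>j\<in>X. {x. lam l x \<le> lam j x})"
    using bary_barycenter bary_vertex l hull_subset[of X convex] by (auto simp: simplex_eq lam_def)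
  ultimately have "piece l \<subseteq> convex hull X \<inter> (\<Inter>j\<in>X. {x. lam l x \<le> lam j x})"
    unfolding piece_def by (intro hull_minimal)
  then show "x \<in> {x \<in> convex hull X. \<forall>j\<in>X. lam l x \<le> lam j x}" if "x \<in> piece l" for x using that by blast
next
  fix x assume x: "x \<in> {x \<in> convex hull X. \<forall>j\<in>X. lam l x \<le> lam j x}"
  \<comment> \<open>The part \<open>lam l x\<close> of all coordinates is collected in a multiple of the barycenter; the rest has no component at \<open>l\<close>.\<close>
  define w where "w j = (if j = l then real (card X) * lam l x else lam j x - lam l x)" for j
  define y where "y j = (if j = l then barycenter X else j)" for j
  have w: "w j = (lam j x - lam l x) + (if j = l then real (card X) * lam l x else 0)" for j
    by (simp add: w_def)
  have "sum w X = (\<Sum>j\<in>X. lam j x)" 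
    unfolding w sum.distrib using l finite_X by (simp add: sum_subtractf)
  then have 1: "sum w X = 1" using representation[of x] by simp
  have wy: "w j *\<^sub>R y j = (lam j x *\<^sub>R j - lam l x *\<^sub>R j) + (if j = l then lam l x *\<^sub>R (\<Sum>j\<in>X. j) else 0)" for j
    using card_X by (simp add: w_def y_def barycenter_def scaleR_diff_left)
  have "(\<Sum>j\<in>X. w j *\<^sub>R y j) = (\<Sum>j\<in>X. lam j x *\<^sub>R j)"
    unfolding wy sum.distrib using l finite_X by (simp add: sum_subtractf flip: scaleR_sum_right)
  then have 2: "(\<Sum>j\<in>X. w j *\<^sub>R y j) = x" using representation[of x] by simp
  have "(\<Sum>j\<in>X. w j *\<^sub>R y j) \<in> piece l"
    unfolding piece_def using x l finite_X 1
    by (intro convex_sum) (auto simp: w_def y_def simplex_eq intro: hull_inc)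
  then show "x \<in> piece l" using 2 by simp
qed

lemma alfeld_split_eq: "alfeld_split X = piece ` X"
  by (simp add: alfeld_split_def piece_def)

lemma simplex_covered:
  "\<exists>l\<in>X. \<forall>j\<in>X. lam l x \<le> lam j x"
  using arg_min_if_finite[OF finite_X X_nonempty, of "\<lambda>l. lam l x"] by (metis not_le)

text \<open>For a singleton \<open>S\<close> this is a point inside a piece, for a pair it is a point of the common face of two pieces and of no
  other piece.\<close>

lemma interior_point:
  assumes "S \<subseteq> X" "S \<noteq> {}"
  obtains p t where "p \<in> interior (convex hull X)" "\<And>j. j \<in> S \<Longrightarrow> lam j p = t" "\<And>j. j \<in> X - S \<Longrightarrow> t < lam j p"
proof -
  have fS: "finite S" using assms finite_X finite_subset by blast
  \<comment> \<open>The weights are \<open>t\<close> on \<open>S\<close> and \<open>2 * t\<close> elsewhere, with sum \<open>1\<close>.\<close>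
  define t where "t = 1 / (real (card S) + 2 * real (card (X - S)))"
  define u where "u j = (if j \<in> S then t else 2 * t)" for j
  have den: "0 < real (card S) + 2 * real (card (X - S))" 
    using assms fS by (simp add: card_gt_0_iff add_pos_nonneg)
  then have t: "0 < t" by (simp add: t_def)
  have "sum u X = sum u S + sum u (X - S)" using assms finite_X by (metis add.commute sum.subset_diff)
  also have "sum u S = real (card S) * t" by (simp add: u_def)
  also have "sum u (X - S) = real (card (X - S)) * (2 * t)" by (simp add: u_def)
  also have "real (card S) * t + real (card (X - S)) * (2 * t) = (real (card S) + 2 * real (card (X - S))) * t"
    by (simp add: algebra_simps)
  also have "\<dots> = 1" using den by (simp add: t_def)
  finally have u: "sum u X = 1" .
  let ?p = "\<Sum>j\<in>X. u j *\<^sub>R j"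
  have lam: "lam j ?p = u j" if "j \<in> X" for j by (rule lam_sum[OF that u])
  have "open (\<Inter>l\<in>X. {x. 0 < lam l x})"
    using finite_X by (intro open_INT ballI open_Collect_less lam_continuous continuous_on_const) auto
  moreover have "(\<Inter>l\<in>X. {x. 0 < lam l x}) \<subseteq> convex hull X" by (force simp: simplex_eq)
  moreover have "?p \<in> (\<Inter>l\<in>X. {x. 0 < lam l x})" using lam t by (simp add: u_def)
  ultimately have "?p \<in> interior (convex hull X)" by (meson interiorI)
  then show thesis
  proof (rule that[of ?p t])
    show "lam j ?p = t" if "j \<in> S" for j using that lam[of j] assms(1) by (auto simp: u_def)
    show "t < lam j ?p" if "j \<in> X - S" for j using that lam[of j] t by (simp add: u_def)
  qed
qed

section \<open>Extension of the pieces\<close>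

text \<open>The coefficients with respect to the standard basis are polynomials on \<open>S\<close>, hence so are those for arbitrary vectors, by
  multilinearity.  The extended coefficients form an alternating map, since this amounts to identities between polynomials, which hold on
  an open set.\<close>

lemma poly_form_extends:
  assumes p: "p \<in> poly_forms_on S r k" and U: "open U" "U \<noteq> {}" "U \<subseteq> S"
  shows "\<exists>\<alpha>. pform r k \<alpha> \<and> (\<forall>x\<in>S. p x = \<alpha> x)"
proof -
  have alt: "p x \<in> alt_maps k" if "x \<in> S" for x using p that by (auto simp: poly_forms_on_def forms_on_def)
  have poly: "\<exists>f. polyf r f \<and> (\<forall>x\<in>S. p x (us @ ws) = f x)" if "set us \<subseteq> Basis" "length (us @ ws) = k" for us ws
    using that
  proof (induction ws arbitrary: us)
    case Nil
    then have "us \<in> basis_lists k" by (simp add: basis_lists_def)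
    then obtain f where "f \<in> polys_le r" "\<forall>x\<in>S. p x us = f x" using p unfolding poly_forms_on_def by blast
    then show ?case by (auto simp: polys_le_eq_polyf)
  next
    case (Cons v ws)
    have "\<exists>f. polyf r f \<and> (\<forall>x\<in>S. p x (us @ b # ws) = f x)" if "b \<in> Basis" for b
      using Cons.IH[of "us @ [b]"] Cons.prems that by simp
    then obtain f where f: "\<And>b. b \<in> Basis \<Longrightarrow> polyf r (f b)" "\<And>b x. b \<in> Basis \<Longrightarrow> x \<in> S \<Longrightarrow> p x (us @ b # ws) = f b x"
      by metis
    have "p x (us @ v # ws) = (\<Sum>b\<in>Basis. (v \<bullet> b) * f b x)" if x: "x \<in> S" for x
    proof -
      have lin: "linear (\<lambda>u. p x (us @ u # ws))" by (rule alt_maps_linear[OF alt[OF x]])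
      have "p x (us @ v # ws) = p x (us @ (\<Sum>b\<in>Basis. (v \<bullet> b) *\<^sub>R b) # ws)" by (simp add: euclidean_representation)
      also have "\<dots> = (\<Sum>b\<in>Basis. (v \<bullet> b) * p x (us @ b # ws))"
        using linear_sum[OF lin, of "\<lambda>b. (v \<bullet> b) *\<^sub>R b" Basis] by (simp add: linear_cmul[OF lin])
      finally show ?thesis using f(2) x by simp
    qed
    moreover have "polyf r (\<lambda>x. \<Sum>b\<in>Basis. (v \<bullet> b) * f b x)" by (intro polyf_sum polyf_scale f)
    ultimately show ?case by blast
  qed
  have "\<exists>f. polyf r f \<and> (\<forall>x\<in>S. p x vs = f x)" for vs
  proof (cases "length vs = k")
    case True then show ?thesis using poly[of "[]" vs] by simp
  next
    case False
    then show ?thesis using alt_maps_length[OF alt] by (intro exI[of _ "\<lambda>x. 0"]) (simp add: polyf.const)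
  qed
  then obtain f where f: "\<And>vs. polyf r (f vs)" "\<And>vs x. x \<in> S \<Longrightarrow> p x vs = f vs x" by metis
  obtain q where q: "q \<in> U" using U by blast
  have ext: "g x = 0" if "polyf r g" "\<And>x. x \<in> S \<Longrightarrow> g x = 0" for g x
    using polyf_zero_open[OF that(1) U(1) q] that(2) U(3) by blast
  have "(\<lambda>vs. f vs x) \<in> alt_maps k" for x
  proof (rule alt_mapsI)
    show "f vs x = 0" if "length vs \<noteq> k" for vs
      by (rule ext[OF f(1)]) (simp add: f(2)[symmetric] alt_maps_length[OF alt that])
    show "f (us @ v # ws @ v # xs) x = 0" for us v ws xs
      by (rule ext[OF f(1)]) (simp add: f(2)[symmetric] alt_maps_alternate[OF alt])
    show "linear (\<lambda>u. f (us @ u # vs) x)" for us vs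
    proof (rule linearI)
      fix u w and t :: real
      have "f (us @ (u + w) # vs) x - (f (us @ u # vs) x + f (us @ w # vs) x) = 0"
        by (rule ext[OF polyf_diff[OF f(1) polyf.add[OF f(1) f(1)]]]) 
          (simp add: f(2)[symmetric] alt_maps_add_arg[OF alt])
      then show "f (us @ (u + w) # vs) x = f (us @ u # vs) x + f (us @ w # vs) x" by simp
      have "f (us @ (t *\<^sub>R u) # vs) x - t * f (us @ u # vs) x = 0"
        by (rule ext[OF polyf_diff[OF f(1) polyf_scale[OF f(1)]]]) 
          (simp add: f(2)[symmetric] alt_maps_scale_arg[OF alt])
      then show "f (us @ (t *\<^sub>R u) # vs) x = t *\<^sub>R f (us @ u # vs) x" by simp
    qed
  qed
  then have "pform r k (\<lambda>x vs. f vs x)" using f(1) by (simp add: pform_def)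
  moreover have "\<forall>x\<in>S. p x = (\<lambda>vs. f vs x)" using f(2) by auto
  ultimately show ?thesis by blast
qed

lemma cell_in_piece: "l \<in> X \<Longrightarrow> x \<in> cell l \<Longrightarrow> x \<in> convex hull X \<Longrightarrow> x \<in> piece l"
  by (simp add: piece_eq cell_def) (metis DiffI empty_iff insert_iff less_le order_refl)

lemma interior_cell:
  assumes "l \<in> X" obtains p where "p \<in> interior (convex hull X)" "p \<in> cell l"
proof -
  obtain p t where p: "p \<in> interior (convex hull X)" "\<And>j. j \<in> {l} \<Longrightarrow> lam j p = t" "\<And>j. j \<in> X - {l} \<Longrightarrow> t < lam j p"
    using interior_point[of "{l}"] assms by blast
  then have "p \<in> cell l" by (auto simp: cell_def)
  then show thesis using that p(1) by blast
qed

lemma simplex_lebesgue: "convex hull X \<in> sets lebesgue" "piece l \<in> sets lebesgue"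
  unfolding piece_def using finite_X
  by (intro fmeasurableD[OF lmeasurable_compact] compact_convex_hull finite_imp_compact; simp)+

text \<open>The definition of \<open>V_space\<close> gives the polynomial pieces of \<open>\<omega>\<close> almost everywhere and on their own simplices; here they are extended
  to the whole space and taken together.\<close>

lemma V_space_pieces:
  assumes "\<omega> \<in> V_space X r k"
  obtains \<alpha> where "\<And>l. l \<in> X \<Longrightarrow> pform r k (\<alpha> l)"
    "AE x in lebesgue. x \<in> convex hull X \<longrightarrow> (\<exists>l\<in>X. x \<in> cell l \<and> \<omega> x = \<alpha> l x)"
proof -
  have "\<exists>\<alpha>. pform r k \<alpha> \<and> (AE x in lebesgue. x \<in> piece l \<longrightarrow> \<omega> x = \<alpha> x)" if l: "l \<in> X" for l
  proof -
    obtain p where p: "p \<in> poly_forms_on (piece l) r k" "AE x in lebesgue_on (piece l). \<omega> x = p x"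
      using assms l unfolding V_space_def alfeld_split_eq by blast
    have "cell l \<inter> interior (convex hull X) \<noteq> {}" using interior_cell[OF l] by blast
    moreover have "cell l \<inter> interior (convex hull X) \<subseteq> piece l"
      using cell_in_piece[OF l] interior_subset by blast
    ultimately obtain \<alpha> where \<alpha>: "pform r k \<alpha>" "\<And>x. x \<in> piece l \<Longrightarrow> p x = \<alpha> x"
      using poly_form_extends[OF p(1) open_Int[OF open_cell open_interior]] by blast
    have "AE x in lebesgue. x \<in> piece l \<longrightarrow> \<omega> x = p x"
      using p(2) simplex_lebesgue(2) by (simp add: AE_restrict_space_iff)
    then have "AE x in lebesgue. x \<in> piece l \<longrightarrow> \<omega> x = \<alpha> x"
      by (rule AE_mp) (use \<alpha>(2) in \<open>auto intro!: AE_I2\<close>)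
    then show ?thesis using \<alpha>(1) by blast
  qed
  then obtain \<alpha> where \<alpha>: "\<And>l. l \<in> X \<Longrightarrow> pform r k (\<alpha> l)" 
    "\<And>l. l \<in> X \<Longrightarrow> AE x in lebesgue. x \<in> piece l \<longrightarrow> \<omega> x = \<alpha> l x" by metis
  have "AE x in lebesgue. \<forall>l\<in>X. x \<in> piece l \<longrightarrow> \<omega> x = \<alpha> l x"
    using \<alpha>(2) finite_X by (intro AE_finite_allI) auto
  then have "AE x in lebesgue. x \<in> convex hull X \<longrightarrow> (\<exists>l\<in>X. x \<in> cell l \<and> \<omega> x = \<alpha> l x)"
    using AE_cell by eventually_elim (use cell_in_piece in blast)
  with \<alpha>(1) show thesis by (rule that)
qed

lemma integral_simplex_outside:
  assumes "\<And>x. x \<notin> convex hull X \<Longrightarrow> g x = 0"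
  shows "(LINT x|lebesgue_on (convex hull X). f x * g x) = (LINT x|lebesgue. f x * g x :: real)"
proof -
  have "(LINT x|lebesgue_on (convex hull X). f x * g x) = (LINT x|lebesgue. indicator (convex hull X) x *\<^sub>R (f x * g x))"
    using simplex_lebesgue(1) by (intro integral_restrict_space) auto
  also have "\<dots> = (LINT x|lebesgue. f x * g x)"
    using assms by (intro Bochner_Integration.integral_cong) (auto simp: indicator_def)
  finally show ?thesis .
qed

text \<open>Measurability of \<open>\<omega> x vs\<close> for general vectors comes from that of the pieces, by completeness of the Lebesgue measure.\<close>

lemma integral_simplex_pw:
  assumes \<alpha>: "\<And>l. l \<in> X \<Longrightarrow> pform r k (\<alpha> l)"
    and \<omega>: "AE x in lebesgue. x \<in> convex hull X \<longrightarrow> (\<exists>l\<in>X. x \<in> cell l \<and> \<omega> x = \<alpha> l x)"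
    and g: "continuous_on UNIV g" "\<And>x. x \<notin> convex hull X \<Longrightarrow> g x = 0"
  shows "(LINT x|lebesgue_on (convex hull X). \<omega> x vs * g x) = (LINT x|lebesgue. pw (\<lambda>l x. \<alpha> l x vs) x * g x)"
proof -
  have ae: "AE x in lebesgue. pw (\<lambda>l x. \<alpha> l x vs) x * g x = \<omega> x vs * g x"
    using \<omega>
  proof (rule AE_mp, intro AE_I2 impI)
    fix x assume *: "x \<in> convex hull X \<longrightarrow> (\<exists>l\<in>X. x \<in> cell l \<and> \<omega> x = \<alpha> l x)"
    show "pw (\<lambda>l x. \<alpha> l x vs) x * g x = \<omega> x vs * g x"
    proof (cases "x \<in> convex hull X")
      case True
      then obtain l where "l \<in> X" "x \<in> cell l" "\<omega> x = \<alpha> l x" using * by blast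
      then show ?thesis by (simp add: pw_cell)
    qed (use g in simp)
  qed
  have m: "(\<lambda>x. pw (\<lambda>l x. \<alpha> l x vs) x * g x) \<in> borel_measurable lebesgue"
    by (intro borel_measurable_times pw_measurable continuous_borel_measurable_lebesgue g
        polyf_continuous[OF pform_polyf[OF \<alpha>]])
  have "(\<lambda>x. \<omega> x vs * g x) \<in> borel_measurable lebesgue" by (rule borel_measurable_AE[OF m ae])
  from integral_cong_AE[OF m this ae] show ?thesis
    using integral_simplex_outside[of g "\<lambda>x. \<omega> x vs"] g(2) by simp
qed

lemma weakly_closed_of_weak_ext_deriv:
  assumes \<alpha>: "\<And>l. l \<in> X \<Longrightarrow> pform r k (\<alpha> l)"
    and \<omega>: "AE x in lebesgue. x \<in> convex hull X \<longrightarrow> (\<exists>l\<in>X. x \<in> cell l \<and> \<omega> x = \<alpha> l x)"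
    and weak: "weak_ext_deriv (convex hull X) k \<omega> (\<lambda>_ _. 0)"
  shows "weakly_closed (interior (convex hull X)) k \<alpha>"
  unfolding weakly_closed_def
proof (intro ballI allI impI)
  fix \<phi> and vs :: "'a list" assume \<phi>: "\<phi> \<in> test_functions (interior (convex hull X))" and vs: "length vs = Suc k"
  have "(LINT x|lebesgue. pw (\<lambda>l x. \<alpha> l x (omit i vs)) x * dirderiv (vs ! i) \<phi> x) =
    (LINT x|lebesgue_on (convex hull X). \<omega> x (omit i vs) * frechet_derivative \<phi> (at x) (vs ! i))" for i
    unfolding dirderiv_def[symmetric] using \<phi> interior_subset
    by (intro integral_simplex_pw[symmetric, OF \<alpha> \<omega>] test_function_dirderiv_continuous[OF \<phi>] test_function_outside(2)[OF \<phi>]) auto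
  then show "(\<Sum>i\<le>k. (- 1) ^ i * (LINT x|lebesgue. pw (\<lambda>l x. \<alpha> l x (omit i vs)) x * dirderiv (vs ! i) \<phi> x)) = 0"
    using weak \<phi> vs unfolding weak_ext_deriv_def by simp
qed

theorem exists_continuous_potential:
  assumes V: "\<omega> \<in> V_space X r (Suc k)" and weak: "weak_ext_deriv (convex hull X) (Suc k) \<omega> (\<lambda>_ _. 0)"
  shows "\<exists>\<rho>\<in>M_space X (Suc r) k. weak_ext_deriv (convex hull X) k \<rho> \<omega>"
proof -
  let ?W = "interior (convex hull X)"
  obtain \<alpha> where \<alpha>: "\<And>l. l \<in> X \<Longrightarrow> pform r (Suc k) (\<alpha> l)"
    and \<omega>: "AE x in lebesgue. x \<in> convex hull X \<longrightarrow> (\<exists>l\<in>X. x \<in> cell l \<and> \<omega> x = \<alpha> l x)"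
    using V_space_pieces[OF V] by blast
  have wc: "weakly_closed ?W (Suc k) \<alpha>" by (rule weakly_closed_of_weak_ext_deriv[OF \<alpha> \<omega> weak])
  have closed: "ext_d (Suc k) (\<alpha> l) x vs = 0" if l: "l \<in> X" for l x vs
  proof -
    obtain p where "p \<in> ?W" "p \<in> cell l" using interior_cell[OF l] .
    then show ?thesis by (intro weakly_closed_piece[OF \<alpha> wc open_interior _ _ l])
  qed
  have compat: "\<alpha> l x vs = \<alpha> m x vs" if lm: "l \<in> X" "m \<in> X" "lam l x = lam m x" 
    and tang: "\<And>v. v \<in> set vs \<Longrightarrow> (ba m - ba l) \<bullet> v = 0" for l m x vs
  proof (cases "l = m")
    case False
    obtain p t where p: "p \<in> ?W" "\<And>j. j \<in> {l, m} \<Longrightarrow> lam j p = t" "\<And>j. j \<in> X - {l, m} \<Longrightarrow> t < lam j p"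
      using interior_point[of "{l, m}"] lm by blast
    show ?thesis
      using p lm tang False
      by (intro weakly_closed_tangential[of r "Suc k" \<alpha> ?W l p m, OF \<alpha> wc closed open_interior]) auto
  qed simp
  obtain \<rho> R where \<rho>: "\<And>l. l \<in> X \<Longrightarrow> pform (Suc r) k (\<rho> l)" 
    "\<And>l x vs. l \<in> X \<Longrightarrow> ext_d k (\<rho> l) x vs = \<alpha> l x vs"
    and R: "\<And>l x. l \<in> X \<Longrightarrow> (\<And>j. j \<in> X \<Longrightarrow> lam l x \<le> lam j x) \<Longrightarrow> R x = \<rho> l x"
    "\<And>vs. loclip (\<lambda>x. R x vs)"
    using continuous_primitive[of r k \<alpha>, OF \<alpha> closed compat] by blast
  have alt: "R x \<in> alt_maps k" for x
  proof -
    obtain l where "l \<in> X" "\<And>j. j \<in> X \<Longrightarrow> lam l x \<le> lam j x" using simplex_covered[of x] by blast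
    then show ?thesis using R(1) pform_alt[OF \<rho>(1)] by simp
  qed
  have "R \<in> C0_forms_on (convex hull X) k"
    using alt continuous_on_subset[OF loclip_continuous[OF R(2)] subset_UNIV]
    by (auto simp: C0_forms_on_def forms_on_def)
  moreover have "R \<in> poly_forms_on (piece l) (Suc r) k" if l: "l \<in> X" for l
  proof -
    have "R x = \<rho> l x" if "x \<in> piece l" for x using that R(1)[OF l] unfolding piece_eq[OF l] by blast
    then show ?thesis using pform_alt[OF \<rho>(1)[OF l]] pform_polyf[OF \<rho>(1)[OF l]]
      by (auto simp: poly_forms_on_def forms_on_def polys_le_eq_polyf)
  qed
  ultimately have M: "R \<in> M_space X (Suc r) k" by (auto simp: M_space_def alfeld_split_eq)
  have cell: "R x = \<rho> l x" if "l \<in> X" "x \<in> cell l" for l x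
    using that by (intro R(1)) (auto simp: cell_def intro: less_imp_le)
  have "weak_ext_deriv (convex hull X) k R \<omega>"
    unfolding weak_ext_deriv_def
  proof (intro ballI allI impI)
    fix \<phi> and vs :: "'a list" assume \<phi>: "\<phi> \<in> test_functions ?W" and vs: "length vs = Suc k"
    have out: "\<phi> x = 0" "dirderiv v \<phi> x = 0" if "x \<notin> convex hull X" for x v
      using test_function_outside[OF \<phi>] that interior_subset by blast+
    have c: "continuous_on UNIV \<phi>"
      using test_function_differentiable[OF \<phi>] by (simp add: continuous_at_imp_continuous_on differentiable_imp_continuous_within)
    have "(LINT x|lebesgue_on (convex hull X). \<omega> x vs * \<phi> x) = (LINT x|lebesgue. pw (\<lambda>l x. \<alpha> l x vs) x * \<phi> x)"
      by (rule integral_simplex_pw[OF \<alpha> \<omega> c out(1)])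
    also have "\<dots> = - (\<Sum>i\<le>k. (- 1) ^ i * (LINT x|lebesgue. R x (omit i vs) * dirderiv (vs ! i) \<phi> x))"
      by (rule weak_derivative_of_primitive[OF \<rho> cell R(2) \<phi> vs])
    finally show "(LINT x|lebesgue_on (convex hull X). \<omega> x vs * \<phi> x) = - (\<Sum>i\<le>k. (- 1) ^ i *
      (LINT x|lebesgue_on (convex hull X). R x (omit i vs) * frechet_derivative \<phi> (at x) (vs ! i)))"
      unfolding dirderiv_def[symmetric] by (simp add: integral_simplex_outside[OF out(2)])
  qed
  with M show ?thesis by blast
qed

end

theorem theorem3p2:
  fixes X :: "(real ^ 'n) set" and \<omega> :: "(real ^ 'n) form" and r k :: nat
  assumes "2 \<le> CARD('n)"
    and "\<not> affine_dependent X" and "card X = CARD('n) + 1"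
    and "1 \<le> k" and "k \<le> CARD('n)"
    and "\<omega> \<in> Vd_space X r k"
    and "weak_ext_deriv (convex hull X) k \<omega> (\<lambda>_ _. 0)"
  shows "\<exists>\<rho> \<in> M_space X (r + 1) (k - 1). weak_ext_deriv (convex hull X) (k - 1) \<rho> \<omega>"
proof -
  interpret simplex X by standard (use assms(2,3) in simp_all)
  obtain m where k: "k = Suc m" using assms(4) by (metis Suc_le_D One_nat_def)
  show ?thesis
    using exists_continuous_potential[of \<omega> r m] assms(6,7) by (simp add: k Vd_space_def)
qed

end
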